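(* Let $0<\alpha<2$, $\beta\in(1,2]$ and $H'\in(0,1)$. Let $\{A_t\}_{t\ge 0}$ be a non-degenerate symmetric $\beta$-stable process with stationary increments, self-similar with exponent $H'$, defined on a probability space $(\Omega',\mathcal F',\mathbf P')$. Let $M$ be a symmetric $\alpha$-stable random measure with control measure $\mathbf P'\times\lambda$ on $\Omega'\times\mathbb R$, living on another probability space $(\Omega,\mathcal F,\mathbf P)$, where $\lambda$ is Lebesgue measure on $\mathbb R$. Then the indicator fractional stable noise $$Z_A(n):=\int_{\Omega'}\int_{\mathbb R}\left(1_{[0,A_n(\omega')]}(x)-1_{[0,A_{n-1}(\omega')]}(x)\right)M(d\omega',dx),\qquad n\in\mathbb N=\{1,2,\dots\},$$ which is a stationary symmetric $\alpha$-stable process, is mixing.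
   Context: Interval convention: for real $a,b$ with $b<a$, $[a,b]$ denotes $[b,a]$; so $[0,A_t]$ means $[A_t,0]$ when $A_t<0$. A process is symmetric $\alpha$-stable (S$\alpha$S) if all finite linear combinations of its values are S$\alpha$S random variables; $S_\alpha(\sigma)$ denotes the S$\alpha$S law with scale parameter $\sigma$, i.e. with characteristic function $\theta\mapsto\exp(-\sigma^\alpha|\theta|^\alpha)$. (The same applies with $\beta$ in place of $\alpha$; $\beta=2$ is the centered Gaussian case.) A process $\{X(t)\}_{t\ge0}$ is self-similar with exponent $H$ if for every $c>0$ the processes $\{X(ct)\}_{t\ge 0}$ and $\{c^{H}X(t)\}_{t\ge 0}$ have the same finite-dimensional distributions. It has stationary increments if for every $h\ge 0$ the processes $\{X(t+h)-X(h)\}_{t\ge0}$ and $\{X(t)-X(0)\}_{t\ge 0}$ have the same finite-dimensional distributions. By self-similarity, $A_0=0$ almost surely. Given a $\sigma$-finite measure $m$ on a measurable space $(B,\mathcal B)$, put $\mathcal B_0=\{A\in\mathcal B:m(A)<\infty\}$. An S$\alpha$S random measure $M$ with control measure $m$ is a $\sigma$-additive random set function on $\mathcal B_0$ such that $M(A)\sim S_\alpha(m(A)^{1/\alpha})$ for $A\in\mathcal B_0$, and such that $M$ is independently scattered: its values on disjoint sets are independent. The stable integral $\int f\,dM$ is defined for $f\in L^\alpha(B,m)$ and is S$\alpha$S with $\mathbf E\exp(i\theta\int f\,dM)=\exp(-|\theta|^\alpha\int|f|^\alpha\,dm)$. A stationary process is mixing if, for its law $\mu$ on sequence space and the left shift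 $T$, $\lim_{k\to\infty}\mu(U\cap T^{-k}V)=\mu(U)\mu(V)$ for all measurable sets $U,V$ of sequences. *)

theory Defs
  imports "HOL-Probability.Probability"
begin

section \<open>Symmetric stable laws and processes\<close>

text \<open>The law \<open>S\<^sub>\<alpha>(\<sigma>)\<close>. Because \<open>0 powr \<alpha> = 0\<close>, the scale \<open>\<sigma> = 0\<close> gives the point mass at 0,
  and \<open>\<alpha> = 2\<close> gives a centered Gaussian law with variance \<open>2\<sigma>\<^sup>2\<close>.\<close>

definition sas_law :: "real \<Rightarrow> real \<Rightarrow> real measure \<Rightarrow> bool" where
  "sas_law \<alpha> \<sigma> \<mu> \<longleftrightarrow> real_distribution \<mu> \<and>
     (\<forall>\<theta>. char \<mu> \<theta> = of_real (exp (- (\<sigma> powr \<alpha>) * \<bar>\<theta>\<bar> powr \<alpha>)))"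

definition sas_rv :: "real \<Rightarrow> 'w measure \<Rightarrow> ('w \<Rightarrow> real) \<Rightarrow> bool" where
  "sas_rv \<alpha> P X \<longleftrightarrow> X \<in> borel_measurable P \<and> (\<exists>\<sigma>\<ge>0. sas_law \<alpha> \<sigma> (distr P borel X))"

text \<open>A process is a function \<open>X\<close> of the time and of the sample point, of which only the values at
  times in the index set \<open>I\<close> are meaningful.\<close>

definition sas_process :: "real \<Rightarrow> 'w measure \<Rightarrow> 'i set \<Rightarrow> ('i \<Rightarrow> 'w \<Rightarrow> real) \<Rightarrow> bool" where
  "sas_process \<alpha> P I X \<longleftrightarrow>
     (\<forall>t\<in>I. X t \<in> borel_measurable P) \<and>
     (\<forall>J a. finite J \<and> J \<subseteq> I \<longrightarrow> sas_rv \<alpha> P (\<lambda>\<omega>. \<Sum>t\<in>J. a t * X t \<omega>))"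

definition same_fdd ::
    "'i set \<Rightarrow> 'v measure \<Rightarrow> ('i \<Rightarrow> 'v \<Rightarrow> real) \<Rightarrow> 'w measure \<Rightarrow> ('i \<Rightarrow> 'w \<Rightarrow> real) \<Rightarrow> bool" where
  "same_fdd I P X Q Y \<longleftrightarrow>
     (\<forall>J. finite J \<and> J \<subseteq> I \<longrightarrow>
        distr P (\<Pi>\<^sub>M t\<in>J. borel) (\<lambda>\<omega>. \<lambda>t\<in>J. X t \<omega>) =
        distr Q (\<Pi>\<^sub>M t\<in>J. borel) (\<lambda>\<omega>. \<lambda>t\<in>J. Y t \<omega>))"

definition self_similar :: "real \<Rightarrow> 'w measure \<Rightarrow> (real \<Rightarrow> 'w \<Rightarrow> real) \<Rightarrow> bool" where
  "self_similar H P X \<longleftrightarrow>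
     (\<forall>c>0. same_fdd {0..} P (\<lambda>t. X (c * t)) P (\<lambda>t \<omega>. c powr H * X t \<omega>))"

definition stationary_increments :: "'w measure \<Rightarrow> (real \<Rightarrow> 'w \<Rightarrow> real) \<Rightarrow> bool" where
  "stationary_increments P X \<longleftrightarrow>
     (\<forall>h\<ge>0. same_fdd {0..} P (\<lambda>t \<omega>. X (t + h) \<omega> - X h \<omega>) P (\<lambda>t \<omega>. X t \<omega> - X 0 \<omega>))"

definition non_degenerate :: "'w measure \<Rightarrow> (real \<Rightarrow> 'w \<Rightarrow> real) \<Rightarrow> bool" where
  "non_degenerate P X \<longleftrightarrow> (\<exists>t\<ge>0. \<not> (\<exists>c. AE \<omega> in P. X t \<omega> = c))"

section \<open>Stable random measures and stable integrals\<close>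

definition finite_sets :: "'b measure \<Rightarrow> 'b set set" where
  "finite_sets m = {D \<in> sets m. emeasure m D < \<infinity>}"

definition sas_random_measure ::
    "real \<Rightarrow> 'w measure \<Rightarrow> 'b measure \<Rightarrow> ('b set \<Rightarrow> 'w \<Rightarrow> real) \<Rightarrow> bool" where
  "sas_random_measure \<alpha> P m M \<longleftrightarrow>
     sigma_finite_measure m \<and>
     (\<forall>D\<in>finite_sets m. M D \<in> borel_measurable P \<and>
        sas_law \<alpha> (measure m D powr (1 / \<alpha>)) (distr P borel (M D))) \<and>
     (\<forall>J. finite J \<and> J \<subseteq> finite_sets m \<and> disjoint J \<longrightarrow>
        prob_space.indep_vars P (\<lambda>_. borel) M J) \<and>
     (\<forall>D :: nat \<Rightarrow> 'b set. range D \<subseteq> finite_sets m \<and> disjoint_family D \<and>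
        (\<Union>i. D i) \<in> finite_sets m \<longrightarrow>
        (AE \<omega> in P. (\<lambda>i. M (D i) \<omega>) sums M (\<Union>i. D i) \<omega>))"

text \<open>The stable integral is defined in the usual way, first for simple functions with support of
  finite control measure and then by approximation in \<open>L\<^sup>\<alpha>\<close>, the integrals of the approximating
  simple functions converging in probability.\<close>

definition simple_integrand :: "'b measure \<Rightarrow> ('b \<Rightarrow> real) \<Rightarrow> bool" where
  "simple_integrand m g \<longleftrightarrow>
     simple_function m g \<and> emeasure m {x \<in> space m. g x \<noteq> 0} < \<infinity>"

definition simple_stable_integral ::
    "'b measure \<Rightarrow> ('b set \<Rightarrow> 'w \<Rightarrow> real) \<Rightarrow> ('b \<Rightarrow> real) \<Rightarrow> 'w \<Rightarrow> real" where
  "simple_stable_integral m M g \<omega> =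
     (\<Sum>c \<in> g ` space m - {0}. c * M {x \<in> space m. g x = c} \<omega>)"

definition converges_in_prob ::
    "'w measure \<Rightarrow> (nat \<Rightarrow> 'w \<Rightarrow> real) \<Rightarrow> ('w \<Rightarrow> real) \<Rightarrow> bool" where
  "converges_in_prob P X Y \<longleftrightarrow>
     (\<forall>\<epsilon>>0. (\<lambda>k. measure P {\<omega> \<in> space P. \<bar>X k \<omega> - Y \<omega>\<bar> > \<epsilon>}) \<longlonglongrightarrow> 0)"

definition is_stable_integral ::
    "real \<Rightarrow> 'w measure \<Rightarrow> 'b measure \<Rightarrow> ('b set \<Rightarrow> 'w \<Rightarrow> real) \<Rightarrow> ('b \<Rightarrow> real) \<Rightarrow> ('w \<Rightarrow> real) \<Rightarrow> bool" where
  "is_stable_integral \<alpha> P m M f Y \<longleftrightarrow>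
     f \<in> borel_measurable m \<and> (\<integral>\<^sup>+ x. ennreal (\<bar>f x\<bar> powr \<alpha>) \<partial>m) < \<infinity> \<and>
     Y \<in> borel_measurable P \<and>
     (\<exists>g :: nat \<Rightarrow> 'b \<Rightarrow> real. (\<forall>k. simple_integrand m (g k)) \<and>
        (\<lambda>k. \<integral>\<^sup>+ x. ennreal (\<bar>g k x - f x\<bar> powr \<alpha>) \<partial>m) \<longlonglongrightarrow> 0 \<and>
        converges_in_prob P (\<lambda>k. simple_stable_integral m M (g k)) Y)"

text \<open>For \<open>f\<close> in \<open>L\<^sup>\<alpha>\<close>, the integral is determined up to almost sure equality; a version is chosen.\<close>

definition stable_integral ::
    "real \<Rightarrow> 'w measure \<Rightarrow> 'b measure \<Rightarrow> ('b set \<Rightarrow> 'w \<Rightarrow> real) \<Rightarrow> ('b \<Rightarrow> real) \<Rightarrow> 'w \<Rightarrow> real" where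
  "stable_integral \<alpha> P m M f = (SOME Y. is_stable_integral \<alpha> P m M f Y)"

section \<open>Stationarity and mixing of processes indexed by the positive integers\<close>

definition stationary :: "'w measure \<Rightarrow> (nat \<Rightarrow> 'w \<Rightarrow> real) \<Rightarrow> bool" where
  "stationary P Z \<longleftrightarrow> (\<forall>h. same_fdd {1..} P (\<lambda>n. Z (n + h)) P Z)"

definition seq_space :: "(nat \<Rightarrow> real) measure" where
  "seq_space = (\<Pi>\<^sub>M n\<in>{1..}. borel)"

definition path_law :: "'w measure \<Rightarrow> (nat \<Rightarrow> 'w \<Rightarrow> real) \<Rightarrow> (nat \<Rightarrow> real) measure" where
  "path_law P Z = distr P seq_space (\<lambda>\<omega>. \<lambda>n\<in>{1..}. Z n \<omega>)"

definition left_shift :: "(nat \<Rightarrow> real) \<Rightarrow> nat \<Rightarrow> real" where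
  "left_shift x = (\<lambda>n\<in>{1..}. x (n + 1))"

definition mixing :: "'w measure \<Rightarrow> (nat \<Rightarrow> 'w \<Rightarrow> real) \<Rightarrow> bool" where
  "mixing P Z \<longleftrightarrow>
     (\<forall>U\<in>sets seq_space. \<forall>V\<in>sets seq_space.
        (\<lambda>k. measure (path_law P Z) (U \<inter> ((left_shift ^^ k) -` V \<inter> space seq_space)))
          \<longlonglongrightarrow> measure (path_law P Z) U * measure (path_law P Z) V)"

section \<open>Indicator fractional stable noise\<close>

text \<open>\<open>closed_segment 0 a\<close> is \<open>[0, a]\<close> for \<open>a \<ge> 0\<close> and \<open>[a, 0]\<close> for \<open>a < 0\<close>.\<close>

definition indicator_kernel :: "(real \<Rightarrow> 'v \<Rightarrow> real) \<Rightarrow> nat \<Rightarrow> 'v \<times> real \<Rightarrow> real" where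
  "indicator_kernel A n = (\<lambda>(\<omega>', x).
     indicat_real (closed_segment 0 (A (real n) \<omega>')) x -
     indicat_real (closed_segment 0 (A (real n - 1) \<omega>')) x)"

definition indicator_noise ::
    "real \<Rightarrow> 'w measure \<Rightarrow> 'v measure \<Rightarrow> (('v \<times> real) set \<Rightarrow> 'w \<Rightarrow> real) \<Rightarrow>
      (real \<Rightarrow> 'v \<Rightarrow> real) \<Rightarrow> nat \<Rightarrow> 'w \<Rightarrow> real" where
  "indicator_noise \<alpha> P P' M A n =
     stable_integral \<alpha> P (P' \<Otimes>\<^sub>M lborel) M (indicator_kernel A n)"

end

theory Submission
  imports Defs
begin

text \<open>Write \<open>f\<^sub>n\<close> for the kernel of \<open>Z(n)\<close> and \<open>m\<close> for the control measure. Each \<open>f\<^sub>n\<close> takes the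
values \<open>-1, 0, 1\<close> and its support has finite measure, because \<open>A\<^sub>n - A\<^sub>n\<^sub>-\<^sub>1\<close> is symmetric stable of
index \<open>\<beta> > 1\<close> and hence integrable. So \<open>f\<^sub>n\<close> is itself a simple integrand, the stable integral of \<open>f\<^sub>n\<close>
agrees almost surely with the elementary integral of a simple function
(\<open>stable_integral_simple\<close>), and every finite combination satisfies
\<open>E cos (\<Sum> a\<^sub>j Z(j) + s) = cos s * exp (- \<integral> \<bar>\<Sum> a\<^sub>j f\<^sub>j\<bar>\<^sup>\<alpha> dm)\<close>. All three claims are read off from these
cosines.

Stationarity. For almost every \<open>x\<close>, the value \<open>f\<^sub>n(\<omega>, x)\<close> is \<open>sgn x\<close> times the difference of the
indicators of \<open>x < A\<^sub>n(\<omega>)\<close> and \<open>x < A\<^sub>n\<^sub>-\<^sub>1(\<omega>)\<close>. The sign does not depend on \<open>n\<close>, so it drops out of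
\<open>\<bar>\<Sum> a\<^sub>j f\<^sub>j\<bar>\<close>; what remains is turned into a functional of the increments
\<open>A(t + h) - A(h)\<close> by translating \<open>x\<close>, and these increments have a law that does not depend on \<open>h\<close>
(\<open>K_norm_shift\<close>).

Mixing. Where \<open>f\<^sub>i\<close> and \<open>f\<^sub>j\<close> are both nonzero, the segment between \<open>A\<^sub>j\<^sub>-\<^sub>1\<close> and \<open>A\<^sub>j\<close> meets the one
between \<open>A\<^sub>i\<^sub>-\<^sub>1\<close> and \<open>A\<^sub>i\<close>. The increments of \<open>A\<close> over unit intervals are tight, whereas \<open>\<bar>A\<^sub>j\<bar>\<close>
has the law of \<open>j\<^sup>H \<bar>A\<^sub>1\<bar>\<close>, where \<open>A\<^sub>1\<close> has no atom at 0; so the probability of meeting tends to 0, and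
by integrability of \<open>A\<^sub>i - A\<^sub>i\<^sub>-\<^sub>1\<close> the measure of the common support does too
(\<open>overlap_tendsto_0\<close>). The functions are bounded, so for \<open>F = \<Sum> a\<^sub>j f\<^sub>j\<close> and
\<open>G\<^sub>k = \<Sum> b\<^sub>j f\<^sub>j\<^sub>+\<^sub>k\<close> the integral of \<open>\<bar>F \<plusminus> G\<^sub>k\<bar>\<^sup>\<alpha>\<close> approaches the sum of the integrals of
\<open>\<bar>F\<bar>\<^sup>\<alpha>\<close> and \<open>\<bar>G\<^sub>k\<bar>\<^sup>\<alpha>\<close> (\<open>norm_nearly_disjoint\<close>): cosines of the past and of the shifted process
decorrelate. This suffices for all measurable sets of sequences, because
trigonometric polynomials in the coordinates are dense in mean
(\<open>trig_polys_dense\<close>, \<open>mixing_from_cosines\<close>). The same density shows that laws on product spaces with equal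
cosine integrals coincide (\<open>law_eqI_cosines\<close>), which is how stationarity is obtained.\<close>

section \<open>Approximation in mean by an algebra of bounded functions\<close>

text \<open>The approximation is simultaneous for a finite set of probability measures: one measure serves for
mixing, two for comparing two laws.\<close>

locale L1_approximation =
  fixes N :: "'a measure" and S :: "'a measure set" and \<A> :: "('a \<Rightarrow> real) set"
  assumes finite_S: "finite S"
    and prob_S: "\<mu> \<in> S \<Longrightarrow> prob_space \<mu>"
    and sets_S [measurable_cong]: "\<mu> \<in> S \<Longrightarrow> sets \<mu> = sets N"
    and meas_A: "p \<in> \<A> \<Longrightarrow> p \<in> borel_measurable N"
    and bounded_A: "p \<in> \<A> \<Longrightarrow> \<exists>B. \<forall>x. \<bar>p x\<bar> \<le> B"
    and const_A: "(\<lambda>x. c) \<in> \<A>"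
    and add_A: "p \<in> \<A> \<Longrightarrow> q \<in> \<A> \<Longrightarrow> (\<lambda>x. p x + q x) \<in> \<A>"
    and mult_A: "p \<in> \<A> \<Longrightarrow> q \<in> \<A> \<Longrightarrow> (\<lambda>x. p x * q x) \<in> \<A>"
begin

lemma space_S: "\<mu> \<in> S \<Longrightarrow> space \<mu> = space N"
  using sets_S sets_eq_imp_space_eq by blast

definition bounded_mb :: "('a \<Rightarrow> real) \<Rightarrow> bool" where
  "bounded_mb f \<longleftrightarrow> f \<in> borel_measurable N \<and> (\<exists>B. \<forall>x\<in>space N. \<bar>f x\<bar> \<le> B)"

definition approximable :: "('a \<Rightarrow> real) \<Rightarrow> bool" where
  "approximable f \<longleftrightarrow> bounded_mb f \<and>
     (\<forall>\<epsilon>>0. \<exists>p\<in>\<A>. \<forall>\<mu>\<in>S. (\<integral>x. \<bar>f x - p x\<bar> \<partial>\<mu>) < \<epsilon>)"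

lemma bounded_mb_bound:
  assumes "bounded_mb f"
  obtains B where "B > 0" "\<And>x. x \<in> space N \<Longrightarrow> \<bar>f x\<bar> \<le> B"
proof -
  from assms obtain B where "\<forall>x\<in>space N. \<bar>f x\<bar> \<le> B" by (auto simp: bounded_mb_def)
  then show ?thesis by (intro that[of "\<bar>B\<bar> + 1"]) force+
qed

lemma bounded_mb_A: "p \<in> \<A> \<Longrightarrow> bounded_mb p"
  unfolding bounded_mb_def using meas_A bounded_A by blast

lemma bounded_mb_add:
  assumes "bounded_mb f" "bounded_mb g" shows "bounded_mb (\<lambda>x. f x + g x)"
proof -
  obtain B where B: "\<And>x. x \<in> space N \<Longrightarrow> \<bar>f x\<bar> \<le> B" using bounded_mb_bound[OF assms(1)] by blast
  obtain C where C: "\<And>x. x \<in> space N \<Longrightarrow> \<bar>g x\<bar> \<le> C" using bounded_mb_bound[OF assms(2)] by blast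
  have "\<bar>f x + g x\<bar> \<le> B + C" if "x \<in> space N" for x using B[OF that] C[OF that] by linarith
  then show ?thesis using assms unfolding bounded_mb_def by (auto intro!: exI[of _ "B + C"])
qed

lemma bounded_mb_mult:
  assumes "bounded_mb f" "bounded_mb g" shows "bounded_mb (\<lambda>x. f x * g x)"
proof -
  obtain B where B: "B > 0" "\<And>x. x \<in> space N \<Longrightarrow> \<bar>f x\<bar> \<le> B" using bounded_mb_bound[OF assms(1)] by blast
  obtain C where C: "\<And>x. x \<in> space N \<Longrightarrow> \<bar>g x\<bar> \<le> C" using bounded_mb_bound[OF assms(2)] by blast
  have "\<bar>f x * g x\<bar> \<le> B * C" if "x \<in> space N" for x
    unfolding abs_mult using B C that by (intro mult_mono) auto
  then show ?thesis using assms unfolding bounded_mb_def by (auto intro!: exI[of _ "B * C"])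
qed

lemma bounded_mb_integrable:
  assumes "bounded_mb f" "\<mu> \<in> S" shows "integrable \<mu> f"
proof -
  interpret prob_space \<mu> by (rule prob_S) fact
  obtain B where B: "\<And>x. x \<in> space N \<Longrightarrow> \<bar>f x\<bar> \<le> B" using bounded_mb_bound[OF assms(1)] by blast
  show ?thesis
    using assms B sets_S[OF assms(2)] space_S[OF assms(2)]
    by (intro integrable_const_bound[of _ B])
       (auto simp: bounded_mb_def measurable_cong_sets[OF sets_S[OF assms(2)] refl])
qed

lemma bounded_mb_const: "bounded_mb (\<lambda>x. c)"
  by (auto simp: bounded_mb_def)

lemma bounded_mb_abs_diff: "bounded_mb f \<Longrightarrow> bounded_mb g \<Longrightarrow> bounded_mb (\<lambda>x. \<bar>f x - g x\<bar>)"
  using bounded_mb_add[of f "\<lambda>x. -1 * g x"] bounded_mb_mult[OF bounded_mb_const, of g "-1"]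
  by (auto simp: bounded_mb_def)

lemma approximable_A: "p \<in> \<A> \<Longrightarrow> approximable p"
  unfolding approximable_def by (auto intro!: bounded_mb_A bexI[of _ p])

lemma approximable_close:
  assumes "bounded_mb f"
    and "\<And>\<epsilon>. \<epsilon> > 0 \<Longrightarrow> \<exists>g. approximable g \<and> (\<forall>\<mu>\<in>S. (\<integral>x. \<bar>f x - g x\<bar> \<partial>\<mu>) < \<epsilon>)"
  shows "approximable f"
  unfolding approximable_def
proof (intro conjI allI impI)
  fix \<epsilon> :: real assume "\<epsilon> > 0"
  then obtain g where g: "approximable g" "\<And>\<mu>. \<mu> \<in> S \<Longrightarrow> (\<integral>x. \<bar>f x - g x\<bar> \<partial>\<mu>) < \<epsilon>/2"
    using assms(2)[of "\<epsilon>/2"] by auto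
  then obtain p where p: "p \<in> \<A>" "\<And>\<mu>. \<mu> \<in> S \<Longrightarrow> (\<integral>x. \<bar>g x - p x\<bar> \<partial>\<mu>) < \<epsilon>/2"
    using \<open>\<epsilon> > 0\<close> unfolding approximable_def by (meson half_gt_zero)
  have bg: "bounded_mb g" using g(1) by (simp add: approximable_def)
  have "(\<integral>x. \<bar>f x - p x\<bar> \<partial>\<mu>) < \<epsilon>" if "\<mu> \<in> S" for \<mu>
  proof -
    have i1: "integrable \<mu> (\<lambda>x. \<bar>f x - g x\<bar>)" "integrable \<mu> (\<lambda>x. \<bar>g x - p x\<bar>)"
      "integrable \<mu> (\<lambda>x. \<bar>f x - p x\<bar>)"
      by (intro bounded_mb_integrable bounded_mb_abs_diff assms bg bounded_mb_A p that)+
    have "(\<integral>x. \<bar>f x - p x\<bar> \<partial>\<mu>) \<le> (\<integral>x. \<bar>f x - g x\<bar> + \<bar>g x - p x\<bar> \<partial>\<mu>)"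
      using i1 by (intro integral_mono) auto
    also have "\<dots> < \<epsilon>" using i1 g(2)[OF that] p(2)[OF that] by simp
    finally show ?thesis .
  qed
  then show "\<exists>p\<in>\<A>. \<forall>\<mu>\<in>S. (\<integral>x. \<bar>f x - p x\<bar> \<partial>\<mu>) < \<epsilon>" using p(1) by blast
qed fact

lemma approximable_add:
  assumes "approximable f" "approximable g" shows "approximable (\<lambda>x. f x + g x)"
  unfolding approximable_def
proof (intro conjI allI impI)
  show "bounded_mb (\<lambda>x. f x + g x)"
    using assms by (intro bounded_mb_add) (auto simp: approximable_def)
  fix \<epsilon> :: real assume "\<epsilon> > 0"
  obtain p where p: "p \<in> \<A>" "\<And>\<mu>. \<mu> \<in> S \<Longrightarrow> (\<integral>x. \<bar>f x - p x\<bar> \<partial>\<mu>) < \<epsilon>/2"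
    using \<open>\<epsilon> > 0\<close> assms(1) unfolding approximable_def by (meson half_gt_zero)
  obtain q where q: "q \<in> \<A>" "\<And>\<mu>. \<mu> \<in> S \<Longrightarrow> (\<integral>x. \<bar>g x - q x\<bar> \<partial>\<mu>) < \<epsilon>/2"
    using \<open>\<epsilon> > 0\<close> assms(2) unfolding approximable_def by (meson half_gt_zero)
  have b: "bounded_mb f" "bounded_mb g" "bounded_mb p" "bounded_mb q"
    using assms p q bounded_mb_A by (auto simp: approximable_def)
  have "(\<integral>x. \<bar>f x + g x - (p x + q x)\<bar> \<partial>\<mu>) < \<epsilon>" if "\<mu> \<in> S" for \<mu>
  proof -
    have i1: "integrable \<mu> (\<lambda>x. \<bar>f x - p x\<bar>)" "integrable \<mu> (\<lambda>x. \<bar>g x - q x\<bar>)"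
      "integrable \<mu> (\<lambda>x. \<bar>f x + g x - (p x + q x)\<bar>)"
      by (intro bounded_mb_integrable bounded_mb_abs_diff bounded_mb_add b that)+
    have "(\<integral>x. \<bar>f x + g x - (p x + q x)\<bar> \<partial>\<mu>) \<le> (\<integral>x. \<bar>f x - p x\<bar> + \<bar>g x - q x\<bar> \<partial>\<mu>)"
      using i1 by (intro integral_mono) auto
    also have "\<dots> < \<epsilon>" using i1 p(2)[OF that] q(2)[OF that] by simp
    finally show ?thesis .
  qed
  then show "\<exists>p\<in>\<A>. \<forall>\<mu>\<in>S. (\<integral>x. \<bar>f x + g x - p x\<bar> \<partial>\<mu>) < \<epsilon>"
    by (intro bexI[of _ "\<lambda>x. p x + q x"] add_A p q) auto
qed

text \<open>Approximate one factor at a time. Multiplying by a fixed bounded function distorts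
the distance in mean by at most a constant, and once one factor is in the algebra, the other can be
replaced as well. Only the bound of the factor that is kept enters at each stage.\<close>

lemma approximable_mult:
  assumes "approximable f" "approximable g" shows "approximable (\<lambda>x. f x * g x)"
proof -
  have key: "approximable (\<lambda>x. h x * q x)" 
    if h: "bounded_mb h" and q: "bounded_mb q" 
    and ex: "\<And>\<epsilon>. \<epsilon> > 0 \<Longrightarrow> \<exists>r. bounded_mb r \<and> approximable (\<lambda>x. r x * q x) \<and>
       (\<forall>\<mu>\<in>S. (\<integral>x. \<bar>h x - r x\<bar> \<partial>\<mu>) < \<epsilon>)" for h q
  proof (rule approximable_close)
    show "bounded_mb (\<lambda>x. h x * q x)" by (intro bounded_mb_mult h q)
    fix \<epsilon> :: real assume "\<epsilon> > 0"
    obtain B where B: "B > 0" "\<And>x. x \<in> space N \<Longrightarrow> \<bar>q x\<bar> \<le> B" using bounded_mb_bound[OF q] by blast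
    obtain r where r: "bounded_mb r" "approximable (\<lambda>x. r x * q x)"
      "\<And>\<mu>. \<mu> \<in> S \<Longrightarrow> (\<integral>x. \<bar>h x - r x\<bar> \<partial>\<mu>) < \<epsilon> / B"
      using ex[of "\<epsilon> / B"] \<open>\<epsilon> > 0\<close> B(1) by auto
    have "(\<integral>x. \<bar>h x * q x - r x * q x\<bar> \<partial>\<mu>) < \<epsilon>" if "\<mu> \<in> S" for \<mu>
    proof -
      have i1: "integrable \<mu> (\<lambda>x. \<bar>h x - r x\<bar>)" "integrable \<mu> (\<lambda>x. \<bar>h x * q x - r x * q x\<bar>)"
        by (intro bounded_mb_integrable bounded_mb_abs_diff bounded_mb_mult h q r that)+
      have "(\<integral>x. \<bar>h x * q x - r x * q x\<bar> \<partial>\<mu>) \<le> (\<integral>x. \<bar>h x - r x\<bar> * B \<partial>\<mu>)"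
      proof (intro integral_mono i1 integrable_mult_left)
        fix x assume "x \<in> space \<mu>"
        then have "\<bar>q x\<bar> \<le> B" using B(2) space_S[OF that] by auto
        then show "\<bar>h x * q x - r x * q x\<bar> \<le> \<bar>h x - r x\<bar> * B"
          by (simp flip: left_diff_distrib add: abs_mult mult_left_mono)
      qed
      also have "\<dots> = (\<integral>x. \<bar>h x - r x\<bar> \<partial>\<mu>) * B" by simp
      also have "\<dots> < \<epsilon>" using r(3)[OF that] B(1) by (simp add: field_simps)
      finally show ?thesis .
    qed
    then show "\<exists>g. approximable g \<and> (\<forall>\<mu>\<in>S. (\<integral>x. \<bar>h x * q x - g x\<bar> \<partial>\<mu>) < \<epsilon>)"
      using r(2) by blast
  qed
  have fA: "approximable (\<lambda>x. f x * q x)" if "q \<in> \<A>" for q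
  proof (rule key)
    show "bounded_mb f" "bounded_mb q" using assms that bounded_mb_A by (auto simp: approximable_def)
    fix \<epsilon> :: real assume "\<epsilon> > 0"
    then obtain p where p: "p \<in> \<A>" "\<forall>\<mu>\<in>S. (\<integral>x. \<bar>f x - p x\<bar> \<partial>\<mu>) < \<epsilon>"
      using assms(1) unfolding approximable_def by meson
    then show "\<exists>r. bounded_mb r \<and> approximable (\<lambda>x. r x * q x) \<and> (\<forall>\<mu>\<in>S. (\<integral>x. \<bar>f x - r x\<bar> \<partial>\<mu>) < \<epsilon>)"
      by (intro exI[of _ p] conjI approximable_A mult_A bounded_mb_A that) auto
  qed
  have "approximable (\<lambda>x. g x * f x)"
  proof (rule key)
    show "bounded_mb f" "bounded_mb g" using assms by (auto simp: approximable_def)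
    fix \<epsilon> :: real assume "\<epsilon> > 0"
    then obtain p where p: "p \<in> \<A>" "\<forall>\<mu>\<in>S. (\<integral>x. \<bar>g x - p x\<bar> \<partial>\<mu>) < \<epsilon>"
      using assms(2) unfolding approximable_def by meson
    then show "\<exists>r. bounded_mb r \<and> approximable (\<lambda>x. r x * f x) \<and> (\<forall>\<mu>\<in>S. (\<integral>x. \<bar>g x - r x\<bar> \<partial>\<mu>) < \<epsilon>)"
      using fA[OF p(1)] by (intro exI[of _ p] conjI bounded_mb_A) (auto simp: mult.commute)
  qed
  then show ?thesis by (simp add: mult.commute)
qed

lemma approximable_const: "approximable (\<lambda>x. c)"
  by (intro approximable_A const_A)

lemma approximable_limit:
  assumes "\<And>n. approximable (f n)"
    and lim: "\<And>x. x \<in> space N \<Longrightarrow> (\<lambda>n. f n x) \<longlonglongrightarrow> g x"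
    and bound: "\<And>n x. x \<in> space N \<Longrightarrow> \<bar>f n x\<bar> \<le> B"
  shows "approximable g"
proof (rule approximable_close)
  have f_meas: "f n \<in> borel_measurable N" for n
    using assms(1)[of n] by (auto simp: approximable_def bounded_mb_def)
  have g_bound: "\<bar>g x\<bar> \<le> B" if "x \<in> space N" for x
    using LIMSEQ_le_const2[OF tendsto_rabs[OF lim[OF that]]] bound[OF that] by blast
  have g_meas: "g \<in> borel_measurable N"
    by (rule borel_measurable_LIMSEQ_real[OF lim f_meas])
  show g: "bounded_mb g" using g_bound g_meas by (auto simp: bounded_mb_def)
  fix \<epsilon> :: real assume "\<epsilon> > 0"
  have "\<forall>\<^sub>F n in sequentially. (\<integral>x. \<bar>g x - f n x\<bar> \<partial>\<mu>) < \<epsilon>" if "\<mu> \<in> S" for \<mu>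
  proof -
    interpret prob_space \<mu> by (rule prob_S) fact
    have mc: "measurable \<mu> borel = measurable N (borel :: real measure)"
      by (rule measurable_cong_sets[OF sets_S[OF that] refl])
    have "(\<lambda>n. \<integral>x. \<bar>g x - f n x\<bar> \<partial>\<mu>) \<longlonglongrightarrow> (\<integral>x. 0 \<partial>\<mu>)"
    proof (rule integral_dominated_convergence[where w = "\<lambda>_. 2 * B"])
      show "(\<lambda>x. \<bar>g x - f n x\<bar>) \<in> borel_measurable \<mu>" for n
        unfolding mc using g_meas f_meas[of n] by measurable
      show "AE x in \<mu>. (\<lambda>n. \<bar>g x - f n x\<bar>) \<longlonglongrightarrow> 0"
      proof (rule AE_I2)
        fix x assume "x \<in> space \<mu>"
        then have "x \<in> space N" using space_S[OF that] by simp
        have "(\<lambda>n. \<bar>g x - f n x\<bar>) \<longlonglongrightarrow> \<bar>g x - g x\<bar>"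
          by (intro tendsto_intros lim) fact
        then show "(\<lambda>n. \<bar>g x - f n x\<bar>) \<longlonglongrightarrow> 0" by simp
      qed
      show "AE x in \<mu>. norm \<bar>g x - f n x\<bar> \<le> 2 * B" for n
      proof (rule AE_I2)
        fix x assume "x \<in> space \<mu>"
        then have "x \<in> space N" using space_S[OF that] by simp
        then show "norm \<bar>g x - f n x\<bar> \<le> 2 * B" using g_bound[of x] bound[of x n] by simp
      qed
    qed auto
    then show ?thesis using \<open>\<epsilon> > 0\<close> by (intro order_tendstoD(2)) auto
  qed
  then have "\<forall>\<^sub>F n in sequentially. \<forall>\<mu>\<in>S. (\<integral>x. \<bar>g x - f n x\<bar> \<partial>\<mu>) < \<epsilon>"
    using finite_S by (simp add: eventually_ball_finite)
  then obtain n where "\<forall>\<mu>\<in>S. (\<integral>x. \<bar>g x - f n x\<bar> \<partial>\<mu>) < \<epsilon>"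
    by (auto dest: eventually_happens'[rotated])
  then show "\<exists>g'. approximable g' \<and> (\<forall>\<mu>\<in>S. (\<integral>x. \<bar>g x - g' x\<bar> \<partial>\<mu>) < \<epsilon>)"
    using assms(1) by blast
qed

definition approximable_sets :: "'a set set" where
  "approximable_sets = {U \<in> sets N. approximable (indicat_real U)}"

lemma sigma_algebra_approximable_sets: "sigma_algebra (space N) approximable_sets"
proof (rule sigma_algebra_iff2[THEN iffD2], intro conjI ballI allI impI)
  show "approximable_sets \<subseteq> Pow (space N)"
    by (auto simp: approximable_sets_def dest: sets.sets_into_space)
  show "{} \<in> approximable_sets"
    using approximable_const[of 0] by (simp add: approximable_sets_def indicator_def[abs_def])
  have compl: "space N - U \<in> approximable_sets" if "U \<in> approximable_sets" for U
  proof -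
    have "approximable (\<lambda>x. 1 + (-1) * indicat_real U x)"
      using that by (intro approximable_add approximable_mult approximable_const)
        (auto simp: approximable_sets_def)
    then have "approximable (indicat_real (space N - U))"
      by (rule approximable_limit[of "\<lambda>_. _" _ 2]) (auto simp: indicator_def)
    then show ?thesis using that by (auto simp: approximable_sets_def)
  qed
  then show "space N - U \<in> approximable_sets" if "U \<in> approximable_sets" for U using that .
  fix D :: "nat \<Rightarrow> 'a set" assume "range D \<subseteq> approximable_sets"
  then have D: "D i \<in> approximable_sets" for i by auto
  \<comment> \<open>finite intersections of complements are products of indicators; their complements increase to the union\<close>
  have fin: "approximable (indicat_real (\<Inter>i<n. space N - D i))" for n
  proof (induction n)
    case 0 then show ?case using approximable_const[of 1] by (simp add: indicator_def)
  next
    case (Suc n)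
    have eq: "indicat_real (\<Inter>i<Suc n. space N - D i)
      = (\<lambda>x. indicat_real (\<Inter>i<n. space N - D i) x * indicat_real (space N - D n) x)"
      by (auto simp: indicator_def lessThan_Suc fun_eq_iff)
    show ?case unfolding eq using compl[OF D]
      by (intro approximable_mult Suc) (auto simp: approximable_sets_def)
  qed
  have "approximable (\<lambda>x. 1 + (-1) * indicat_real (\<Inter>i<n. space N - D i) x)" for n
    by (intro approximable_add approximable_mult approximable_const fin)
  then have "approximable (indicat_real (\<Union>i. D i))"
  proof (rule approximable_limit[where B = 2])
    fix x assume x: "x \<in> space N"
    show "(\<lambda>n. 1 + (-1) * indicat_real (\<Inter>i<n. space N - D i) x) \<longlonglongrightarrow> indicat_real (\<Union>i. D i) x"
    proof (cases "x \<in> (\<Union>i. D i)")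
      case True
      then obtain i where i: "x \<in> D i" by auto
      have "\<forall>\<^sub>F n in sequentially. 1 + (-1) * indicat_real (\<Inter>i<n. space N - D i) x = 1"
        using eventually_gt_at_top[of i] by eventually_elim (use i in \<open>auto simp: indicator_def\<close>)
      then show ?thesis using True by (auto intro: tendsto_eventually)
    next
      case False
      then have "indicat_real (\<Inter>i<n. space N - D i) x = 1" for n using x by (auto simp: indicator_def)
      then show ?thesis using False by simp
    qed
  qed (auto simp: indicator_def)
  then show "\<Union> (range D) \<in> approximable_sets"
    using D by (auto simp: approximable_sets_def)
qed

lemma approximable_polynomial:
  assumes "real_polynomial_function q" "approximable f"
  shows "approximable (\<lambda>x. q (f x))"
  using assms(1)
proof induction
  case (linear h)
  have "h (f x) = f x * h 1" for x
    using linear bounded_linear.linear linear_cmul[of h "f x" 1] by fastforce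
  then show ?case by (simp add: approximable_mult assms(2) approximable_const)
qed (auto intro: approximable_const approximable_add approximable_mult)

text \<open>The indicator of a superlevel set is a bounded pointwise limit of polynomials in the function: use a
steep ramp, and replace it by a polynomial by means of the Weierstrass theorem.\<close>

lemma approximable_superlevel:
  assumes "approximable f" shows "{x \<in> space N. f x > c} \<in> approximable_sets"
proof -
  have bm: "bounded_mb f" using assms by (simp add: approximable_def)
  then have mf [measurable]: "f \<in> borel_measurable N" by (simp add: bounded_mb_def)
  obtain B where B: "\<And>x. x \<in> space N \<Longrightarrow> \<bar>f x\<bar> \<le> B" using bounded_mb_bound[OF bm] by blast
  define r where "r n t = min 1 (max 0 (real n * (t - c)))" for n t
  have r_cont: "continuous_on {-B..B} (r n)" for n
    unfolding r_def by (intro continuous_intros)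
  have "\<exists>g. real_polynomial_function g \<and> (\<forall>t\<in>{-B..B}. \<bar>r n t - g t\<bar> < inverse (real (Suc n)))" for n
  proof -
    have "0 < inverse (real (Suc n))" by simp
    from Stone_Weierstrass_real_polynomial_function[OF compact_Icc r_cont this]
    obtain g where "real_polynomial_function g" "\<And>t. t \<in> {-B..B} \<Longrightarrow> \<bar>r n t - g t\<bar> < inverse (real (Suc n))"
      by metis
    then show ?thesis by blast
  qed
  then obtain q where q: "\<And>n. real_polynomial_function (q n)"
    and qr: "\<And>n t. t \<in> {-B..B} \<Longrightarrow> \<bar>r n t - q n t\<bar> < inverse (real (Suc n))"
    by metis
  have "approximable (indicat_real {x \<in> space N. f x > c})"
  proof (rule approximable_limit[where B = 2])
    show "approximable (\<lambda>x. q n (f x))" for n by (rule approximable_polynomial[OF q assms])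
    fix x assume x: "x \<in> space N"
    then have fx: "f x \<in> {-B..B}" using B[OF x] by auto
    show "\<bar>q n (f x)\<bar> \<le> 2" for n
    proof -
      have "\<bar>r n (f x)\<bar> \<le> 1" by (auto simp: r_def)
      moreover have "inverse (real (Suc n)) \<le> 1" by (simp add: field_simps)
      ultimately show ?thesis using qr[OF fx, of n] by linarith
    qed
    have "(\<lambda>n. r n (f x)) \<longlonglongrightarrow> indicat_real {x \<in> space N. f x > c} x"
    proof (cases "f x > c")
      case True
      then obtain m where m: "1 < real m * (f x - c)" using reals_Archimedean3[of "f x - c"] by auto
      have "\<forall>\<^sub>F n in sequentially. r n (f x) = 1"
        using eventually_ge_at_top[of m]
      proof eventually_elim
        case (elim n)
        then have "real m * (f x - c) \<le> real n * (f x - c)" using True by (intro mult_right_mono) auto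
        then show ?case using m by (auto simp: r_def)
      qed
      then show ?thesis using True x by (auto intro: tendsto_eventually)
    next
      case False
      then have "real n * (f x - c) \<le> 0" for n by (intro mult_nonneg_nonpos) auto
      then have "r n (f x) = 0" for n by (simp add: r_def)
      then show ?thesis using False by simp
    qed
    moreover have "(\<lambda>n. q n (f x) - r n (f x)) \<longlonglongrightarrow> 0"
      by (rule Lim_null_comparison[OF _ LIMSEQ_inverse_real_of_nat])
         (use qr[OF fx] in \<open>auto intro!: always_eventually simp: abs_minus_commute intro: less_imp_le\<close>)
    ultimately have "(\<lambda>n. r n (f x) + (q n (f x) - r n (f x))) \<longlonglongrightarrow> indicat_real {x \<in> space N. f x > c} x + 0"
      by (rule tendsto_add)
    then show "(\<lambda>n. q n (f x)) \<longlonglongrightarrow> indicat_real {x \<in> space N. f x > c} x" by simp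
  qed
  then show ?thesis by (simp add: approximable_sets_def)
qed

text \<open>The sets with approximable indicators thus form a \<open>\<sigma>\<close>-algebra that makes every function of the
algebra measurable; it contains the \<open>\<sigma>\<close>-algebra that these functions generate.\<close>

lemma approximable_measurable:
  assumes "approximable f" shows "f \<in> borel_measurable (sigma (space N) approximable_sets)"
proof (rule borel_measurable_iff_greater[THEN iffD2], rule allI)
  interpret sigma_algebra "space N" approximable_sets by (rule sigma_algebra_approximable_sets)
  fix c
  show "{w \<in> space (sigma (space N) approximable_sets). c < f w} \<in> sets (sigma (space N) approximable_sets)"
    using approximable_superlevel[OF assms, of c] space_closed by (simp add: sigma_sets_eq)
qed

end

section \<open>Trigonometric polynomials determine laws and mixing\<close>

text \<open>The phase \<open>s\<close> covers sines as well, so that the span of these cosines is closed under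
multiplication.\<close>

inductive_set trig_polys :: "'i set \<Rightarrow> (('i \<Rightarrow> real) \<Rightarrow> real) set" for I where
  cosine: "finite J \<Longrightarrow> J \<subseteq> I \<Longrightarrow> (\<lambda>x. c * cos ((\<Sum>j\<in>J. a j * x j) + s)) \<in> trig_polys I"
| add: "p \<in> trig_polys I \<Longrightarrow> q \<in> trig_polys I \<Longrightarrow> (\<lambda>x. p x + q x) \<in> trig_polys I"

lemma sum_union_extend:
  fixes a :: "'i \<Rightarrow> real"
  assumes "finite J" "finite K"
  shows "(\<Sum>j\<in>J. a j * x j) = (\<Sum>j\<in>J \<union> K. (if j \<in> J then a j else 0) * x j)"
    and "(\<Sum>j\<in>J. a j * x j) = (\<Sum>j\<in>K \<union> J. (if j \<in> J then a j else 0) * x j)"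
  using assms by (auto intro!: sum.mono_neutral_cong_left)

lemma trig_polys_mult_cosine:
  assumes J: "finite J" "J \<subseteq> I" and K: "finite K" "K \<subseteq> I"
  shows "(\<lambda>x. (c * cos ((\<Sum>j\<in>J. a j * x j) + s)) * (d * cos ((\<Sum>j\<in>K. b j * x j) + t))) \<in> trig_polys I"
proof -
  define u v where "u x = (\<Sum>j\<in>J. a j * x j) + s" and "v x = (\<Sum>j\<in>K. b j * x j) + t" for x
  define a' b' where "a' j = (if j \<in> J then a j else 0)" and "b' j = (if j \<in> K then b j else 0)" for j
  have pm: "u x + v x = (\<Sum>j\<in>J \<union> K. (a' j + b' j) * x j) + (s + t)"
    "u x - v x = (\<Sum>j\<in>J \<union> K. (a' j - b' j) * x j) + (s - t)" for x
    unfolding u_def v_def sum_union_extend(1)[OF J(1) K(1), of a x] sum_union_extend(2)[OF K(1) J(1), of b x]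
    by (simp_all add: a'_def b'_def sum.distrib sum_subtractf ring_distribs)
  have "(c * cos (u x)) * (d * cos (v x)) = (c * d / 2) * cos (u x - v x) + (c * d / 2) * cos (u x + v x)" for x
    by (simp add: cos_add cos_diff algebra_simps)
  then have "(\<lambda>x. (c * cos (u x)) * (d * cos (v x))) =
    (\<lambda>x. (c * d / 2) * cos (u x - v x) + (c * d / 2) * cos (u x + v x))" by blast
  also have "\<dots> \<in> trig_polys I"
    unfolding pm using J K by (intro trig_polys.intros) auto
  finally show ?thesis unfolding u_def v_def .
qed

lemma trig_polys_mult:
  assumes "p \<in> trig_polys I" "q \<in> trig_polys I"
  shows "(\<lambda>x. p x * q x) \<in> trig_polys I"
  using assms(1)
proof induction
  case (cosine J c a s)
  from assms(2) show ?case
  proof induction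
    case (cosine K d b t)
    show ?case by (rule trig_polys_mult_cosine) fact+
  next
    case (add q q')
    then show ?case by (simp add: distrib_left trig_polys.add)
  qed
next
  case (add p p')
  then show ?case by (simp add: distrib_right trig_polys.add)
qed

lemma trig_polys_measurable:
  assumes "p \<in> trig_polys I" shows "p \<in> borel_measurable (\<Pi>\<^sub>M i\<in>I. borel)"
  using assms
proof induction
  case (cosine J c a s)
  have [measurable]: "(\<lambda>x. x j) \<in> borel_measurable (\<Pi>\<^sub>M i\<in>I. borel)" if "j \<in> J" for j
    by (rule measurable_component_singleton) (use cosine that in auto)
  show ?case by measurable
qed simp

lemma trig_polys_bounded:
  assumes "p \<in> trig_polys I" shows "\<exists>B. \<forall>x. \<bar>p x\<bar> \<le> B"
  using assms
proof induction
  case (cosine J c a s)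
  show ?case
    by (rule exI[of _ "\<bar>c\<bar>"]) (auto simp: abs_mult mult_left_le)
next
  case (add p q)
  then obtain B C where "\<And>x. \<bar>p x\<bar> \<le> B" "\<And>x. \<bar>q x\<bar> \<le> C" by blast
  then have "\<bar>p x + q x\<bar> \<le> B + C" for x by (meson abs_triangle_ineq abs_triangle_ineq4 add_mono order_trans)
  then show ?case by blast
qed

lemma L1_approximation_trig_polys:
  assumes "finite S" "\<And>\<mu>. \<mu> \<in> S \<Longrightarrow> prob_space \<mu>"
    and "\<And>\<mu>. \<mu> \<in> S \<Longrightarrow> sets \<mu> = sets (\<Pi>\<^sub>M i\<in>I. (borel :: real measure))"
  shows "L1_approximation (\<Pi>\<^sub>M i\<in>I. borel) S (trig_polys I)"
proof (rule L1_approximation.intro)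
  show "(\<lambda>x. c) \<in> trig_polys I" for c
    using trig_polys.cosine[of "{}" I c _ 0] by simp
qed (rule assms trig_polys_measurable trig_polys_bounded trig_polys.add trig_polys_mult | assumption)+

text \<open>A coordinate is not bounded, but it is the pointwise limit of \<open>n sin (x\<^sub>i / n)\<close>. It is therefore measurable
for the \<open>\<sigma>\<close>-algebra of approximable sets, which then contains the whole product \<open>\<sigma>\<close>-algebra.\<close>

theorem trig_polys_dense:
  fixes S :: "('i \<Rightarrow> real) measure set"
  assumes S: "finite S" "\<And>\<mu>. \<mu> \<in> S \<Longrightarrow> prob_space \<mu>"
    "\<And>\<mu>. \<mu> \<in> S \<Longrightarrow> sets \<mu> = sets (\<Pi>\<^sub>M i\<in>I. borel)"
    and U: "U \<in> sets (\<Pi>\<^sub>M i\<in>I. borel)" and \<epsilon>: "\<epsilon> > 0"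
  shows "\<exists>p\<in>trig_polys I. \<forall>\<mu>\<in>S. (\<integral>x. \<bar>indicat_real U x - p x\<bar> \<partial>\<mu>) < \<epsilon>"
proof -
  let ?N = "\<Pi>\<^sub>M i\<in>I. (borel :: real measure)"
  interpret L1_approximation ?N S "trig_polys I" by (rule L1_approximation_trig_polys[OF S])
  interpret sa: sigma_algebra "space ?N" approximable_sets by (rule sigma_algebra_approximable_sets)
  let ?D = "sigma (space ?N) approximable_sets"
  have coord: "(\<lambda>x. x i) \<in> borel_measurable ?D" if "i \<in> I" for i
  proof (rule borel_measurable_LIMSEQ_real)
    \<comment> \<open>shifting the phase by a quarter period yields the sine\<close>
    have "(\<lambda>x. cos (x i / real (Suc n) - pi/2)) \<in> trig_polys I" for n
      using trig_polys.cosine[of "{i}" I 1 "\<lambda>_. 1 / real (Suc n)" "-pi/2"] that by simp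
    then have "approximable (\<lambda>x. real (Suc n) * cos (x i / real (Suc n) - pi/2))" for n
      by (intro approximable_mult approximable_const approximable_A)
    then show "(\<lambda>x. real (Suc n) * cos (x i / real (Suc n) - pi/2)) \<in> borel_measurable ?D" for n
      by (rule approximable_measurable)
    fix x :: "'i \<Rightarrow> real"
    have "((\<lambda>h. sin (x i * h) / h) \<longlongrightarrow> x i) (at 0)"
    proof -
      have "((\<lambda>h. sin (x i * h)) has_real_derivative x i) (at 0)"
        by (auto intro!: derivative_eq_intros)
      then show ?thesis by (simp add: DERIV_def)
    qed
    moreover have "filterlim (\<lambda>n. inverse (real (Suc n))) (at 0) sequentially"
      using LIMSEQ_inverse_real_of_nat by (auto simp: filterlim_at)
    ultimately have "(\<lambda>n. sin (x i * inverse (real (Suc n))) / inverse (real (Suc n))) \<longlonglongrightarrow> x i"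
      by (rule filterlim_compose)
    then have "(\<lambda>n. real (Suc n) * sin (x i / real (Suc n))) \<longlonglongrightarrow> x i"
      by (simp add: divide_inverse mult.commute del: of_nat_Suc)
    then show "(\<lambda>n. real (Suc n) * cos (x i / real (Suc n) - pi/2)) \<longlonglongrightarrow> x i"
      by (simp add: cos_diff del: of_nat_Suc)
  qed
  have "(\<lambda>x. \<lambda>i\<in>I. x i) \<in> measurable ?D ?N"
    by (rule measurable_restrict) (use coord in auto)
  then have "(\<lambda>x. \<lambda>i\<in>I. x i) -` U \<inter> space ?D \<in> sets ?D" using U by (rule measurable_sets)
  moreover have "(\<lambda>x. \<lambda>i\<in>I. x i) -` U \<inter> space ?D = U"
    using sets.sets_into_space[OF U] sa.space_closed
    by (auto simp: space_PiM PiE_def extensional_restrict)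
  ultimately have "U \<in> approximable_sets" using sa.space_closed by (simp add: sa.sigma_sets_eq)
  then have "approximable (indicat_real U)" by (simp add: approximable_sets_def)
  then show ?thesis using \<epsilon> by (simp add: approximable_def)
qed

lemma trig_polys_integrable:
  assumes "prob_space \<mu>" "sets \<mu> = sets (\<Pi>\<^sub>M i\<in>I. (borel :: real measure))" "p \<in> trig_polys I"
  shows "integrable \<mu> p"
proof -
  interpret prob_space \<mu> by fact
  obtain B where "\<And>x. \<bar>p x\<bar> \<le> B" using trig_polys_bounded[OF assms(3)] by blast
  then show ?thesis
    using trig_polys_measurable[OF assms(3)] measurable_cong_sets[OF assms(2) refl]
    by (intro integrable_const_bound[of _ B]) auto
qed

theorem law_eqI_cosines:
  fixes \<mu> \<nu> :: "('i \<Rightarrow> real) measure"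
  assumes \<mu>: "prob_space \<mu>" "sets \<mu> = sets (\<Pi>\<^sub>M i\<in>I. borel)"
    and \<nu>: "prob_space \<nu>" "sets \<nu> = sets (\<Pi>\<^sub>M i\<in>I. borel)"
    and eq: "\<And>J a s. finite J \<Longrightarrow> J \<subseteq> I \<Longrightarrow>
      (\<integral>x. cos ((\<Sum>j\<in>J. a j * x j) + s) \<partial>\<mu>) = (\<integral>x. cos ((\<Sum>j\<in>J. a j * x j) + s) \<partial>\<nu>)"
  shows "\<mu> = \<nu>"
proof (rule measure_eqI)
  show "sets \<mu> = sets \<nu>" using \<mu> \<nu> by simp
  interpret \<mu>: prob_space \<mu> by fact
  interpret \<nu>: prob_space \<nu> by fact
  have int_eq: "(\<integral>x. p x \<partial>\<mu>) = (\<integral>x. p x \<partial>\<nu>)" if "p \<in> trig_polys I" for p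
    using that
  proof induction
    case (add p q)
    then show ?case
      using trig_polys_integrable[OF \<mu>] trig_polys_integrable[OF \<nu>] by simp
  qed (simp add: eq)
  fix U assume U: "U \<in> sets \<mu>"
  have "\<bar>measure \<mu> U - measure \<nu> U\<bar> \<le> 2 * \<epsilon>" if "\<epsilon> > 0" for \<epsilon>
  proof -
    have "U \<in> sets (\<Pi>\<^sub>M i\<in>I. borel)" using U \<mu> by simp
    then have "\<exists>p\<in>trig_polys I. \<forall>\<rho>\<in>{\<mu>, \<nu>}. (\<integral>x. \<bar>indicat_real U x - p x\<bar> \<partial>\<rho>) < \<epsilon>"
      by (intro trig_polys_dense) (use \<mu> \<nu> that in auto)
    then obtain p where p: "p \<in> trig_polys I" "(\<integral>x. \<bar>indicat_real U x - p x\<bar> \<partial>\<mu>) < \<epsilon>"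
      "(\<integral>x. \<bar>indicat_real U x - p x\<bar> \<partial>\<nu>) < \<epsilon>"
      by auto
    have close: "\<bar>measure \<rho> U - (\<integral>x. p x \<partial>\<rho>)\<bar> < \<epsilon>"
      if \<rho>: "prob_space \<rho>" "sets \<rho> = sets (\<Pi>\<^sub>M i\<in>I. borel)"
        and "(\<integral>x. \<bar>indicat_real U x - p x\<bar> \<partial>\<rho>) < \<epsilon>" for \<rho>
    proof -
      interpret prob_space \<rho> by fact
      have U': "U \<in> sets \<rho>" using U \<mu> \<rho> by simp
      have "measure \<rho> U - (\<integral>x. p x \<partial>\<rho>) = (\<integral>x. indicat_real U x - p x \<partial>\<rho>)"
        using trig_polys_integrable[OF \<rho> p(1)] U' by (subst Bochner_Integration.integral_diff) (auto simp: emeasure_eq_measure sets.Int_space_eq2)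
      then show ?thesis using that(3) integral_abs_bound[of \<rho> "\<lambda>x. indicat_real U x - p x"] by linarith
    qed
    show ?thesis using close[OF \<mu> p(2)] close[OF \<nu> p(3)] int_eq[OF p(1)] by linarith
  qed
  from this[of "\<delta> / 2" for \<delta>] have "\<bar>measure \<mu> U - measure \<nu> U\<bar> \<le> 0 + \<delta>" if "\<delta> > 0" for \<delta>
    using that by simp
  then have "\<bar>measure \<mu> U - measure \<nu> U\<bar> \<le> 0" by (rule field_le_epsilon)
  then show "emeasure \<mu> U = emeasure \<nu> U" by (simp add: \<mu>.emeasure_eq_measure \<nu>.emeasure_eq_measure)
qed

lemma LIMSEQ_approx:
  fixes a :: "nat \<Rightarrow> real"
  assumes "\<And>\<epsilon>. \<epsilon> > 0 \<Longrightarrow> \<exists>b L'. b \<longlonglongrightarrow> L' \<and> (\<forall>k. \<bar>a k - b k\<bar> \<le> \<epsilon>) \<and> \<bar>L - L'\<bar> \<le> \<epsilon>"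
  shows "a \<longlonglongrightarrow> L"
proof (rule LIMSEQ_I)
  fix r :: real assume "r > 0"
  then obtain b L' where b: "b \<longlonglongrightarrow> L'" "\<And>k. \<bar>a k - b k\<bar> \<le> r/4" "\<bar>L - L'\<bar> \<le> r/4"
    using assms[of "r/4"] by auto
  obtain n where n: "\<And>k. k \<ge> n \<Longrightarrow> norm (b k - L') < r/4"
    using LIMSEQ_D[OF b(1), of "r/4"] \<open>r > 0\<close> by auto
  have "norm (a k - L) < r" if "k \<ge> n" for k
    using n[OF that] b(2)[of k] b(3) \<open>r > 0\<close> unfolding real_norm_def by linarith
  then show "\<exists>no. \<forall>n\<ge>no. norm (a n - L) < r" by blast
qed

text \<open>Correlations of \<open>f\<close> with \<open>g \<circ> T\<^sub>k\<close> are controlled by the supremum of one function times the mean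
of the other, uniformly in \<open>k\<close> because \<open>T\<^sub>k\<close> preserves the measure. So the limit passes
from trigonometric polynomials to indicators, first in \<open>f\<close> with a polynomial \<open>g\<close>, then in \<open>g\<close> with an
indicator \<open>f\<close>.\<close>

theorem mixing_from_cosines:
  fixes \<mu> :: "('i \<Rightarrow> real) measure"
  assumes \<mu>: "prob_space \<mu>" "sets \<mu> = sets (\<Pi>\<^sub>M i\<in>I. borel)"
    and T [measurable]: "\<And>k::nat. T k \<in> measurable \<mu> \<mu>"
    and inv: "\<And>k. distr \<mu> \<mu> (T k) = \<mu>"
    and cosines: "\<And>J K a b s t. finite J \<Longrightarrow> J \<subseteq> I \<Longrightarrow> finite K \<Longrightarrow> K \<subseteq> I \<Longrightarrow>
      (\<lambda>k. \<integral>x. cos ((\<Sum>j\<in>J. a j * x j) + s) * cos ((\<Sum>j\<in>K. b j * T k x j) + t) \<partial>\<mu>) \<longlonglongrightarrow>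
        (\<integral>x. cos ((\<Sum>j\<in>J. a j * x j) + s) \<partial>\<mu>) * (\<integral>x. cos ((\<Sum>j\<in>K. b j * x j) + t) \<partial>\<mu>)"
    and U: "U \<in> sets \<mu>" and V: "V \<in> sets \<mu>"
  shows "(\<lambda>k. measure \<mu> (U \<inter> (T k -` V \<inter> space \<mu>))) \<longlonglongrightarrow> measure \<mu> U * measure \<mu> V"
proof -
  interpret prob_space \<mu> by fact
  define bdd where "bdd f \<longleftrightarrow> f \<in> borel_measurable \<mu> \<and> (\<exists>B. \<forall>x. \<bar>f x\<bar> \<le> B)" for f :: "('i \<Rightarrow> real) \<Rightarrow> real"
  have bdd_int: "integrable \<mu> f" if f: "bdd f" for f
  proof -
    obtain B where "\<forall>x. \<bar>f x\<bar> \<le> B" using f unfolding bdd_def by blast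
    then show ?thesis using f unfolding bdd_def by (intro integrable_const_bound[of _ B]) auto
  qed
  have bdd_pos: "\<exists>B>0. \<forall>x. \<bar>f x\<bar> \<le> B" if f: "bdd f" for f
  proof -
    obtain B where B: "\<And>x. \<bar>f x\<bar> \<le> B" using f unfolding bdd_def by blast
    have "\<bar>f x\<bar> \<le> \<bar>B\<bar> + 1" for x using B[of x] by linarith
    moreover have "\<bar>B\<bar> + 1 > 0" by simp
    ultimately show ?thesis by blast
  qed
  have bdd_T: "bdd (\<lambda>x. f (T k x))" if "bdd f" for f k
    using that unfolding bdd_def by auto
  have bdd_mult: "bdd (\<lambda>x. f x * g x)" if f: "bdd f" and g: "bdd g" for f g
  proof -
    obtain B C where "\<And>x. \<bar>f x\<bar> \<le> B" "\<And>x. \<bar>g x\<bar> \<le> C" using f g unfolding bdd_def by blast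
    then have "\<bar>f x * g x\<bar> \<le> B * C" for x
      unfolding abs_mult by (intro mult_mono) (auto intro: order_trans[OF abs_ge_zero])
    then show ?thesis using f g unfolding bdd_def by auto
  qed
  have bdd_diff: "bdd (\<lambda>x. \<bar>f x - g x\<bar>)" if f: "bdd f" and g: "bdd g" for f g
  proof -
    obtain B C where "\<And>x. \<bar>f x\<bar> \<le> B" "\<And>x. \<bar>g x\<bar> \<le> C" using f g unfolding bdd_def by blast
    then have "\<bar>\<bar>f x - g x\<bar>\<bar> \<le> B + C" for x
      unfolding abs_idempotent by (meson abs_triangle_ineq4 add_mono order_trans)
    then show ?thesis using f g unfolding bdd_def by auto
  qed
  have bdd_p: "bdd p" if "p \<in> trig_polys I" for p
    using trig_polys_bounded[OF that] trig_polys_measurable[OF that] measurable_cong_sets[OF \<mu>(2) refl]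
    unfolding bdd_def by auto
  have bdd_ind: "bdd (indicat_real W)" if "W \<in> sets \<mu>" for W
    using that unfolding bdd_def by (auto intro!: exI[of _ 1] simp: indicator_def)
  have int_T: "(\<integral>x. f (T k x) \<partial>\<mu>) = (\<integral>x. f x \<partial>\<mu>)" if f: "bdd f" for f k
    using integral_distr[OF T[of k], of f] f unfolding inv bdd_def by simp
  have L1: "\<bar>(\<integral>x. f x \<partial>\<mu>) - (\<integral>x. g x \<partial>\<mu>)\<bar> \<le> (\<integral>x. \<bar>f x - g x\<bar> \<partial>\<mu>)" if "bdd f" "bdd g" for f g
    using integral_abs_bound[of \<mu> "\<lambda>x. f x - g x"] bdd_int[OF that(1)] bdd_int[OF that(2)] by simp
  have mult_bound: "(\<integral>x. \<bar>f x * h x - g x * h x\<bar> \<partial>\<mu>) \<le> (\<integral>x. \<bar>f x - g x\<bar> \<partial>\<mu>) * B"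
    if "bdd f" "bdd g" "bdd h" "\<And>x. \<bar>h x\<bar> \<le> B" for f g h B
  proof -
    have "(\<integral>x. \<bar>f x * h x - g x * h x\<bar> \<partial>\<mu>) \<le> (\<integral>x. \<bar>f x - g x\<bar> * B \<partial>\<mu>)"
      by (intro integral_mono bdd_int bdd_diff bdd_mult that integrable_mult_left)
         (simp flip: left_diff_distrib add: abs_mult mult_left_mono that(4))
    then show ?thesis by simp
  qed
  define good where "good f g \<longleftrightarrow> (\<lambda>k. \<integral>x. f x * g (T k x) \<partial>\<mu>) \<longlonglongrightarrow> (\<integral>x. f x \<partial>\<mu>) * (\<integral>x. g x \<partial>\<mu>)"
    for f g :: "('i \<Rightarrow> real) \<Rightarrow> real"
  have good_left: "good f g" if f: "bdd f" and g: "bdd g"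
    and ex: "\<And>\<epsilon>. \<epsilon> > 0 \<Longrightarrow> \<exists>p. bdd p \<and> good p g \<and> (\<integral>x. \<bar>f x - p x\<bar> \<partial>\<mu>) < \<epsilon>" for f g
    unfolding good_def
  proof (rule LIMSEQ_approx)
    fix \<epsilon> :: real assume "\<epsilon> > 0"
    obtain B where B: "B > 0" "\<And>x. \<bar>g x\<bar> \<le> B" using bdd_pos[OF g] by blast
    obtain p where p: "bdd p" "good p g" "(\<integral>x. \<bar>f x - p x\<bar> \<partial>\<mu>) < \<epsilon> / B"
      using ex[of "\<epsilon> / B"] \<open>\<epsilon> > 0\<close> B by auto
    have small: "(\<integral>x. \<bar>f x - p x\<bar> \<partial>\<mu>) * B \<le> \<epsilon>" using p(3) B(1) by (simp add: field_simps)
    have "\<bar>(\<integral>x. f x * g (T k x) \<partial>\<mu>) - (\<integral>x. p x * g (T k x) \<partial>\<mu>)\<bar> \<le> \<epsilon>" for k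
      using L1[OF bdd_mult[OF f bdd_T[OF g, of k]] bdd_mult[OF p(1) bdd_T[OF g, of k]]]
        mult_bound[OF f p(1) bdd_T[OF g, of k] B(2)] small by linarith
    moreover have "\<bar>(\<integral>x. f x \<partial>\<mu>) * (\<integral>x. g x \<partial>\<mu>) - (\<integral>x. p x \<partial>\<mu>) * (\<integral>x. g x \<partial>\<mu>)\<bar> \<le> \<epsilon>"
    proof -
      have "\<bar>\<integral>x. g x \<partial>\<mu>\<bar> \<le> (\<integral>x. B \<partial>\<mu>)"
        by (rule order_trans[OF integral_abs_bound])
           (use bdd_int[OF g] B(2) in \<open>intro integral_mono; auto\<close>)
      then have gB: "\<bar>\<integral>x. g x \<partial>\<mu>\<bar> \<le> B" by (simp add: prob_space)
      have "\<bar>((\<integral>x. f x \<partial>\<mu>) - (\<integral>x. p x \<partial>\<mu>)) * (\<integral>x. g x \<partial>\<mu>)\<bar> \<le> (\<integral>x. \<bar>f x - p x\<bar> \<partial>\<mu>) * B"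
        unfolding abs_mult by (intro mult_mono L1 f p gB) auto
      then show ?thesis using small by (simp add: left_diff_distrib)
    qed
    ultimately show "\<exists>b L'. b \<longlonglongrightarrow> L' \<and> (\<forall>k. \<bar>(\<integral>x. f x * g (T k x) \<partial>\<mu>) - b k\<bar> \<le> \<epsilon>) \<and>
        \<bar>(\<integral>x. f x \<partial>\<mu>) * (\<integral>x. g x \<partial>\<mu>) - L'\<bar> \<le> \<epsilon>"
      using p(2) unfolding good_def by blast
  qed
  have good_right: "good f g" if f: "bdd f" and g: "bdd g"
    and ex: "\<And>\<epsilon>. \<epsilon> > 0 \<Longrightarrow> \<exists>p. bdd p \<and> good f p \<and> (\<integral>x. \<bar>g x - p x\<bar> \<partial>\<mu>) < \<epsilon>" for f g
    unfolding good_def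
  proof (rule LIMSEQ_approx)
    fix \<epsilon> :: real assume "\<epsilon> > 0"
    obtain B where B: "B > 0" "\<And>x. \<bar>f x\<bar> \<le> B" using bdd_pos[OF f] by blast
    obtain p where p: "bdd p" "good f p" "(\<integral>x. \<bar>g x - p x\<bar> \<partial>\<mu>) < \<epsilon> / B"
      using ex[of "\<epsilon> / B"] \<open>\<epsilon> > 0\<close> B by auto
    have small: "(\<integral>x. \<bar>g x - p x\<bar> \<partial>\<mu>) * B \<le> \<epsilon>" using p(3) B(1) by (simp add: field_simps)
    have "\<bar>(\<integral>x. g (T k x) * f x \<partial>\<mu>) - (\<integral>x. p (T k x) * f x \<partial>\<mu>)\<bar> \<le> \<epsilon>" for k
      using L1[OF bdd_mult[OF bdd_T[OF g, of k] f] bdd_mult[OF bdd_T[OF p(1), of k] f]]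
        mult_bound[OF bdd_T[OF g, of k] bdd_T[OF p(1), of k] f B(2)] small
        int_T[OF bdd_diff[OF g p(1)], of k] by simp
    moreover have "\<bar>(\<integral>x. f x \<partial>\<mu>) * (\<integral>x. g x \<partial>\<mu>) - (\<integral>x. f x \<partial>\<mu>) * (\<integral>x. p x \<partial>\<mu>)\<bar> \<le> \<epsilon>"
    proof -
      have "\<bar>\<integral>x. f x \<partial>\<mu>\<bar> \<le> (\<integral>x. B \<partial>\<mu>)"
        by (rule order_trans[OF integral_abs_bound])
           (use bdd_int[OF f] B(2) in \<open>intro integral_mono; auto\<close>)
      then have fB: "\<bar>\<integral>x. f x \<partial>\<mu>\<bar> \<le> B" by (simp add: prob_space)
      have "\<bar>((\<integral>x. g x \<partial>\<mu>) - (\<integral>x. p x \<partial>\<mu>)) * (\<integral>x. f x \<partial>\<mu>)\<bar> \<le> (\<integral>x. \<bar>g x - p x\<bar> \<partial>\<mu>) * B"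
        unfolding abs_mult by (intro mult_mono L1 g p fB) auto
      then show ?thesis using small by (simp add: algebra_simps)
    qed
    ultimately show "\<exists>b L'. b \<longlonglongrightarrow> L' \<and> (\<forall>k. \<bar>(\<integral>x. f x * g (T k x) \<partial>\<mu>) - b k\<bar> \<le> \<epsilon>) \<and>
        \<bar>(\<integral>x. f x \<partial>\<mu>) * (\<integral>x. g x \<partial>\<mu>) - L'\<bar> \<le> \<epsilon>"
      using p(2) unfolding good_def
      by (intro exI[of _ "\<lambda>k. \<integral>x. f x * p (T k x) \<partial>\<mu>"] exI[of _ "(\<integral>x. f x \<partial>\<mu>) * (\<integral>x. p x \<partial>\<mu>)"])
         (simp add: mult.commute)
  qed
  have good_add_left: "good (\<lambda>x. f x + f' x) g" if "good f g" "good f' g" "bdd f" "bdd f'" "bdd g" for f f' g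
    using tendsto_add[OF that(1,2)[unfolded good_def]] that(3-)
    unfolding good_def by (simp add: distrib_right bdd_int bdd_mult bdd_T)
  have good_add_right: "good f (\<lambda>x. g x + g' x)" if "good f g" "good f g'" "bdd f" "bdd g" "bdd g'" for f g g'
    using tendsto_add[OF that(1,2)[unfolded good_def]] that(3-)
    unfolding good_def by (simp add: distrib_left bdd_int bdd_mult bdd_T)
  have trig_good: "good p q" if p: "p \<in> trig_polys I" and q: "q \<in> trig_polys I" for p q
    using p
  proof induction
    case c1: (cosine J c a s)
    from q show ?case
    proof induction
      case c2: (cosine K d b t)
      from tendsto_mult[OF tendsto_const[of "c * d"] cosines[OF c1 c2, of a s b t]]
      show ?case unfolding good_def
        by (simp flip: integral_mult_right_zero add: mult_ac)
    next
      case (add q q')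
      then show ?case by (intro good_add_right bdd_p[OF trig_polys.cosine[OF c1]]) (auto intro: bdd_p)
    qed
  next
    case (add p p')
    then show ?case by (intro good_add_left) (auto intro: bdd_p q)
  qed
  have dense: "\<exists>p\<in>trig_polys I. (\<integral>x. \<bar>indicat_real W x - p x\<bar> \<partial>\<mu>) < \<epsilon>" if "W \<in> sets \<mu>" "\<epsilon> > 0" for W \<epsilon>
    using trig_polys_dense[of "{\<mu>}" I W \<epsilon>] \<mu> that by auto
  have "good (indicat_real U) q" if "q \<in> trig_polys I" for q
    by (rule good_left[OF bdd_ind[OF U] bdd_p[OF that]]) (use dense[OF U] trig_good bdd_p that in blast)
  then have "good (indicat_real U) (indicat_real V)"
    by (intro good_right bdd_ind U V) (use dense[OF V] bdd_p in blast)
  moreover have "(\<integral>x. indicat_real U x * indicat_real V (T k x) \<partial>\<mu>) = measure \<mu> (U \<inter> (T k -` V \<inter> space \<mu>))" for k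
  proof -
    have "(\<integral>x. indicat_real U x * indicat_real V (T k x) \<partial>\<mu>) = (\<integral>x. indicat_real (U \<inter> (T k -` V \<inter> space \<mu>)) x \<partial>\<mu>)"
      by (intro Bochner_Integration.integral_cong) (auto simp: indicator_def)
    also have "\<dots> = measure \<mu> (U \<inter> (T k -` V \<inter> space \<mu>))"
      using measurable_sets[OF T V, of k] U by (simp add: Int_ac)
    finally show ?thesis .
  qed
  moreover have "(\<integral>x. indicat_real U x \<partial>\<mu>) = measure \<mu> U" "(\<integral>x. indicat_real V x \<partial>\<mu>) = measure \<mu> V"
    using U V by (simp_all add: sets.Int_space_eq2)
  ultimately show ?thesis unfolding good_def by simp
qed

section \<open>Real characteristic functions and convergence in probability\<close>

lemma (in prob_space) integrable_bounded_cos: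
  fixes X :: "'a \<Rightarrow> real"
  assumes [measurable]: "X \<in> borel_measurable M"
  shows "integrable M (\<lambda>\<omega>. cos (X \<omega>))" "integrable M (\<lambda>\<omega>. sin (X \<omega>))"
proof -
  have [measurable]: "(\<lambda>\<omega>. cos (X \<omega>)) \<in> borel_measurable M" "(\<lambda>\<omega>. sin (X \<omega>)) \<in> borel_measurable M"
    by measurable
  show "integrable M (\<lambda>\<omega>. cos (X \<omega>))" by (rule integrable_const_bound[of _ 1]) auto
  show "integrable M (\<lambda>\<omega>. sin (X \<omega>))" by (rule integrable_const_bound[of _ 1]) auto
qed

lemma (in prob_space) char_eq_real_iff:
  fixes X :: "'a \<Rightarrow> real"
  assumes X [measurable]: "X \<in> borel_measurable M"
  shows "char (distr M borel X) \<theta> = of_real r \<longleftrightarrow>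
    expectation (\<lambda>\<omega>. cos (\<theta> * X \<omega>)) = r \<and> expectation (\<lambda>\<omega>. sin (\<theta> * X \<omega>)) = 0"
proof -
  have int: "integrable M (\<lambda>\<omega>. exp (\<i> * complex_of_real (\<theta> * X \<omega>)))"
    by (rule integrable_iexp) auto
  have "char (distr M borel X) \<theta> = (\<integral>\<omega>. exp (\<i> * complex_of_real (\<theta> * X \<omega>)) \<partial>M)"
    unfolding char_def by (subst integral_distr) auto
  moreover have "Re (\<integral>\<omega>. exp (\<i> * complex_of_real (\<theta> * X \<omega>)) \<partial>M) = expectation (\<lambda>\<omega>. cos (\<theta> * X \<omega>))"
    by (subst integral_Re[OF int, symmetric]) (simp add: Re_exp)
  moreover have "Im (\<integral>\<omega>. exp (\<i> * complex_of_real (\<theta> * X \<omega>)) \<partial>M) = expectation (\<lambda>\<omega>. sin (\<theta> * X \<omega>))"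
    by (subst integral_Im[OF int, symmetric]) (simp add: Im_exp)
  ultimately show ?thesis by (auto simp: complex_eq_iff)
qed

lemma (in prob_space) expectation_cos_phase:
  fixes X :: "'a \<Rightarrow> real"
  assumes [measurable]: "X \<in> borel_measurable M" 
    and "char (distr M borel X) \<theta> = of_real r"
  shows "expectation (\<lambda>\<omega>. cos (\<theta> * X \<omega> + s)) = cos s * r"
  using assms(2) unfolding char_eq_real_iff[OF assms(1)]
  by (simp add: cos_add integrable_bounded_cos mult.commute)

text \<open>The variable \<open>1 - cos (\<theta> X)\<close> is nonnegative with mean 0, so \<open>cos (\<theta> X) = 1\<close> almost surely. Applying
this to \<open>\<theta> = 1/n\<close> for all \<open>n\<close> at once leaves only \<open>X = 0\<close>, since \<open>\<theta> X\<close> is eventually smaller than 1.\<close>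

lemma (in prob_space) AE_eq_0_if_cos:
  fixes X :: "'a \<Rightarrow> real"
  assumes [measurable]: "X \<in> borel_measurable M" 
    and cos1: "\<And>\<theta>. expectation (\<lambda>\<omega>. cos (\<theta> * X \<omega>)) = 1"
  shows "AE \<omega> in M. X \<omega> = 0"
proof -
  have "AE \<omega> in M. 1 - cos (\<theta> * X \<omega>) = 0" for \<theta>
  proof (subst integral_nonneg_eq_0_iff_AE[symmetric])
    show "integrable M (\<lambda>\<omega>. 1 - cos (\<theta> * X \<omega>))" by (simp add: integrable_bounded_cos)
    show "expectation (\<lambda>\<omega>. 1 - cos (\<theta> * X \<omega>)) = 0"
      by (simp add: integrable_bounded_cos cos1 prob_space)
  qed auto
  then have "AE \<omega> in M. \<forall>n::nat. 1 - cos (inverse (real (Suc n)) * X \<omega>) = 0"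
    by (simp add: AE_all_countable)
  then show ?thesis
  proof eventually_elim
    case (elim \<omega>)
    show ?case
    proof (rule ccontr)
      assume "X \<omega> \<noteq> 0"
      obtain n where n: "\<bar>X \<omega>\<bar> < real (Suc n)"
        using reals_Archimedean2[of "\<bar>X \<omega>\<bar>"] by (metis less_trans lessI of_nat_less_iff)
      define y where "y = inverse (real (Suc n)) * X \<omega>"
      have "\<bar>y\<bar> < 1" using n by (simp add: y_def abs_mult field_simps)
      moreover have "\<bar>y\<bar> > 0" using \<open>X \<omega> \<noteq> 0\<close> by (simp add: y_def)
      ultimately have "cos \<bar>y\<bar> < cos 0" by (intro cos_monotone_0_pi) (use pi_gt3 in auto)
      then show False using elim[rule_format, of n] by (simp add: y_def)
    qed
  qed
qed

lemma (in prob_space) tendsto_expectation_cos: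
  assumes [measurable]: "\<And>k. X k \<in> borel_measurable M" "Y \<in> borel_measurable M" "Z \<in> borel_measurable M"
    and conv: "converges_in_prob M X Y"
  shows "(\<lambda>k. expectation (\<lambda>\<omega>. cos (\<theta> * (X k \<omega> - Z \<omega>)))) \<longlonglongrightarrow> expectation (\<lambda>\<omega>. cos (\<theta> * (Y \<omega> - Z \<omega>)))"
proof (rule LIMSEQ_I)
  fix r :: real assume "r > 0"
  define \<epsilon> where "\<epsilon> = r / (2 * (\<bar>\<theta>\<bar> + 1))"
  have "\<epsilon> > 0" using \<open>r > 0\<close> by (simp add: \<epsilon>_def)
  have "\<bar>\<theta>\<bar> * \<epsilon> \<le> r / 2" using \<open>r > 0\<close> by (simp add: \<epsilon>_def field_simps)
  let ?E = "\<lambda>k. {\<omega> \<in> space M. \<bar>X k \<omega> - Y \<omega>\<bar> > \<epsilon>}"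
  have "(\<lambda>k. prob (?E k)) \<longlonglongrightarrow> 0" using conv \<open>\<epsilon> > 0\<close> by (simp add: converges_in_prob_def)
  then obtain n where n: "\<And>k. k \<ge> n \<Longrightarrow> prob (?E k) < r / 4"
    using LIMSEQ_D[of _ 0 "r/4"] \<open>r > 0\<close> by fastforce
  have "norm (expectation (\<lambda>\<omega>. cos (\<theta> * (X k \<omega> - Z \<omega>))) - expectation (\<lambda>\<omega>. cos (\<theta> * (Y \<omega> - Z \<omega>)))) < r"
    if "k \<ge> n" for k
  proof -
    have E [measurable]: "?E k \<in> sets M" by measurable
    have "norm (expectation (\<lambda>\<omega>. cos (\<theta> * (X k \<omega> - Z \<omega>))) - expectation (\<lambda>\<omega>. cos (\<theta> * (Y \<omega> - Z \<omega>))))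
      = norm (expectation (\<lambda>\<omega>. cos (\<theta> * (X k \<omega> - Z \<omega>)) - cos (\<theta> * (Y \<omega> - Z \<omega>))))"
      by (simp add: integrable_bounded_cos)
    also have "\<dots> \<le> expectation (\<lambda>\<omega>. norm (cos (\<theta> * (X k \<omega> - Z \<omega>)) - cos (\<theta> * (Y \<omega> - Z \<omega>))))"
      by (rule integral_norm_bound)
    also have "\<dots> \<le> expectation (\<lambda>\<omega>. \<bar>\<theta>\<bar> * \<epsilon> + 2 * indicator (?E k) \<omega>)"
    proof (rule integral_mono)
      show "integrable M (\<lambda>\<omega>. norm (cos (\<theta> * (X k \<omega> - Z \<omega>)) - cos (\<theta> * (Y \<omega> - Z \<omega>))))"
        by (simp add: integrable_bounded_cos)
      show "integrable M (\<lambda>\<omega>. \<bar>\<theta>\<bar> * \<epsilon> + 2 * indicator (?E k) \<omega>)"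
        using E by (simp add: emeasure_eq_measure)
      fix \<omega> assume "\<omega> \<in> space M"
      define u v where "u = \<theta> * (X k \<omega> - Z \<omega>)" and "v = \<theta> * (Y \<omega> - Z \<omega>)"
      have "\<bar>cos u - cos v\<bar> \<le> \<bar>u - v\<bar>"
      proof -
        have "\<bar>cos u - cos v\<bar> = 2 * \<bar>sin ((u + v) / 2)\<bar> * \<bar>sin ((v - u) / 2)\<bar>"
          by (simp add: cos_diff_cos abs_mult)
        also have "\<dots> \<le> 2 * 1 * \<bar>(v - u) / 2\<bar>"
          by (intro mult_mono abs_sin_x_le_abs_x) auto
        finally show ?thesis by simp
      qed
      moreover have "u - v = \<theta> * (X k \<omega> - Y \<omega>)" by (simp add: u_def v_def algebra_simps)
      moreover have "\<bar>\<theta> * (X k \<omega> - Y \<omega>)\<bar> \<le> \<bar>\<theta>\<bar> * \<epsilon>" if "\<omega> \<notin> ?E k"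
        using that \<open>\<omega> \<in> space M\<close> by (auto simp: abs_mult intro!: mult_left_mono)
      moreover have "\<bar>cos u - cos v\<bar> \<le> 2"
        using abs_cos_le_one[of u] abs_cos_le_one[of v] by linarith
      moreover have "0 \<le> \<bar>\<theta>\<bar> * \<epsilon>" using \<open>\<epsilon> > 0\<close> by simp
      ultimately show "norm (cos (\<theta> * (X k \<omega> - Z \<omega>)) - cos (\<theta> * (Y \<omega> - Z \<omega>))) \<le> \<bar>\<theta>\<bar> * \<epsilon> + 2 * indicator (?E k) \<omega>"
        unfolding u_def[symmetric] v_def[symmetric] by (cases "\<omega> \<in> ?E k") auto
    qed
    also have "\<dots> = \<bar>\<theta>\<bar> * \<epsilon> + 2 * prob (?E k)"
      using E by (simp add: emeasure_eq_measure prob_space)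
    also have "\<dots> < r" using n[OF that] \<open>\<bar>\<theta>\<bar> * \<epsilon> \<le> r / 2\<close> by linarith
    finally show ?thesis .
  qed
  then show "\<exists>no. \<forall>k\<ge>no. norm (expectation (\<lambda>\<omega>. cos (\<theta> * (X k \<omega> - Z \<omega>))) - expectation (\<lambda>\<omega>. cos (\<theta> * (Y \<omega> - Z \<omega>)))) < r"
    by blast
qed

section \<open>Stable integrals of simple functions\<close>

locale stable_measure = prob_space P for P :: "'w measure" +
  fixes \<alpha> :: real and m :: "'b measure" and M :: "'b set \<Rightarrow> 'w \<Rightarrow> real"
  assumes \<alpha>_pos: "0 < \<alpha>"
    and random_measure: "sas_random_measure \<alpha> P m M"
begin

abbreviation "S \<equiv> simple_stable_integral m M"

lemma M_measurable [measurable]: "D \<in> finite_sets m \<Longrightarrow> M D \<in> borel_measurable P"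
  using random_measure by (simp add: sas_random_measure_def)

lemma char_M:
  assumes "D \<in> finite_sets m"
  shows "char (distr P borel (M D)) \<theta> = of_real (exp (- measure m D * \<bar>\<theta>\<bar> powr \<alpha>))"
proof -
  have "sas_law \<alpha> (measure m D powr (1 / \<alpha>)) (distr P borel (M D))"
    using assms random_measure by (simp add: sas_random_measure_def)
  moreover have "(measure m D powr (1 / \<alpha>)) powr \<alpha> = measure m D"
    using \<alpha>_pos by (simp add: powr_powr)
  ultimately show ?thesis by (simp add: sas_law_def)
qed

lemma empty_finite_sets: "{} \<in> finite_sets m"
  by (simp add: finite_sets_def)

lemma M_empty: "AE \<omega> in P. M {} \<omega> = 0"
proof (rule AE_eq_0_if_cos[OF M_measurable[OF empty_finite_sets]])
  show "expectation (\<lambda>\<omega>. cos (\<theta> * M {} \<omega>)) = 1" for \<theta>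
    using expectation_cos_phase[OF M_measurable[OF empty_finite_sets] char_M[OF empty_finite_sets], of \<theta> 0]
    by simp
qed

lemma finite_sets_UN:
  assumes "finite V" "\<And>v. v \<in> V \<Longrightarrow> D v \<in> finite_sets m"
  shows "(\<Union>v\<in>V. D v) \<in> finite_sets m"
proof -
  have "(\<Union>v\<in>V. D v) \<in> sets m" using assms by (auto simp: finite_sets_def)
  moreover have "emeasure m (\<Union>v\<in>V. D v) \<le> (\<Sum>v\<in>V. emeasure m (D v))"
    using assms by (intro emeasure_subadditive_finite) (auto simp: finite_sets_def)
  moreover have "(\<Sum>v\<in>V. emeasure m (D v)) < \<infinity>"
    using assms by (auto simp: finite_sets_def)
  ultimately show ?thesis by (auto simp: finite_sets_def)
qed

lemma M_finite_additive:
  assumes V: "finite V" and D: "\<And>v. v \<in> V \<Longrightarrow> D v \<in> finite_sets m" and disj: "disjoint_family_on D V"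
  shows "AE \<omega> in P. M (\<Union>v\<in>V. D v) \<omega> = (\<Sum>v\<in>V. M (D v) \<omega>)"
proof -
  obtain h where h: "bij_betw h {0..<card V} V" using ex_bij_betw_nat_finite[OF V] by blast
  define n where "n = card V"
  have hV: "h i \<in> V" if "i < n" for i using h that by (auto simp: bij_betw_def n_def)
  \<comment> \<open>pad the finite family with empty sets, so that countable additivity applies\<close>
  define E where "E i = (if i < n then D (h i) else {})" for i
  have E_fin: "range E \<subseteq> finite_sets m" using D hV empty_finite_sets by (auto simp: E_def)
  have E_disj: "disjoint_family E"
    unfolding disjoint_family_on_def
  proof (intro ballI impI)
    fix i j :: nat assume "i \<noteq> j"
    then have "h i \<noteq> h j" if "i < n" "j < n"
      using h that by (auto simp: bij_betw_def n_def inj_on_def)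
    then show "E i \<inter> E j = {}"
      using disj hV by (auto simp: E_def disjoint_family_on_def)
  qed
  have E_UN: "(\<Union>i. E i) = (\<Union>v\<in>V. D v)"
  proof -
    have "(\<Union>i. E i) = (\<Union>i\<in>{0..<n}. D (h i))" by (auto simp: E_def split: if_splits)
    also have "\<dots> = (\<Union>v\<in>h ` {0..<n}. D v)" by auto
    also have "h ` {0..<n} = V" using h by (simp add: bij_betw_def n_def)
    finally show ?thesis .
  qed
  have UN_fin: "(\<Union>v\<in>V. D v) \<in> finite_sets m" by (rule finite_sets_UN[OF V D])
  have "AE \<omega> in P. (\<lambda>i. M (E i) \<omega>) sums M (\<Union>i. E i) \<omega>"
    using random_measure[unfolded sas_random_measure_def] E_fin E_disj UN_fin[folded E_UN] by blast
  then show ?thesis using M_empty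
  proof eventually_elim
    case (elim \<omega>)
    have "(\<lambda>i. M (E i) \<omega>) sums (\<Sum>i\<in>{0..<n}. M (E i) \<omega>)"
      by (rule sums_finite) (use elim in \<open>auto simp: E_def\<close>)
    then have "M (\<Union>i. E i) \<omega> = (\<Sum>i\<in>{0..<n}. M (E i) \<omega>)" using elim(1) sums_unique2 by blast
    also have "\<dots> = (\<Sum>i\<in>{0..<n}. M (D (h i)) \<omega>)" by (simp add: E_def)
    also have "\<dots> = (\<Sum>v\<in>V. M (D v) \<omega>)"
      using sum.reindex_bij_betw[OF h, of "\<lambda>v. M (D v) \<omega>"] by (simp add: n_def)
    finally show ?case by (simp add: E_UN)
  qed
qed

text \<open>The elementary integral groups the points by the value of the integrand. It can be computed from any
finer partition into level sets, here those of \<open>G\<close>, by finite additivity of \<open>M\<close>. The value \<open>z\<close>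
stands for the part of the space that may have infinite measure.\<close>

lemma S_compose:
  fixes G :: "'b \<Rightarrow> 'c" and \<phi> :: "'c \<Rightarrow> real"
  assumes fin: "finite (G ` space m)"
    and lev: "\<And>v. v \<in> G ` space m - {z} \<Longrightarrow> {x \<in> space m. G x = v} \<in> finite_sets m"
    and z: "\<phi> z = 0"
  shows "AE \<omega> in P. S (\<lambda>x. \<phi> (G x)) \<omega> = (\<Sum>v\<in>G ` space m - {z}. \<phi> v * M {x \<in> space m. G x = v} \<omega>)"
proof -
  let ?C = "(\<lambda>x. \<phi> (G x)) ` space m - {0}"
  define L where "L v = {x \<in> space m. G x = v}" for v
  define V where "V c = {v \<in> G ` space m - {z}. \<phi> v = c}" for c
  have C: "finite ?C" using finite_imageI[OF fin, of \<phi>] by (simp add: image_image)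
  have V_fin: "finite (V c)" for c using fin by (simp add: V_def)
  have "AE \<omega> in P. M {x \<in> space m. \<phi> (G x) = c} \<omega> = (\<Sum>v\<in>V c. M (L v) \<omega>)" if "c \<in> ?C" for c
  proof -
    have "{x \<in> space m. \<phi> (G x) = c} = (\<Union>v\<in>V c. L v)"
      using that z by (auto simp: L_def V_def)
    then show ?thesis
      using M_finite_additive[OF V_fin, of c L] lev
      by (auto simp: V_def L_def disjoint_family_on_def)
  qed
  then have "AE \<omega> in P. \<forall>c\<in>?C. M {x \<in> space m. \<phi> (G x) = c} \<omega> = (\<Sum>v\<in>V c. M (L v) \<omega>)"
    using C by (simp add: AE_finite_all)
  then show ?thesis
  proof eventually_elim
    case (elim \<omega>)
    have "S (\<lambda>x. \<phi> (G x)) \<omega> = (\<Sum>c\<in>?C. c * (\<Sum>v\<in>V c. M (L v) \<omega>))"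
      unfolding simple_stable_integral_def using elim by (intro sum.cong) auto
    also have "\<dots> = (\<Sum>c\<in>?C. \<Sum>v\<in>V c. \<phi> v * M (L v) \<omega>)"
      by (auto simp: sum_distrib_left V_def intro!: sum.cong)
    also have "\<dots> = (\<Sum>c\<in>?C. \<Sum>v\<in>{v \<in> {v \<in> G ` space m - {z}. \<phi> v \<noteq> 0}. \<phi> v = c}. \<phi> v * M (L v) \<omega>)"
      by (intro sum.cong refl) (auto simp: V_def)
    also have "\<dots> = (\<Sum>v\<in>{v \<in> G ` space m - {z}. \<phi> v \<noteq> 0}. \<phi> v * M (L v) \<omega>)"
      using fin C by (intro sum.group) auto
    also have "\<dots> = (\<Sum>v\<in>G ` space m - {z}. \<phi> v * M (L v) \<omega>)"
      using fin by (intro sum.mono_neutral_left) auto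
    finally show ?case by (simp add: L_def)
  qed
qed

lemma simple_integrand_linear:
  fixes f :: "'j \<Rightarrow> 'b \<Rightarrow> real"
  assumes J: "finite J" and f: "\<And>j. j \<in> J \<Longrightarrow> simple_integrand m (f j)"
  shows "simple_integrand m (\<lambda>x. \<Sum>j\<in>J. a j * f j x)"
proof -
  have sf: "simple_function m (f j)" if "j \<in> J" for j using f[OF that] by (simp add: simple_integrand_def)
  have [measurable]: "f j \<in> borel_measurable m" if "j \<in> J" for j
    using borel_measurable_simple_function[OF sf[OF that]] .
  have sum: "simple_function m (\<lambda>x. \<Sum>j\<in>J. a j * f j x)"
    using sf by (intro simple_function_sum simple_function_mult) auto
  have "emeasure m {x \<in> space m. (\<Sum>j\<in>J. a j * f j x) \<noteq> 0} \<le> emeasure m (\<Union>j\<in>J. {x \<in> space m. f j x \<noteq> 0})"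
    using J by (intro emeasure_mono sets.finite_UN) (auto, metis (mono_tags, lifting) mult_zero_right sum.neutral)
  also have "\<dots> \<le> (\<Sum>j\<in>J. emeasure m {x \<in> space m. f j x \<noteq> 0})"
    using J by (intro emeasure_subadditive_finite) auto
  also have "\<dots> < \<infinity>" using J f by (auto simp: simple_integrand_def)
  finally show ?thesis using sum by (simp add: simple_integrand_def)
qed

text \<open>Evaluate all integrals on the common partition of the space by the joint values of the functions.\<close>

lemma S_linear:
  fixes f :: "'j \<Rightarrow> 'b \<Rightarrow> real"
  assumes J: "finite J" and f: "\<And>j. j \<in> J \<Longrightarrow> simple_integrand m (f j)"
  shows "AE \<omega> in P. S (\<lambda>x. \<Sum>j\<in>J. a j * f j x) \<omega> = (\<Sum>j\<in>J. a j * S (f j) \<omega>)"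
proof -
  define G where "G x = (\<lambda>j\<in>J. f j x)" for x
  define z :: "'j \<Rightarrow> real" where "z = (\<lambda>j\<in>J. 0)"
  have sf: "simple_function m (f j)" if "j \<in> J" for j using f[OF that] by (simp add: simple_integrand_def)
  have [measurable]: "f j \<in> borel_measurable m" if "j \<in> J" for j
    using borel_measurable_simple_function[OF sf[OF that]] .
  have fin: "finite (G ` space m)"
  proof (rule finite_subset)
    show "G ` space m \<subseteq> (\<Pi>\<^sub>E j\<in>J. f j ` space m)" by (auto simp: G_def)
    show "finite (\<Pi>\<^sub>E j\<in>J. f j ` space m)"
      using J sf by (intro finite_PiE) (auto simp: simple_function_def)
  qed
  have lev: "{x \<in> space m. G x = v} \<in> finite_sets m" if v: "v \<in> G ` space m - {z}" for v
  proof -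
    from v have "v \<in> extensional J" by (auto simp: G_def)
    then have eq: "{x \<in> space m. G x = v} = {x \<in> space m. \<forall>j\<in>J. f j x = v j}"
      by (auto simp: G_def extensional_def fun_eq_iff)
    have meas: "{x \<in> space m. G x = v} \<in> sets m"
      unfolding eq using J by measurable
    from v \<open>v \<in> extensional J\<close> obtain j where j: "j \<in> J" "v j \<noteq> 0"
      by (auto simp: z_def extensional_def fun_eq_iff split: if_splits)
    have "emeasure m {x \<in> space m. G x = v} \<le> emeasure m {x \<in> space m. f j x \<noteq> 0}"
      unfolding eq using j by (intro emeasure_mono) auto
    also have "\<dots> < \<infinity>" using f[OF j(1)] by (simp add: simple_integrand_def)
    finally show ?thesis using meas by (simp add: finite_sets_def)
  qed
  have "AE \<omega> in P. S (\<lambda>x. \<phi> (G x)) \<omega> = (\<Sum>v\<in>G ` space m - {z}. \<phi> v * M {x \<in> space m. G x = v} \<omega>)"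
    if "\<phi> z = 0" for \<phi> by (rule S_compose[where G = G and \<phi> = \<phi> and z = z]) (use fin lev that in auto)
  note comp = this
  have "AE \<omega> in P. \<forall>j\<in>J. S (f j) \<omega> = (\<Sum>v\<in>G ` space m - {z}. v j * M {x \<in> space m. G x = v} \<omega>)"
    using J
  proof (subst AE_finite_all, simp, intro ballI)
    fix j assume j: "j \<in> J"
    show "AE \<omega> in P. S (f j) \<omega> = (\<Sum>v\<in>G ` space m - {z}. v j * M {x \<in> space m. G x = v} \<omega>)"
      using comp[of "\<lambda>v. v j"] j by (simp add: G_def z_def)
  qed
  moreover have "AE \<omega> in P. S (\<lambda>x. \<Sum>j\<in>J. a j * f j x) \<omega>
      = (\<Sum>v\<in>G ` space m - {z}. (\<Sum>j\<in>J. a j * v j) * M {x \<in> space m. G x = v} \<omega>)"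
    using comp[of "\<lambda>v. \<Sum>j\<in>J. a j * v j"] by (simp add: G_def z_def)
  ultimately show ?thesis
  proof eventually_elim
    case (elim \<omega>)
    have "(\<Sum>j\<in>J. a j * S (f j) \<omega>) = (\<Sum>j\<in>J. \<Sum>v\<in>G ` space m - {z}. a j * v j * M {x \<in> space m. G x = v} \<omega>)"
      using elim(1) by (simp add: sum_distrib_left mult.assoc)
    also have "\<dots> = S (\<lambda>x. \<Sum>j\<in>J. a j * f j x) \<omega>"
      unfolding elim(2) by (subst sum.swap) (simp add: sum_distrib_right)
    finally show ?case by simp
  qed
qed

lemma simple_integrand_scale: "simple_integrand m f \<Longrightarrow> simple_integrand m (\<lambda>x. c * f x)"
  and S_scale: "simple_integrand m f \<Longrightarrow> AE \<omega> in P. S (\<lambda>x. c * f x) \<omega> = c * S f \<omega>"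
  using simple_integrand_linear[of "{()}" "\<lambda>_. f" "\<lambda>_. c"] S_linear[of "{()}" "\<lambda>_. f" "\<lambda>_. c"] by auto

lemma simple_integrand_combine:
    "simple_integrand m f \<Longrightarrow> simple_integrand m g \<Longrightarrow> simple_integrand m (\<lambda>x. f x + c * g x)"
  and S_combine: "simple_integrand m f \<Longrightarrow> simple_integrand m g \<Longrightarrow>
    AE \<omega> in P. S (\<lambda>x. f x + c * g x) \<omega> = S f \<omega> + c * S g \<omega>"
  using simple_integrand_linear[of UNIV "\<lambda>b. if b then f else g" "\<lambda>b. if b then 1 else c"]
    S_linear[of UNIV "\<lambda>b. if b then f else g" "\<lambda>b. if b then 1 else c"]
  by (auto simp: UNIV_bool add.commute)

lemma level_finite_sets:
  assumes "simple_integrand m g" "c \<noteq> 0"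
  shows "{x \<in> space m. g x = c} \<in> finite_sets m"
proof -
  have [measurable]: "g \<in> borel_measurable m"
    using assms by (auto simp: simple_integrand_def intro: borel_measurable_simple_function)
  have "emeasure m {x \<in> space m. g x = c} \<le> emeasure m {x \<in> space m. g x \<noteq> 0}"
    using assms(2) by (intro emeasure_mono) auto
  also have "\<dots> < \<infinity>" using assms(1) by (simp add: simple_integrand_def)
  finally show ?thesis by (simp add: finite_sets_def)
qed

lemma S_measurable: "simple_integrand m g \<Longrightarrow> S g \<in> borel_measurable P"
  unfolding simple_stable_integral_def
  by (intro borel_measurable_sum borel_measurable_times M_measurable level_finite_sets) auto

lemma powr_simple_integrand:
  assumes g: "simple_integrand m g"
  shows "integrable m (\<lambda>x. \<bar>g x\<bar> powr \<alpha>)"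
    and "(\<integral>x. \<bar>g x\<bar> powr \<alpha> \<partial>m) = (\<Sum>c\<in>g ` space m - {0}. \<bar>c\<bar> powr \<alpha> * measure m {x \<in> space m. g x = c})"
proof -
  have fin: "finite (g ` space m)" using g by (auto simp: simple_integrand_def simple_function_def)
  have eq: "\<bar>g x\<bar> powr \<alpha> = (\<Sum>c\<in>g ` space m - {0}. \<bar>c\<bar> powr \<alpha> * indicat_real {x \<in> space m. g x = c} x)"
    if "x \<in> space m" for x
  proof -
    have "(\<Sum>c\<in>g ` space m - {0}. \<bar>c\<bar> powr \<alpha> * indicat_real {x \<in> space m. g x = c} x)
      = (\<Sum>c\<in>g ` space m - {0}. if c = g x then \<bar>c\<bar> powr \<alpha> else 0)"
      using that by (intro sum.cong) (auto simp: indicator_def)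
    also have "\<dots> = \<bar>g x\<bar> powr \<alpha>" using fin that by (simp add: sum.delta)
    finally show ?thesis by simp
  qed
  have lev: "{x \<in> space m. g x = c} \<in> sets m" "emeasure m {x \<in> space m. g x = c} < \<infinity>" if "c \<noteq> 0" for c
    using level_finite_sets[OF g that] by (auto simp: finite_sets_def)
  have int: "integrable m (\<lambda>x. \<bar>c\<bar> powr \<alpha> * indicat_real {x \<in> space m. g x = c} x)" if "c \<noteq> 0" for c
    using lev[OF that] by (intro integrable_mult_right integrable_real_indicator) auto
  show "integrable m (\<lambda>x. \<bar>g x\<bar> powr \<alpha>)"
    by (subst Bochner_Integration.integrable_cong[OF refl eq]) (auto intro!: Bochner_Integration.integrable_sum int)
  have "(\<integral>x. \<bar>g x\<bar> powr \<alpha> \<partial>m) = (\<integral>x. (\<Sum>c\<in>g ` space m - {0}. \<bar>c\<bar> powr \<alpha> * indicat_real {x \<in> space m. g x = c} x) \<partial>m)"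
    by (intro Bochner_Integration.integral_cong eq) auto
  also have "\<dots> = (\<Sum>c\<in>g ` space m - {0}. \<integral>x. \<bar>c\<bar> powr \<alpha> * indicat_real {x \<in> space m. g x = c} x \<partial>m)"
    by (intro Bochner_Integration.integral_sum int) auto
  also have "\<dots> = (\<Sum>c\<in>g ` space m - {0}. \<bar>c\<bar> powr \<alpha> * measure m {x \<in> space m. g x = c})"
    by (intro sum.cong refl) (auto simp: Int_def conj_commute)
  finally show "(\<integral>x. \<bar>g x\<bar> powr \<alpha> \<partial>m) = (\<Sum>c\<in>g ` space m - {0}. \<bar>c\<bar> powr \<alpha> * measure m {x \<in> space m. g x = c})" .
qed

lemma char_S:
  assumes g: "simple_integrand m g"
  shows "char (distr P borel (S g)) \<theta> = of_real (exp (- (\<integral>x. \<bar>g x\<bar> powr \<alpha> \<partial>m) * \<bar>\<theta>\<bar> powr \<alpha>))"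
proof -
  define V where "V = g ` space m - {0}"
  define L where "L c = {x \<in> space m. g x = c}" for c
  have V: "finite V" using g by (auto simp: simple_integrand_def simple_function_def V_def)
  have inj: "inj_on L V" unfolding inj_on_def V_def L_def by blast
  have LV: "L c \<in> finite_sets m" if "c \<in> V" for c
    using level_finite_sets[OF g] that by (auto simp: V_def L_def)
  define val where "val = the_inv_into V L"
  have val: "val (L c) = c" if "c \<in> V" for c
    unfolding val_def by (rule the_inv_into_f_f[OF inj that])
  have "finite (L ` V) \<and> L ` V \<subseteq> finite_sets m \<and> disjoint (L ` V)"
    using V LV by (auto simp: disjoint_def) (auto simp: L_def)
  then have "indep_vars (\<lambda>_. borel) M (L ` V)"
    using random_measure unfolding sas_random_measure_def by blast
  \<comment> \<open>independence is indexed by the level sets themselves, so the value on each level is recovered from the set\<close>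
  then have ind: "indep_vars (\<lambda>_. borel) (\<lambda>D. (\<lambda>y. val D * y) \<circ> M D) (L ` V)"
    by (rule indep_vars_compose) auto
  have S_eq: "S g = (\<lambda>\<omega>. \<Sum>D\<in>L ` V. ((\<lambda>y. val D * y) \<circ> M D) \<omega>)"
    unfolding simple_stable_integral_def
    by (simp add: sum.reindex[OF inj] val fun_eq_iff V_def[symmetric] L_def[symmetric])
  have "char (distr P borel (S g)) \<theta> = (\<Prod>D\<in>L ` V. char (distr P borel ((\<lambda>y. val D * y) \<circ> M D)) \<theta>)"
    unfolding S_eq by (rule char_distr_sum[OF ind])
  also have "\<dots> = (\<Prod>c\<in>V. char (distr P borel ((\<lambda>y. c * y) \<circ> M (L c))) \<theta>)"
    by (simp add: prod.reindex[OF inj] val)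
  also have "\<dots> = (\<Prod>c\<in>V. of_real (exp (- measure m (L c) * \<bar>\<theta> * c\<bar> powr \<alpha>)))"
  proof (rule prod.cong[OF refl])
    fix c assume "c \<in> V"
    have [measurable]: "M (L c) \<in> borel_measurable P" using LV[OF \<open>c \<in> V\<close>] by simp
    have "char (distr P borel ((\<lambda>y. c * y) \<circ> M (L c))) \<theta> = char (distr P borel (M (L c))) (\<theta> * c)"
      unfolding char_def by (simp add: integral_distr mult_ac)
    then show "char (distr P borel ((\<lambda>y. c * y) \<circ> M (L c))) \<theta> = of_real (exp (- measure m (L c) * \<bar>\<theta> * c\<bar> powr \<alpha>))"
      using char_M[OF LV[OF \<open>c \<in> V\<close>]] by simp
  qed
  also have "\<dots> = of_real (exp (\<Sum>c\<in>V. - measure m (L c) * \<bar>\<theta> * c\<bar> powr \<alpha>))"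
    using V by (simp add: exp_sum)
  also have "(\<Sum>c\<in>V. - measure m (L c) * \<bar>\<theta> * c\<bar> powr \<alpha>) = - (\<integral>x. \<bar>g x\<bar> powr \<alpha> \<partial>m) * \<bar>\<theta>\<bar> powr \<alpha>"
    unfolding powr_simple_integrand(2)[OF g] V_def[symmetric] L_def[symmetric] sum_negf[symmetric] sum_distrib_right
    by (intro sum.cong refl) (simp add: abs_mult powr_mult)
  finally show ?thesis .
qed

lemma expectation_cos_S:
  assumes g: "simple_integrand m g"
  shows "expectation (\<lambda>\<omega>. cos (S g \<omega> + s)) = cos s * exp (- (\<integral>x. \<bar>g x\<bar> powr \<alpha> \<partial>m))"
  using expectation_cos_phase[OF S_measurable[OF g] char_S[OF g], of 1 s] by simp

lemma nn_powr_simple_integrand: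
  assumes "simple_integrand m g"
  shows "(\<integral>\<^sup>+ x. ennreal (\<bar>g x\<bar> powr \<alpha>) \<partial>m) = ennreal (\<integral>x. \<bar>g x\<bar> powr \<alpha> \<partial>m)"
  by (rule nn_integral_eq_integral[OF powr_simple_integrand(1)[OF assms]]) simp

lemma is_stable_integral_S:
  assumes "simple_integrand m f"
  shows "is_stable_integral \<alpha> P m M f (S f)"
  unfolding is_stable_integral_def
proof (intro conjI exI[of _ "\<lambda>_. f"] allI)
  show "f \<in> borel_measurable m"
    using assms by (auto simp: simple_integrand_def intro: borel_measurable_simple_function)
  show "converges_in_prob P (\<lambda>k. S f) (S f)" by (auto simp: converges_in_prob_def)
qed (use assms S_measurable \<alpha>_pos nn_powr_simple_integrand in auto)

text \<open>By linearity, the difference between an approximating elementary integral and \<open>S f\<close> is the elementary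
integral of \<open>g\<^sub>k - f\<close>, whose characteristic function tends to 1; hence the difference between the limit
in probability and \<open>S f\<close> has characteristic function 1.\<close>

lemma is_stable_integral_unique:
  assumes f: "simple_integrand m f" and Y: "is_stable_integral \<alpha> P m M f Y"
  shows "AE \<omega> in P. Y \<omega> = S f \<omega>"
proof -
  obtain g where g: "\<And>k. simple_integrand m (g k)"
    and gf: "(\<lambda>k. \<integral>\<^sup>+ x. ennreal (\<bar>g k x - f x\<bar> powr \<alpha>) \<partial>m) \<longlonglongrightarrow> 0"
    and conv: "converges_in_prob P (\<lambda>k. S (g k)) Y"
    using Y by (auto simp: is_stable_integral_def)
  have Ym [measurable]: "Y \<in> borel_measurable P" using Y by (simp add: is_stable_integral_def)
  note [measurable] = S_measurable[OF f] S_measurable[OF g]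
  have d: "simple_integrand m (\<lambda>x. g k x - f x)" for k
    using simple_integrand_combine[OF g f, of k "-1"] by simp
  have "(\<lambda>k. enn2real (\<integral>\<^sup>+ x. ennreal (\<bar>g k x - f x\<bar> powr \<alpha>) \<partial>m)) \<longlonglongrightarrow> 0"
    by (rule tendsto_enn2real) (use gf in simp_all)
  then have lim: "(\<lambda>k. \<integral>x. \<bar>g k x - f x\<bar> powr \<alpha> \<partial>m) \<longlonglongrightarrow> 0"
    by (simp add: nn_powr_simple_integrand[OF d])
  have "AE \<omega> in P. Y \<omega> - S f \<omega> = 0"
  proof (rule AE_eq_0_if_cos)
    fix \<theta> :: real
    have "expectation (\<lambda>\<omega>. cos (\<theta> * (S (g k) \<omega> - S f \<omega>))) = exp (- (\<integral>x. \<bar>g k x - f x\<bar> powr \<alpha> \<partial>m) * \<bar>\<theta>\<bar> powr \<alpha>)" for k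
    proof -
      have "AE \<omega> in P. S (\<lambda>x. g k x - f x) \<omega> = S (g k) \<omega> - S f \<omega>"
        using S_combine[OF g f, of k "-1"] by simp
      then have "expectation (\<lambda>\<omega>. cos (\<theta> * (S (g k) \<omega> - S f \<omega>))) = expectation (\<lambda>\<omega>. cos (\<theta> * S (\<lambda>x. g k x - f x) \<omega>))"
        using S_measurable[OF d[of k]] by (intro integral_cong_AE) auto
      also have "\<dots> = exp (- (\<integral>x. \<bar>g k x - f x\<bar> powr \<alpha> \<partial>m) * \<bar>\<theta>\<bar> powr \<alpha>)"
        using expectation_cos_phase[OF S_measurable[OF d] char_S[OF d], of \<theta> k 0] by simp
      finally show ?thesis .
    qed
    then have "(\<lambda>k. exp (- (\<integral>x. \<bar>g k x - f x\<bar> powr \<alpha> \<partial>m) * \<bar>\<theta>\<bar> powr \<alpha>)) \<longlonglongrightarrow> expectation (\<lambda>\<omega>. cos (\<theta> * (Y \<omega> - S f \<omega>)))"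
      using tendsto_expectation_cos[OF S_measurable[OF g] Ym S_measurable[OF f] conv, of \<theta>] by simp
    moreover have "(\<lambda>k. exp (- (\<integral>x. \<bar>g k x - f x\<bar> powr \<alpha> \<partial>m) * \<bar>\<theta>\<bar> powr \<alpha>)) \<longlonglongrightarrow> exp (- 0 * \<bar>\<theta>\<bar> powr \<alpha>)"
      by (intro tendsto_intros lim)
    ultimately show "expectation (\<lambda>\<omega>. cos (\<theta> * (Y \<omega> - S f \<omega>))) = 1"
      using LIMSEQ_unique by fastforce
  qed auto
  then show ?thesis by eventually_elim simp
qed

lemma stable_integral_simple:
  assumes "simple_integrand m f"
  shows "stable_integral \<alpha> P m M f \<in> borel_measurable P"
    and "AE \<omega> in P. stable_integral \<alpha> P m M f \<omega> = S f \<omega>"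
proof -
  have *: "is_stable_integral \<alpha> P m M f (stable_integral \<alpha> P m M f)"
    unfolding stable_integral_def by (rule someI[of "is_stable_integral \<alpha> P m M f", OF is_stable_integral_S[OF assms]])
  then show "stable_integral \<alpha> P m M f \<in> borel_measurable P" by (simp add: is_stable_integral_def)
  show "AE \<omega> in P. stable_integral \<alpha> P m M f \<omega> = S f \<omega>"
    by (rule is_stable_integral_unique[OF assms *])
qed

text \<open>The integrands \<open>\<bar>F + G\<^sub>k\<bar>\<^sup>\<alpha>\<close> and \<open>\<bar>F\<bar>\<^sup>\<alpha> + \<bar>G\<^sub>k\<bar>\<^sup>\<alpha>\<close> coincide off the common support, and there they
differ by a bounded amount.\<close>

lemma norm_nearly_disjoint:
  assumes F: "simple_integrand m F" "\<And>x. \<bar>F x\<bar> \<le> B"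
    and G: "\<And>k. simple_integrand m (G k)" "\<And>k x. \<bar>G k x\<bar> \<le> C"
    and ov: "(\<lambda>k. measure m {x \<in> space m. F x \<noteq> 0 \<and> G k x \<noteq> 0}) \<longlonglongrightarrow> 0"
  shows "(\<lambda>k. (\<integral>x. \<bar>F x + G k x\<bar> powr \<alpha> \<partial>m) - (\<integral>x. \<bar>F x\<bar> powr \<alpha> \<partial>m) - (\<integral>x. \<bar>G k x\<bar> powr \<alpha> \<partial>m)) \<longlonglongrightarrow> 0"
proof -
  define D where "D = (B + C) powr \<alpha> + B powr \<alpha> + C powr \<alpha>"
  let ?O = "\<lambda>k. {x \<in> space m. F x \<noteq> 0 \<and> G k x \<noteq> 0}"
  have "norm ((\<integral>x. \<bar>F x + G k x\<bar> powr \<alpha> \<partial>m) - (\<integral>x. \<bar>F x\<bar> powr \<alpha> \<partial>m) - (\<integral>x. \<bar>G k x\<bar> powr \<alpha> \<partial>m))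
    \<le> D * measure m (?O k)" for k
  proof -
    have FG: "simple_integrand m (\<lambda>x. F x + G k x)"
      using simple_integrand_combine[OF F(1) G(1), of 1 k] by simp
    note int = powr_simple_integrand(1)[OF F(1)] powr_simple_integrand(1)[OF G(1)[of k]] powr_simple_integrand(1)[OF FG]
    have [measurable]: "F \<in> borel_measurable m" "G k \<in> borel_measurable m"
      using F(1) G(1)[of k] by (auto simp: simple_integrand_def intro: borel_measurable_simple_function)
    have O [measurable]: "?O k \<in> sets m" by measurable
    have "emeasure m (?O k) \<le> emeasure m {x \<in> space m. F x \<noteq> 0}"
      by (intro emeasure_mono) auto
    also have "\<dots> < \<infinity>" using F(1) by (simp add: simple_integrand_def)
    finally have fin: "emeasure m (?O k) < \<infinity>" .
    have "(\<integral>x. \<bar>F x + G k x\<bar> powr \<alpha> \<partial>m) - (\<integral>x. \<bar>F x\<bar> powr \<alpha> \<partial>m) - (\<integral>x. \<bar>G k x\<bar> powr \<alpha> \<partial>m)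
      = (\<integral>x. \<bar>F x + G k x\<bar> powr \<alpha> - \<bar>F x\<bar> powr \<alpha> - \<bar>G k x\<bar> powr \<alpha> \<partial>m)"
      using int by simp
    also have "norm \<dots> \<le> (\<integral>x. norm (\<bar>F x + G k x\<bar> powr \<alpha> - \<bar>F x\<bar> powr \<alpha> - \<bar>G k x\<bar> powr \<alpha>) \<partial>m)"
      by (rule integral_norm_bound)
    also have "\<dots> \<le> (\<integral>x. D * indicator (?O k) x \<partial>m)"
    proof (rule integral_mono)
      show "integrable m (\<lambda>x. norm (\<bar>F x + G k x\<bar> powr \<alpha> - \<bar>F x\<bar> powr \<alpha> - \<bar>G k x\<bar> powr \<alpha>))"
        using int by (intro integrable_norm Bochner_Integration.integrable_diff)
      show "integrable m (\<lambda>x. D * indicator (?O k) x)"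
        using fin O by (intro integrable_mult_right integrable_real_indicator)
      fix x assume x: "x \<in> space m"
      have "\<bar>F x + G k x\<bar> powr \<alpha> \<le> (B + C) powr \<alpha>" "\<bar>F x\<bar> powr \<alpha> \<le> B powr \<alpha>" "\<bar>G k x\<bar> powr \<alpha> \<le> C powr \<alpha>"
        using F(2)[of x] G(2)[of k x] \<alpha>_pos by (auto intro!: powr_mono2)
      then have "\<bar>\<bar>F x + G k x\<bar> powr \<alpha> - \<bar>F x\<bar> powr \<alpha> - \<bar>G k x\<bar> powr \<alpha>\<bar> \<le> D"
        unfolding D_def abs_le_iff
        using powr_ge_zero[of "\<bar>F x + G k x\<bar>" \<alpha>] powr_ge_zero[of "\<bar>F x\<bar>" \<alpha>] powr_ge_zero[of "\<bar>G k x\<bar>" \<alpha>]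
        by linarith
      then show "norm (\<bar>F x + G k x\<bar> powr \<alpha> - \<bar>F x\<bar> powr \<alpha> - \<bar>G k x\<bar> powr \<alpha>) \<le> D * indicator (?O k) x"
        using x by (cases "x \<in> ?O k") auto
    qed
    also have "\<dots> = D * measure m (?O k)" using O fin by (simp add: Int_def conj_commute)
    finally show ?thesis .
  qed
  then show ?thesis
    by (rule Lim_null_comparison[OF always_eventually[OF allI] tendsto_mult_right_zero[OF ov]])
qed

end

section \<open>Moments and atoms of symmetric stable laws\<close>

text \<open>Choose \<open>k\<close> with \<open>1 \<le> \<bar>x\<bar> / 2\<^sup>k \<le> 2\<close>; then the cosine is at most \<open>cos 1 < 1\<close>.\<close>

lemma abs_le_dyadic_cos:
  fixes x :: real
  assumes "1 \<le> \<bar>x\<bar>"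
  shows "\<exists>k::nat. \<bar>x\<bar> \<le> 2 / (1 - cos 1) * (2 ^ k * (1 - cos (x / 2 ^ k)))"
proof -
  have "nat \<lfloor>\<bar>x\<bar>\<rfloor> \<ge> 1" using assms by linarith
  then obtain k where k: "2 ^ k \<le> nat \<lfloor>\<bar>x\<bar>\<rfloor>" "nat \<lfloor>\<bar>x\<bar>\<rfloor> < 2 ^ (k + 1)"
    using ex_power_ivl1[of 2 "nat \<lfloor>\<bar>x\<bar>\<rfloor>"] by auto
  have "real (2 ^ k) \<le> real (nat \<lfloor>\<bar>x\<bar>\<rfloor>)" using k(1) of_nat_le_iff by blast
  moreover have nx: "real (nat \<lfloor>\<bar>x\<bar>\<rfloor>) \<le> \<bar>x\<bar>" "\<bar>x\<bar> < real (nat \<lfloor>\<bar>x\<bar>\<rfloor>) + 1" by linarith+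
  ultimately have "real (2 ^ k) \<le> \<bar>x\<bar>" by (meson order_trans)
  then have lo: "2 ^ k \<le> \<bar>x\<bar>" by simp
  have "real (nat \<lfloor>\<bar>x\<bar>\<rfloor> + 1) \<le> real (2 ^ (k + 1))" using k(2) by (subst of_nat_le_iff) simp
  then have "\<bar>x\<bar> \<le> real (2 ^ (k + 1))" using nx(2) unfolding of_nat_add of_nat_1 by linarith
  then have hi: "\<bar>x\<bar> \<le> 2 * 2 ^ k" by simp
  have c1: "cos 1 < (1::real)" using cos_monotone_0_pi[of 0 1] pi_gt3 by simp
  define y where "y = \<bar>x\<bar> / 2 ^ k"
  have "1 \<le> y" "y \<le> 2" using lo hi by (simp_all add: y_def field_simps)
  then have "cos y \<le> cos 1" using pi_gt3 by (intro cos_monotone_0_pi_le) auto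
  moreover have "cos y = cos (x / 2 ^ k)" unfolding y_def using cos_abs_real[of "x / 2 ^ k"] by simp
  ultimately have "1 - cos 1 \<le> 1 - cos (x / 2 ^ k)" by simp
  then have "2 * 2 ^ k * (1 - cos 1) \<le> 2 * 2 ^ k * (1 - cos (x / 2 ^ k))" by (intro mult_left_mono) auto
  moreover have "\<bar>x\<bar> * (1 - cos 1) \<le> 2 * 2 ^ k * (1 - cos 1)" using hi c1 by (intro mult_right_mono) auto
  ultimately have "\<bar>x\<bar> * (1 - cos 1) \<le> 2 * 2 ^ k * (1 - cos (x / 2 ^ k))" by linarith
  then have "\<bar>x\<bar> \<le> 2 / (1 - cos 1) * (2 ^ k * (1 - cos (x / 2 ^ k)))"
    using c1 by (simp add: field_simps)
  then show ?thesis by blast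
qed

lemma (in prob_space) sas_law_expectation_cos:
  assumes [measurable]: "X \<in> borel_measurable M" and "sas_law \<beta> \<sigma> (distr M borel X)"
  shows "expectation (\<lambda>\<omega>. cos (\<theta> * X \<omega>)) = exp (- (\<sigma> powr \<beta>) * \<bar>\<theta>\<bar> powr \<beta>)"
  using assms(2) expectation_cos_phase[OF assms(1), of \<theta> _ 0] by (simp add: sas_law_def)

text \<open>Summing the dyadic bound over all scales gives
\<open>\<bar>X\<bar> \<le> 1 + K \<Sum>\<^sub>k 2\<^sup>k (1 - cos (X / 2\<^sup>k))\<close>. The mean of the \<open>k\<close>-th term is at most
\<open>\<sigma>\<^sup>\<beta> 2\<^bsup>k(1 - \<beta>)\<^esup>\<close>, a convergent geometric series because \<open>\<beta> > 1\<close>.\<close>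

lemma (in prob_space) sas_rv_integrable:
  assumes \<beta>: "1 < \<beta>" and X: "sas_rv \<beta> M X"
  shows "integrable M X"
proof -
  obtain \<sigma> where Xm [measurable]: "X \<in> borel_measurable M" and law: "sas_law \<beta> \<sigma> (distr M borel X)"
    using X by (auto simp: sas_rv_def)
  define K where "K = 2 / (1 - cos (1::real))"
  define r where "r = (2::real) powr (1 - \<beta>)"
  define h where "h k \<omega> = 2 ^ k * (1 - cos (X \<omega> / 2 ^ k))" for k :: nat and \<omega>
  have c1: "cos 1 < (1::real)" using cos_monotone_0_pi[of 0 1] pi_gt3 by simp
  have K: "K > 0" using c1 by (simp add: K_def)
  have r: "0 < r" "r < 1" using \<beta> by (simp_all add: r_def powr_less_one)
  have h_nonneg: "h k \<omega> \<ge> 0" for k \<omega> by (simp add: h_def)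
  have h_meas [measurable]: "h k \<in> borel_measurable M" for k unfolding h_def by measurable
  have h_int: "integrable M (h k)" for k
    unfolding h_def using integrable_bounded_cos(1)[of "\<lambda>\<omega>. X \<omega> / 2 ^ k"] by simp
  have h_exp: "expectation (h k) \<le> \<sigma> powr \<beta> * r ^ k" for k
  proof -
    have "expectation (h k) = 2 ^ k * (1 - exp (- (\<sigma> powr \<beta>) * \<bar>1 / 2 ^ k\<bar> powr \<beta>))"
    proof -
      have "expectation (h k) = 2 ^ k * expectation (\<lambda>\<omega>. 1 - cos (1 / 2 ^ k * X \<omega>))"
        unfolding h_def by simp
      also have "expectation (\<lambda>\<omega>. 1 - cos (1 / 2 ^ k * X \<omega>)) = 1 - expectation (\<lambda>\<omega>. cos (1 / 2 ^ k * X \<omega>))"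
        using integrable_bounded_cos(1)[of "\<lambda>\<omega>. 1 / 2 ^ k * X \<omega>"]
        by (subst Bochner_Integration.integral_diff) (auto simp: prob_space)
      finally show ?thesis unfolding sas_law_expectation_cos[OF Xm law] .
    qed
    also have "\<dots> \<le> 2 ^ k * (\<sigma> powr \<beta> * \<bar>1 / 2 ^ k\<bar> powr \<beta>)"
    proof (intro mult_left_mono)
      have "1 + - (\<sigma> powr \<beta> * \<bar>1 / 2 ^ k\<bar> powr \<beta>) \<le> exp (- (\<sigma> powr \<beta> * \<bar>1 / 2 ^ k\<bar> powr \<beta>))"
        by (rule exp_ge_add_one_self)
      then show "1 - exp (- (\<sigma> powr \<beta>) * \<bar>1 / 2 ^ k\<bar> powr \<beta>) \<le> \<sigma> powr \<beta> * \<bar>1 / 2 ^ k\<bar> powr \<beta>"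
        by simp
    qed simp
    also have "\<dots> = \<sigma> powr \<beta> * (2 ^ k * \<bar>1 / 2 ^ k\<bar> powr \<beta>)" by simp
    also have "2 ^ k * \<bar>1 / 2 ^ k\<bar> powr \<beta> = r ^ k"
    proof -
      have "\<bar>1 / 2 ^ k\<bar> = (2::real) powr (- real k)" by (simp add: powr_minus powr_realpow divide_inverse)
      then have "2 ^ k * \<bar>1 / 2 ^ k\<bar> powr \<beta> = 2 powr (real k) * (2::real) powr (- real k * \<beta>)"
        by (simp add: powr_powr powr_realpow)
      also have "\<dots> = 2 powr ((1 - \<beta>) * real k)" by (simp add: powr_add[symmetric] algebra_simps)
      also have "\<dots> = r ^ k" unfolding r_def by (simp add: powr_powr[symmetric] powr_realpow)
      finally show ?thesis .
    qed
    finally show ?thesis .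
  qed
  have "(\<integral>\<^sup>+ \<omega>. ennreal \<bar>X \<omega>\<bar> \<partial>M) \<le> (\<integral>\<^sup>+ \<omega>. 1 + ennreal K * (\<Sum>k. ennreal (h k \<omega>)) \<partial>M)"
  proof (rule nn_integral_mono)
    fix \<omega>
    show "ennreal \<bar>X \<omega>\<bar> \<le> 1 + ennreal K * (\<Sum>k. ennreal (h k \<omega>))"
    proof (cases "1 \<le> \<bar>X \<omega>\<bar>")
      case True
      then obtain k where k: "\<bar>X \<omega>\<bar> \<le> K * h k \<omega>"
        using abs_le_dyadic_cos[OF True] unfolding K_def h_def by blast
      have "ennreal (h k \<omega>) = (\<Sum>i\<in>{k}. ennreal (h i \<omega>))" by simp
      also have "\<dots> \<le> (\<Sum>i. ennreal (h i \<omega>))" by (rule sum_le_suminf) auto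
      finally have "ennreal (h k \<omega>) \<le> (\<Sum>i. ennreal (h i \<omega>))" .
      then have "ennreal K * ennreal (h k \<omega>) \<le> ennreal K * (\<Sum>i. ennreal (h i \<omega>))"
        by (rule mult_left_mono) simp
      moreover have "ennreal \<bar>X \<omega>\<bar> \<le> ennreal K * ennreal (h k \<omega>)"
        using k K h_nonneg by (simp add: ennreal_mult[symmetric] ennreal_leI)
      ultimately show ?thesis by (meson add_increasing order_trans zero_le)
    next
      case False
      then have "ennreal \<bar>X \<omega>\<bar> \<le> 1" by (simp add: ennreal_le_1)
      then show ?thesis by (simp add: add_increasing2)
    qed
  qed
  also have "\<dots> = 1 + ennreal K * (\<Sum>k. \<integral>\<^sup>+ \<omega>. ennreal (h k \<omega>) \<partial>M)"
    by (simp add: nn_integral_add nn_integral_cmult nn_integral_suminf emeasure_space_1)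
  also have "(\<Sum>k. \<integral>\<^sup>+ \<omega>. ennreal (h k \<omega>) \<partial>M) = (\<Sum>k. ennreal (expectation (h k)))"
    using h_nonneg by (intro suminf_cong nn_integral_eq_integral h_int) auto
  also have "\<dots> \<le> (\<Sum>k. ennreal (\<sigma> powr \<beta> * r ^ k))"
    by (intro suminf_le ennreal_leI h_exp) auto
  also have "\<dots> = ennreal (\<Sum>k. \<sigma> powr \<beta> * r ^ k)"
    using r by (intro suminf_ennreal2) (auto intro!: summable_mult summable_geometric)
  finally have "(\<integral>\<^sup>+ \<omega>. ennreal \<bar>X \<omega>\<bar> \<partial>M) \<le> 1 + ennreal K * ennreal (\<Sum>k. \<sigma> powr \<beta> * r ^ k)"
    by (simp add: add_left_mono mult_left_mono)
  also have "\<dots> < \<infinity>" by (simp add: ennreal_mult_less_top)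
  finally show ?thesis by (intro integrableI_bounded) auto
qed

text \<open>The event \<open>X = 0\<close> is dominated by \<open>exp (- (n X)\<^sup>2 / 2)\<close>, which is the average of \<open>cos (n u X)\<close> over a
standard normal \<open>u\<close>. Exchanging the two averages gives the average of the characteristic
function of \<open>X\<close> at \<open>n u\<close>, and this vanishes as \<open>n\<close> grows.\<close>

lemma (in prob_space) sas_law_no_atom_at_0:
  assumes \<beta>: "0 < \<beta>" and \<sigma>: "0 < \<sigma>"
    and X [measurable]: "X \<in> borel_measurable M" and law: "sas_law \<beta> \<sigma> (distr M borel X)"
  shows "prob {\<omega> \<in> space M. X \<omega> = 0} = 0"
proof -
  let ?N = "std_normal_distribution"
  interpret N: real_distribution ?N by (rule real_dist_normal_dist)
  interpret pair: pair_prob_space ?N M ..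
  have le: "prob {\<omega> \<in> space M. X \<omega> = 0} \<le> (\<integral>u. exp (- (\<sigma> powr \<beta>) * \<bar>real n * u\<bar> powr \<beta>) \<partial>?N)" for n
  proof -
    have gauss: "(\<integral>u. cos (real n * u * y) \<partial>?N) = exp (- ((real n * y)\<^sup>2) / 2)" for y
    proof -
      have "char (distr ?N borel (\<lambda>u. u)) (real n * y) = of_real (exp (- ((real n * y)\<^sup>2) / 2))"
        using char_std_normal_distribution by (simp add: distr_id2[OF N.events_eq_borel[symmetric]])
      from N.expectation_cos_phase[OF _ this, of 0] show ?thesis
        by (simp add: mult_ac)
    qed
    have "prob {\<omega> \<in> space M. X \<omega> = 0} = (\<integral>\<omega>. indicator {\<omega> \<in> space M. X \<omega> = 0} \<omega> \<partial>M)" by simp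
    also have "\<dots> \<le> (\<integral>\<omega>. exp (- ((real n * X \<omega>)\<^sup>2) / 2) \<partial>M)"
    proof (rule integral_mono)
      show "integrable M (\<lambda>\<omega>. exp (- ((real n * X \<omega>)\<^sup>2) / 2))"
        by (rule integrable_const_bound[of _ 1]) auto
      show "integrable M (indicat_real {\<omega> \<in> space M. X \<omega> = 0})"
        by (rule integrable_real_indicator) (auto simp: emeasure_eq_measure)
    qed (auto simp: indicator_def)
    also have "\<dots> = (\<integral>\<omega>. (\<integral>u. cos (real n * u * X \<omega>) \<partial>?N) \<partial>M)" by (simp only: gauss)
    also have "\<dots> = (\<integral>u. (\<integral>\<omega>. cos (real n * u * X \<omega>) \<partial>M) \<partial>?N)"
      by (rule pair.Fubini_integral, rule pair.P.integrable_const_bound[of _ 1]) auto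
    also have "\<dots> = (\<integral>u. exp (- (\<sigma> powr \<beta>) * \<bar>real n * u\<bar> powr \<beta>) \<partial>?N)"
      by (simp only: sas_law_expectation_cos[OF X law])
    finally show ?thesis .
  qed
  have "(\<lambda>n. \<integral>u. exp (- (\<sigma> powr \<beta>) * \<bar>real n * u\<bar> powr \<beta>) \<partial>?N) \<longlonglongrightarrow> (\<integral>u. 0 \<partial>?N)"
  proof (rule integral_dominated_convergence[where w = "\<lambda>_. 1"])
    have "AE u in lborel. u \<noteq> (0::real)" by (rule AE_lborel_singleton)
    then have "AE u in ?N. u \<noteq> 0" by (subst AE_density) auto
    then show "AE u in ?N. (\<lambda>n. exp (- (\<sigma> powr \<beta>) * \<bar>real n * u\<bar> powr \<beta>)) \<longlonglongrightarrow> 0"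
    proof eventually_elim
      case (elim u)
      define c where "c = \<sigma> powr \<beta> * \<bar>u\<bar> powr \<beta>"
      have "c > 0" using elim \<sigma> by (simp add: c_def)
      have "(\<lambda>n. exp (- (c * real n powr \<beta>))) \<longlonglongrightarrow> 0"
        using \<open>c > 0\<close> \<beta> by real_asymp
      then show ?case by (simp add: c_def abs_mult powr_mult mult_ac)
    qed
  qed auto
  then have "prob {\<omega> \<in> space M. X \<omega> = 0} \<le> 0"
    using le by (intro LIMSEQ_le_const) auto
  then show ?thesis by (simp add: antisym)
qed

lemma (in prob_space) sas_law_0_AE:
  assumes [measurable]: "X \<in> borel_measurable M" and law: "sas_law \<beta> 0 (distr M borel X)"
  shows "AE \<omega> in M. X \<omega> = 0"
  using sas_law_expectation_cos[OF assms] by (intro AE_eq_0_if_cos) auto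

section \<open>Equal laws and vanishing probabilities\<close>

lemma same_fdd_distr:
  assumes "same_fdd I P X Q Y" "t \<in> I"
    and [measurable]: "X t \<in> borel_measurable P" "Y t \<in> borel_measurable Q"
  shows "distr P borel (X t) = distr Q borel (Y t)"
proof -
  have *: "distr (distr R (\<Pi>\<^sub>M i\<in>{t}. borel) (\<lambda>\<omega>. \<lambda>i\<in>{t}. Z i \<omega>)) borel (\<lambda>x. x t) = distr R borel (Z t)"
    if [measurable]: "Z t \<in> borel_measurable R" for Z :: "'a \<Rightarrow> 'e \<Rightarrow> real" and R
  proof (subst distr_distr)
    show "(\<lambda>x. x t) \<in> borel_measurable (\<Pi>\<^sub>M i\<in>{t}. borel)" by (rule measurable_component_singleton) simp
    show "(\<lambda>\<omega>. \<lambda>i\<in>{t}. Z i \<omega>) \<in> measurable R (\<Pi>\<^sub>M i\<in>{t}. borel)"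
      by (rule measurable_restrict) (use that in auto)
  qed (simp add: comp_def)
  have "distr P (\<Pi>\<^sub>M i\<in>{t}. borel) (\<lambda>\<omega>. \<lambda>i\<in>{t}. X i \<omega>) = distr Q (\<Pi>\<^sub>M i\<in>{t}. borel) (\<lambda>\<omega>. \<lambda>i\<in>{t}. Y i \<omega>)"
    using assms(1,2) by (simp add: same_fdd_def)
  then show ?thesis using *[of X P] *[of Y Q] by simp
qed

lemma AE_distr_eq_0:
  fixes X :: "'a \<Rightarrow> real" and Y :: "'b \<Rightarrow> real"
  assumes "distr P borel X = distr Q borel Y"
    and [measurable]: "X \<in> borel_measurable P" "Y \<in> borel_measurable Q" and "AE \<omega> in Q. Y \<omega> = 0"
  shows "AE \<omega> in P. X \<omega> = 0"
proof -
  have "AE x in distr Q borel Y. x = 0" by (subst AE_distr_iff) (use assms(4) in auto)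
  then show ?thesis unfolding assms(1)[symmetric] by (subst (asm) AE_distr_iff) auto
qed

lemma (in prob_space) expectation_vanishing_sets:
  fixes W :: "'a \<Rightarrow> real"
  assumes W: "integrable M W" and E [measurable]: "\<And>n. E n \<in> sets M"
    and ev: "AE \<omega> in M. \<forall>\<^sub>F n in sequentially. \<omega> \<notin> E n"
  shows "(\<lambda>n. expectation (\<lambda>\<omega>. W \<omega> * indicator (E n) \<omega>)) \<longlonglongrightarrow> 0"
proof -
  have [measurable]: "W \<in> borel_measurable M" using W by auto
  have "(\<lambda>n. expectation (\<lambda>\<omega>. W \<omega> * indicator (E n) \<omega>)) \<longlonglongrightarrow> expectation (\<lambda>\<omega>. 0)"
  proof (rule integral_dominated_convergence[where w = "\<lambda>\<omega>. \<bar>W \<omega>\<bar>"])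
    show "AE \<omega> in M. (\<lambda>n. W \<omega> * indicator (E n) \<omega>) \<longlonglongrightarrow> 0"
      using ev by eventually_elim (rule tendsto_eventually, erule eventually_mono, simp)
  qed (use W in \<open>auto simp: indicator_def\<close>)
  then show ?thesis by simp
qed

lemma (in prob_space) prob_vanishing_sets:
  assumes E [measurable]: "\<And>n. E n \<in> sets M"
    and ev: "AE \<omega> in M. \<forall>\<^sub>F n in sequentially. \<omega> \<notin> E n"
  shows "(\<lambda>n. prob (E n)) \<longlonglongrightarrow> 0"
  using expectation_vanishing_sets[of "\<lambda>_. 1" E] assms by simp

text \<open>Below a level \<open>k\<close> the variable contributes at most \<open>k\<close> times the probability of the event, and the
part of its mean above \<open>k\<close> is small uniformly in the event.\<close>

lemma (in prob_space) expectation_small_prob: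
  fixes W :: "'a \<Rightarrow> real"
  assumes W: "integrable M W" "\<And>\<omega>. 0 \<le> W \<omega>" and E [measurable]: "\<And>n. E n \<in> sets M"
    and lim: "(\<lambda>n. prob (E n)) \<longlonglongrightarrow> 0"
  shows "(\<lambda>n. expectation (\<lambda>\<omega>. W \<omega> * indicator (E n) \<omega>)) \<longlonglongrightarrow> 0"
proof (rule LIMSEQ_I)
  have [measurable]: "W \<in> borel_measurable M" using W by auto
  fix \<epsilon> :: real assume "\<epsilon> > 0"
  let ?T = "\<lambda>k::nat. {\<omega> \<in> space M. W \<omega> > real k}"
  have "(\<lambda>k. expectation (\<lambda>\<omega>. W \<omega> * indicator (?T k) \<omega>)) \<longlonglongrightarrow> 0"
  proof (rule expectation_vanishing_sets[OF W(1)])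
    have "W \<omega> \<le> real n" if "nat \<lceil>W \<omega>\<rceil> \<le> n" for \<omega> n using that by linarith
    then have "\<forall>\<^sub>F n in sequentially. \<omega> \<notin> ?T n" for \<omega>
      using eventually_ge_at_top[of "nat \<lceil>W \<omega>\<rceil>"] by (auto elim!: eventually_mono simp: not_less)
    then show "AE \<omega> in M. \<forall>\<^sub>F n in sequentially. \<omega> \<notin> ?T n" by simp
  qed auto
  then obtain k where k: "\<bar>expectation (\<lambda>\<omega>. W \<omega> * indicator (?T k) \<omega>)\<bar> < \<epsilon> / 2"
    using LIMSEQ_D[of _ 0 "\<epsilon> / 2"] \<open>\<epsilon> > 0\<close> by fastforce
  obtain N where N: "\<And>n. n \<ge> N \<Longrightarrow> prob (E n) < \<epsilon> / (2 * (real k + 1))"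
    using LIMSEQ_D[OF lim, of "\<epsilon> / (2 * (real k + 1))"] \<open>\<epsilon> > 0\<close> by fastforce
  have "norm (expectation (\<lambda>\<omega>. W \<omega> * indicator (E n) \<omega>) - 0) < \<epsilon>" if "n \<ge> N" for n
  proof -
    have int: "integrable M (\<lambda>\<omega>. W \<omega> * indicator A \<omega>)" if "A \<in> sets M" for A
      using integrable_real_mult_indicator[OF that W(1)] by simp
    have "expectation (\<lambda>\<omega>. W \<omega> * indicator (E n) \<omega>)
      \<le> expectation (\<lambda>\<omega>. real k * indicator (E n) \<omega> + W \<omega> * indicator (?T k) \<omega>)"
    proof (rule integral_mono)
      show "integrable M (\<lambda>\<omega>. real k * indicator (E n) \<omega> + W \<omega> * indicator (?T k) \<omega>)"
        by (intro Bochner_Integration.integrable_add int integrable_mult_right integrable_real_indicator)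
           (auto simp: emeasure_eq_measure)
      fix \<omega> assume "\<omega> \<in> space M"
      then show "W \<omega> * indicator (E n) \<omega> \<le> real k * indicator (E n) \<omega> + W \<omega> * indicator (?T k) \<omega>"
        using W(2)[of \<omega>] by (auto simp: indicator_def)
    qed (auto intro: int)
    also have "\<dots> = real k * prob (E n) + expectation (\<lambda>\<omega>. W \<omega> * indicator (?T k) \<omega>)"
      by (subst Bochner_Integration.integral_add)
         (auto simp: emeasure_eq_measure intro!: int integrable_mult_right integrable_real_indicator)
    also have "real k * prob (E n) \<le> (real k + 1) * prob (E n)" by (simp add: mult_right_mono)
    also have "(real k + 1) * prob (E n) < \<epsilon> / 2" using N[OF that] by (simp add: field_simps)
    finally have "expectation (\<lambda>\<omega>. W \<omega> * indicator (E n) \<omega>) < \<epsilon>" using k by auto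
    moreover have "0 \<le> expectation (\<lambda>\<omega>. W \<omega> * indicator (E n) \<omega>)"
      using W(2) by (intro Bochner_Integration.integral_nonneg) auto
    ultimately show ?thesis by simp
  qed
  then show "\<exists>no. \<forall>n\<ge>no. norm (expectation (\<lambda>\<omega>. W \<omega> * indicator (E n) \<omega>) - 0) < \<epsilon>" by blast
qed

lemma (in prob_space) tight:
  fixes X :: "'a \<Rightarrow> real"
  assumes [measurable]: "X \<in> borel_measurable M" and "\<epsilon> > 0"
  shows "\<exists>R. prob {\<omega> \<in> space M. \<bar>X \<omega>\<bar> > R} < \<epsilon>"
proof -
  let ?E = "\<lambda>n::nat. {\<omega> \<in> space M. \<bar>X \<omega>\<bar> > real n}"
  have "(\<lambda>n. prob (?E n)) \<longlonglongrightarrow> 0"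
  proof (rule prob_vanishing_sets)
    have "\<bar>X \<omega>\<bar> \<le> real n" if "nat \<lceil>\<bar>X \<omega>\<bar>\<rceil> \<le> n" for \<omega> n using that by linarith
    then have "\<forall>\<^sub>F n in sequentially. \<omega> \<notin> ?E n" for \<omega>
      using eventually_ge_at_top[of "nat \<lceil>\<bar>X \<omega>\<bar>\<rceil>"] by (auto elim!: eventually_mono simp: not_less)
    then show "AE \<omega> in M. \<forall>\<^sub>F n in sequentially. \<omega> \<notin> ?E n" by simp
  qed auto
  then have "\<forall>\<^sub>F n in sequentially. prob (?E n) < \<epsilon>" using \<open>\<epsilon> > 0\<close> by (rule order_tendstoD)
  then show ?thesis by (auto dest: eventually_happens'[rotated])
qed

section \<open>The indicator kernel of a self-similar stable process\<close>

text \<open>On each half-line the indicator of the segment from 0 to \<open>a\<close> is, up to a sign and a constant, the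
indicator of \<open>x < a\<close>. Sign and constant depend on \<open>x\<close> only, which is what makes the kernel
compatible with translations.\<close>

lemma indicator_segment_eq:
  fixes x a :: real
  assumes "x \<noteq> 0" "x \<noteq> a"
  shows "indicat_real (closed_segment 0 a) x = (if 0 < x then of_bool (x < a) else 1 - of_bool (x < a))"
  using assms by (auto simp: indicator_def closed_segment_eq_real_ivl)

lemma indicator_kernel_eq:
  assumes "x \<noteq> 0" "x \<noteq> A (real n) \<omega>" "x \<noteq> A (real n - 1) \<omega>"
  shows "indicator_kernel A n (\<omega>, x) = sgn x * (of_bool (x < A (real n) \<omega>) - of_bool (x < A (real n - 1) \<omega>))"
  using assms by (simp add: indicator_kernel_def indicator_segment_eq)

lemma indicator_kernel_nonzero:
  assumes "indicator_kernel A n (\<omega>, x) \<noteq> 0"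
  shows "x \<in> closed_segment (A (real n - 1) \<omega>) (A (real n) \<omega>)"
  using assms
  by (auto simp: indicator_kernel_def indicator_def of_bool_def closed_segment_eq_real_ivl split: if_splits)

lemma indicator_kernel_range: "indicator_kernel A n z \<in> {-1, 0, 1}"
  by (cases z) (auto simp: indicator_kernel_def indicator_def)

lemma emeasure_lborel_segment: "emeasure lborel (closed_segment a b) = ennreal \<bar>b - a\<bar>" for a b :: real
  by (auto simp: closed_segment_eq_real_ivl)

locale ssi_stable_process = prob_space P' for P' :: "'v measure" +
  fixes \<beta> H :: real and A :: "real \<Rightarrow> 'v \<Rightarrow> real"
  assumes \<beta>: "1 < \<beta>" and H: "0 < H"
    and sas: "sas_process \<beta> P' {0..} A"
    and non_deg: "non_degenerate P' A"
    and stat_incr: "stationary_increments P' A"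
    and self_sim: "self_similar H P' A"
begin

lemma A_measurable [measurable]: "0 \<le> t \<Longrightarrow> A t \<in> borel_measurable P'"
  using sas by (simp add: sas_process_def)

lemma A_sas_rv: "0 \<le> t \<Longrightarrow> sas_rv \<beta> P' (A t)"
  using sas[unfolded sas_process_def, THEN conjunct2, rule_format, of "{t}" "\<lambda>_. 1"] by simp

lemma increment_integrable:
  assumes "0 \<le> s" "0 \<le> t" shows "integrable P' (\<lambda>\<omega>. A t \<omega> - A s \<omega>)"
  using sas_rv_integrable[OF \<beta> A_sas_rv] assms by (intro Bochner_Integration.integrable_diff)

lemma A_scale: "0 < c \<Longrightarrow> 0 \<le> t \<Longrightarrow> distr P' borel (A (c * t)) = distr P' borel (\<lambda>\<omega>. c powr H * A t \<omega>)"
  using self_sim[unfolded self_similar_def, rule_format, of c]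
  by (rule same_fdd_distr) auto

lemma A_increment:
  "0 \<le> h \<Longrightarrow> 0 \<le> t \<Longrightarrow> distr P' borel (\<lambda>\<omega>. A (t + h) \<omega> - A h \<omega>) = distr P' borel (\<lambda>\<omega>. A t \<omega> - A 0 \<omega>)"
  using stat_incr[unfolded stationary_increments_def, rule_format, of h]
  by (rule same_fdd_distr) auto

text \<open>The scale of \<open>A\<^sub>0\<close> is invariant under multiplication by \<open>2\<^sup>H \<noteq> 1\<close>.\<close>

lemma A_0_eq_0: "AE \<omega> in P'. A 0 \<omega> = 0"
proof -
  obtain \<sigma> where \<sigma>: "\<sigma> \<ge> 0" and law: "sas_law \<beta> \<sigma> (distr P' borel (A 0))"
    using A_sas_rv[of 0] by (auto simp: sas_rv_def)
  have "expectation (\<lambda>\<omega>. cos (1 * A 0 \<omega>)) = expectation (\<lambda>\<omega>. cos (2 powr H * A 0 \<omega>))"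
  proof -
    have "expectation (\<lambda>\<omega>. cos (A 0 \<omega>)) = (\<integral>x. cos x \<partial>distr P' borel (A 0))"
      by (subst integral_distr) auto
    also have "\<dots> = (\<integral>x. cos x \<partial>distr P' borel (\<lambda>\<omega>. 2 powr H * A 0 \<omega>))"
      using A_scale[of 2 0] by simp
    also have "\<dots> = expectation (\<lambda>\<omega>. cos (2 powr H * A 0 \<omega>))" by (subst integral_distr) auto
    finally show ?thesis by simp
  qed
  then have "\<sigma> powr \<beta> = \<sigma> powr \<beta> * (2 powr H) powr \<beta>"
    unfolding sas_law_expectation_cos[OF A_measurable[OF order_refl] law] by simp
  moreover have "(2 powr H) powr \<beta> > 1" using H \<beta> by (simp add: powr_powr gr_one_powr)
  ultimately have "\<sigma> = 0" by auto
  then show ?thesis using law by (intro sas_law_0_AE) auto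
qed

text \<open>If the scale of \<open>A\<^sub>1\<close> were 0, self-similarity would make every \<open>A\<^sub>t\<close> vanish almost surely.\<close>

lemma A_1_no_atom: "prob {\<omega> \<in> space P'. A 1 \<omega> = 0} = 0"
proof -
  obtain \<sigma> where \<sigma>: "\<sigma> \<ge> 0" and law: "sas_law \<beta> \<sigma> (distr P' borel (A 1))"
    using A_sas_rv[of 1] by (auto simp: sas_rv_def)
  have "\<sigma> \<noteq> 0"
  proof
    assume "\<sigma> = 0"
    then have A1: "AE \<omega> in P'. A 1 \<omega> = 0" using law by (intro sas_law_0_AE) auto
    have "AE \<omega> in P'. A t \<omega> = 0" if "t \<ge> 0" for t
    proof (cases "t = 0")
      case False
      then have "distr P' borel (A t) = distr P' borel (\<lambda>\<omega>. t powr H * A 1 \<omega>)"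
        using A_scale[of t 1] that by simp
      then show ?thesis by (rule AE_distr_eq_0) (use that A1 in auto)
    qed (use A_0_eq_0 in simp)
    then show False using non_deg unfolding non_degenerate_def by blast
  qed
  then show ?thesis using \<sigma> \<beta> law by (intro sas_law_no_atom_at_0) auto
qed

lemma A_escapes: "(\<lambda>j. prob {\<omega> \<in> space P'. \<bar>A (real j) \<omega>\<bar> \<le> R}) \<longlonglongrightarrow> 0"
proof -
  let ?E = "\<lambda>j. {\<omega> \<in> space P'. \<bar>real j powr H * A 1 \<omega>\<bar> \<le> R}"
  have lim: "(\<lambda>j. prob (?E j)) \<longlonglongrightarrow> 0"
  proof (rule prob_vanishing_sets)
    have "AE \<omega> in P'. \<omega> \<notin> {\<omega> \<in> space P'. A 1 \<omega> = 0}"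
      using A_1_no_atom by (intro AE_not_in) (auto simp: null_sets_def emeasure_eq_measure)
    then show "AE \<omega> in P'. \<forall>\<^sub>F j in sequentially. \<omega> \<notin> ?E j"
      using AE_space
    proof eventually_elim
      case (elim \<omega>)
      define y where "y = \<bar>A 1 \<omega>\<bar>"
      have "y > 0" using elim by (auto simp: y_def)
      have "filterlim (\<lambda>j. real j powr H * y) at_top sequentially"
        using H \<open>y > 0\<close> by real_asymp
      then have "\<forall>\<^sub>F j in sequentially. R < real j powr H * y"
        by (rule filterlim_at_top_dense[THEN iffD1, rule_format])
      then show ?case by eventually_elim (auto simp: y_def abs_mult)
    qed
  qed auto
  have "prob (?E j) = prob {\<omega> \<in> space P'. \<bar>A (real j) \<omega>\<bar> \<le> R}" if "j \<ge> 1" for j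
  proof -
    have set: "{x::real. \<bar>x\<bar> \<le> R} \<in> sets borel" by measurable
    have "measure (distr P' borel (A (real j))) {x. \<bar>x\<bar> \<le> R}
       = measure (distr P' borel (\<lambda>\<omega>. real j powr H * A 1 \<omega>)) {x. \<bar>x\<bar> \<le> R}"
      using A_scale[of "real j" 1] that by simp
    then show ?thesis
      using set by (simp add: measure_distr vimage_def Int_def conj_commute)
  qed
  then have "\<forall>\<^sub>F j in sequentially. prob (?E j) = prob {\<omega> \<in> space P'. \<bar>A (real j) \<omega>\<bar> \<le> R}"
    using eventually_ge_at_top[of 1] by (rule eventually_mono[rotated])
  with lim show ?thesis by (rule Lim_transform_eventually)
qed

abbreviation "m \<equiv> P' \<Otimes>\<^sub>M (lborel :: real measure)"
abbreviation "K \<equiv> indicator_kernel A"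

definition support :: "nat \<Rightarrow> ('v \<times> real) set" where
  "support n = {z \<in> space m. K n z \<noteq> 0}"

lemma K_measurable [measurable]:
  assumes "1 \<le> n" shows "K n \<in> borel_measurable m"
proof -
  have [measurable]: "A (real n) \<in> borel_measurable P'" "A (real n - 1) \<in> borel_measurable P'"
    using assms by auto
  have seg: "indicat_real (closed_segment 0 a) x = (if 0 \<le> x \<and> x \<le> a \<or> a \<le> x \<and> x \<le> 0 then 1 else 0)" for a x :: real
    by (auto simp: indicator_def closed_segment_eq_real_ivl)
  show ?thesis unfolding indicator_kernel_def seg by measurable
qed

lemma support_sets [measurable]: "1 \<le> n \<Longrightarrow> support n \<in> sets m"
  unfolding support_def by measurable

text \<open>A common point \<open>x\<close> of the two segments lies within \<open>\<bar>A\<^sub>j - A\<^sub>j\<^sub>-\<^sub>1\<bar>\<close> of \<open>A\<^sub>j\<close> and within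
\<open>\<bar>A\<^sub>i\<bar> + \<bar>A\<^sub>i\<^sub>-\<^sub>1\<bar>\<close> of 0; this forces the event \<open>E\<close>. The overlap is never longer than
the \<open>i\<close>-th segment.\<close>

lemma overlap_le:
  assumes "1 \<le> i" "1 \<le> j"
  defines "W \<equiv> \<lambda>\<omega>. \<bar>A (real i) \<omega> - A (real i - 1) \<omega>\<bar>"
    and "E \<equiv> {\<omega> \<in> space P'. \<bar>A (real j) \<omega>\<bar> \<le> \<bar>A (real j) \<omega> - A (real j - 1) \<omega>\<bar> + \<bar>A (real i) \<omega>\<bar> + \<bar>A (real i - 1) \<omega>\<bar>}"
  shows "emeasure m (support i \<inter> support j) \<le> ennreal (expectation (\<lambda>\<omega>. W \<omega> * indicator E \<omega>))"
proof -
  have [measurable]: "A (real n) \<in> borel_measurable P'" "A (real n - 1) \<in> borel_measurable P'" if "1 \<le> n" for n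
    using that by auto
  have E [measurable]: "E \<in> sets P'" unfolding E_def using assms(1,2) by measurable
  have W: "integrable P' W" unfolding W_def using assms(1) by (intro integrable_abs increment_integrable) auto
  have "emeasure m (support i \<inter> support j) = (\<integral>\<^sup>+ \<omega>. emeasure lborel (Pair \<omega> -` (support i \<inter> support j)) \<partial>P')"
    by (intro lborel.emeasure_pair_measure_alt sets.Int support_sets assms(1,2))
  also have "\<dots> \<le> (\<integral>\<^sup>+ \<omega>. ennreal (W \<omega> * indicator E \<omega>) \<partial>P')"
  proof (rule nn_integral_mono)
    fix \<omega> assume \<omega>: "\<omega> \<in> space P'"
    show "emeasure lborel (Pair \<omega> -` (support i \<inter> support j)) \<le> ennreal (W \<omega> * indicator E \<omega>)"
    proof (cases "Pair \<omega> -` (support i \<inter> support j) = {}")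
      case False
      then obtain x where x: "K i (\<omega>, x) \<noteq> 0" "K j (\<omega>, x) \<noteq> 0" by (auto simp: support_def)
      have "x \<in> closed_segment (A (real i - 1) \<omega>) (A (real i) \<omega>)" "x \<in> closed_segment (A (real j - 1) \<omega>) (A (real j) \<omega>)"
        using x by (auto dest: indicator_kernel_nonzero)
      then have "\<omega> \<in> E" using \<omega> unfolding E_def
        by (auto simp: closed_segment_eq_real_ivl split: if_splits)
      have "Pair \<omega> -` (support i \<inter> support j) \<subseteq> closed_segment (A (real i - 1) \<omega>) (A (real i) \<omega>)"
        by (auto simp: support_def dest: indicator_kernel_nonzero)
      then have "emeasure lborel (Pair \<omega> -` (support i \<inter> support j)) \<le> emeasure lborel (closed_segment (A (real i - 1) \<omega>) (A (real i) \<omega>))"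
        by (intro emeasure_mono) auto
      then show ?thesis using \<open>\<omega> \<in> E\<close> by (simp add: emeasure_lborel_segment W_def)
    qed simp
  qed
  also have "\<dots> = ennreal (expectation (\<lambda>\<omega>. W \<omega> * indicator E \<omega>))"
    by (rule nn_integral_eq_integral) (use integrable_real_mult_indicator[OF E W] in \<open>auto simp: W_def\<close>)
  finally show ?thesis .
qed

lemma support_finite:
  assumes "1 \<le> n" shows "emeasure m (support n) < \<infinity>"
  using overlap_le[OF assms assms] by (simp add: order_le_less_trans)

text \<open>In the event that bounds the overlap, \<open>A\<^sub>j\<close> is at most a sum of two terms that are tight uniformly in
\<open>j\<close>: the unit increment has the law of \<open>A\<^sub>1 - A\<^sub>0\<close>, and the rest does not depend on \<open>j\<close>.\<close>

lemma overlap_tendsto_0: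
  assumes i: "1 \<le> i"
  shows "(\<lambda>j. measure m (support i \<inter> support j)) \<longlonglongrightarrow> 0"
proof -
  define W where "W \<omega> = \<bar>A (real i) \<omega> - A (real i - 1) \<omega>\<bar>" for \<omega>
  define Y where "Y \<omega> = \<bar>A (real i) \<omega>\<bar> + \<bar>A (real i - 1) \<omega>\<bar>" for \<omega>
  \<comment> \<open>the index is moved by one so that all times are nonnegative; the limit is the same\<close>
  define E where "E j = {\<omega> \<in> space P'. \<bar>A (real (Suc j)) \<omega>\<bar> \<le>
    \<bar>A (real (Suc j)) \<omega> - A (real (Suc j) - 1) \<omega>\<bar> + \<bar>A (real i) \<omega>\<bar> + \<bar>A (real i - 1) \<omega>\<bar>}" for j
  have Am [measurable]: "A (real n) \<in> borel_measurable P'" "A (real n - 1) \<in> borel_measurable P'" if "1 \<le> n" for n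
    using that by auto
  have Am' [measurable]: "A (real (Suc j)) \<in> borel_measurable P'" "A (real (Suc j) - 1) \<in> borel_measurable P'" for j
    by auto
  have Ym [measurable]: "Y \<in> borel_measurable P'" unfolding Y_def using i by measurable
  have E [measurable]: "E j \<in> sets P'" for j unfolding E_def using i by measurable
  have W: "integrable P' W" unfolding W_def using i by (intro integrable_abs increment_integrable) auto
  have "(\<lambda>j. prob (E j)) \<longlonglongrightarrow> 0"
  proof (rule LIMSEQ_I)
    fix \<epsilon> :: real assume "\<epsilon> > 0"
    obtain R where R: "prob {\<omega> \<in> space P'. \<bar>Y \<omega>\<bar> > R} < \<epsilon> / 3"
      using tight[OF Ym, of "\<epsilon> / 3"] \<open>\<epsilon> > 0\<close> by auto
    have D [measurable]: "(\<lambda>\<omega>. A 1 \<omega> - A 0 \<omega>) \<in> borel_measurable P'" by auto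
    obtain Q where Q: "prob {\<omega> \<in> space P'. \<bar>A 1 \<omega> - A 0 \<omega>\<bar> > Q} < \<epsilon> / 3"
      using tight[OF D, of "\<epsilon> / 3"] \<open>\<epsilon> > 0\<close> by auto
    obtain N where N: "\<And>j. j \<ge> N \<Longrightarrow> prob {\<omega> \<in> space P'. \<bar>A (real j) \<omega>\<bar> \<le> R + Q} < \<epsilon> / 3"
      using LIMSEQ_D[OF A_escapes[of "R + Q"], of "\<epsilon> / 3"] \<open>\<epsilon> > 0\<close> by auto
    have "norm (prob (E j) - 0) < \<epsilon>" if "j \<ge> N" for j
    proof -
      let ?B1 = "{\<omega> \<in> space P'. \<bar>Y \<omega>\<bar> > R}"
      let ?B2 = "{\<omega> \<in> space P'. \<bar>A (real (Suc j)) \<omega> - A (real (Suc j) - 1) \<omega>\<bar> > Q}"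
      let ?B3 = "{\<omega> \<in> space P'. \<bar>A (real (Suc j)) \<omega>\<bar> \<le> R + Q}"
      have [measurable]: "?B1 \<in> sets P'" "?B2 \<in> sets P'" "?B3 \<in> sets P'" by measurable
      have "?B1 \<union> ?B2 \<union> ?B3 \<in> sets P'" by (intro sets.Un) fact+
      then have "prob (E j) \<le> prob (?B1 \<union> ?B2 \<union> ?B3)"
        by (rule finite_measure_mono[rotated]) (auto simp: E_def Y_def)
      also have "\<dots> \<le> prob ?B1 + prob ?B2 + prob ?B3"
        using measure_Un_le[of "?B1 \<union> ?B2" P' ?B3] measure_Un_le[of ?B1 P' ?B2] by simp
      also have "prob ?B2 = prob {\<omega> \<in> space P'. \<bar>A 1 \<omega> - A 0 \<omega>\<bar> > Q}"
      proof -
        have set: "{x::real. \<bar>x\<bar> > Q} \<in> sets borel" by measurable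
        have "measure (distr P' borel (\<lambda>\<omega>. A (real (Suc j)) \<omega> - A (real (Suc j) - 1) \<omega>)) {x. \<bar>x\<bar> > Q}
           = measure (distr P' borel (\<lambda>\<omega>. A 1 \<omega> - A 0 \<omega>)) {x. \<bar>x\<bar> > Q}"
          using A_increment[of "real j" 1] by (simp add: add.commute)
        moreover have "measure (distr P' borel (\<lambda>\<omega>. A (real (Suc j)) \<omega> - A (real (Suc j) - 1) \<omega>)) {x. \<bar>x\<bar> > Q} = prob ?B2"
          using set by (subst measure_distr) (auto simp: vimage_def Int_def conj_commute simp del: of_nat_Suc)
        moreover have "measure (distr P' borel (\<lambda>\<omega>. A 1 \<omega> - A 0 \<omega>)) {x. \<bar>x\<bar> > Q} = prob {\<omega> \<in> space P'. \<bar>A 1 \<omega> - A 0 \<omega>\<bar> > Q}"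
          using set by (subst measure_distr) (auto simp: vimage_def Int_def conj_commute)
        ultimately show ?thesis by simp
      qed
      finally have "prob (E j) < \<epsilon>" using R Q N[of "Suc j"] that by linarith
      then show ?thesis by simp
    qed
    then show "\<exists>no. \<forall>j\<ge>no. norm (prob (E j) - 0) < \<epsilon>" by blast
  qed
  then have lim: "(\<lambda>j. expectation (\<lambda>\<omega>. W \<omega> * indicator (E j) \<omega>)) \<longlonglongrightarrow> 0"
    by (intro expectation_small_prob W E) (auto simp: W_def)
  have le: "measure m (support i \<inter> support (Suc j)) \<le> expectation (\<lambda>\<omega>. W \<omega> * indicator (E j) \<omega>)" for j
  proof -
    have "0 \<le> expectation (\<lambda>\<omega>. W \<omega> * indicator (E j) \<omega>)"
      by (intro Bochner_Integration.integral_nonneg) (auto simp: W_def)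
    moreover have "emeasure m (support i \<inter> support (Suc j)) \<le> ennreal (expectation (\<lambda>\<omega>. W \<omega> * indicator (E j) \<omega>))"
      unfolding W_def E_def by (rule overlap_le) (use i in auto)
    ultimately show ?thesis unfolding measure_def by (rule enn2real_leI)
  qed
  have "(\<lambda>j. measure m (support i \<inter> support (Suc j))) \<longlonglongrightarrow> 0"
    by (rule tendsto_sandwich[OF _ _ tendsto_const lim]) (use le in auto)
  then show ?thesis by (rule LIMSEQ_imp_Suc)
qed

lemma simple_integrand_K:
  assumes "1 \<le> n" shows "simple_integrand m (K n)"
proof -
  have "finite (K n ` space m)"
    by (rule finite_subset[of _ "{-1, 0, 1}"], rule image_subsetI, rule indicator_kernel_range) simp
  then have "simple_function m (K n)"
    using K_measurable[OF assms] by (simp add: simple_function_borel_measurable)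
  then show ?thesis using support_finite[OF assms] by (simp add: simple_integrand_def support_def)
qed

text \<open>The inner integral is a functional \<open>\<Psi>\<close> of the path that is unchanged when a constant is subtracted from the path.
Subtracting \<open>A(h)\<close> turns the shifted path into its increments, to which
stationarity of the increments applies.\<close>

lemma K_norm_shift:
  fixes a :: "nat \<Rightarrow> real" and \<alpha> :: real
  assumes J: "finite J" "J \<subseteq> {1..}"
  shows "(\<integral>\<^sup>+ z. ennreal (\<bar>\<Sum>j\<in>J. a j * K (j + h) z\<bar> powr \<alpha>) \<partial>m) =
    (\<integral>\<^sup>+ z. ennreal (\<bar>\<Sum>j\<in>J. a j * K j z\<bar> powr \<alpha>) \<partial>m)"
proof -
  \<comment> \<open>the times at which the path enters; all are nonnegative because \<open>J\<close> omits 0\<close>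
  define T where "T = real ` J \<union> (\<lambda>j. real j - 1) ` J"
  have T: "finite T" "T \<subseteq> {0..}" using J by (auto simp: T_def)
  have TJ: "real j \<in> T" "real j - 1 \<in> T" if "j \<in> J" for j using that by (auto simp: T_def)
  define s :: "real \<Rightarrow> real \<Rightarrow> real" where "s u x = (if x < u then 1 else 0)" for u x
  define F where "F y x = \<bar>\<Sum>j\<in>J. a j * (s (y (real j)) x - s (y (real j - 1)) x)\<bar> powr \<alpha>" for y x
  define \<Psi> where "\<Psi> y = (\<integral>\<^sup>+ x. ennreal (F y x) \<partial>lborel)" for y
  have s_meas [measurable]: "(\<lambda>p. s (f p) (g p)) \<in> borel_measurable N"
    if [measurable]: "f \<in> borel_measurable N" "g \<in> borel_measurable N" for f g and N :: "'c measure"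
    unfolding s_def by measurable
  have \<Psi>_meas [measurable]: "\<Psi> \<in> borel_measurable (\<Pi>\<^sub>M t\<in>T. borel)"
  proof -
    have [measurable]: "(\<lambda>p. fst p t) \<in> borel_measurable ((\<Pi>\<^sub>M t\<in>T. borel) \<Otimes>\<^sub>M (lborel :: real measure))" if "t \<in> T" for t
      using that by (intro measurable_compose[OF measurable_fst measurable_component_singleton]) auto
    have "(\<lambda>p. ennreal (F (fst p) (snd p))) \<in> borel_measurable ((\<Pi>\<^sub>M t\<in>T. borel) \<Otimes>\<^sub>M (lborel :: real measure))"
      unfolding F_def using TJ by measurable
    then show ?thesis unfolding \<Psi>_def
      by (intro lborel.borel_measurable_nn_integral) (simp add: case_prod_beta')
  qed
  have F_cong: "F y x = F y' x" if "\<And>t. t \<in> T \<Longrightarrow> y t = y' t" for y y' x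
    unfolding F_def using that TJ by (metis (no_types, lifting) sum.cong)
  have \<Psi>_cong: "\<Psi> y = \<Psi> y'" if "\<And>t. t \<in> T \<Longrightarrow> y t = y' t" for y y'
    unfolding \<Psi>_def using F_cong[of y y'] that by simp
  have \<Psi>_translate: "\<Psi> (\<lambda>t. y t - c) = \<Psi> y" for y c
  proof -
    have [measurable]: "(\<lambda>x. ennreal (F y x)) \<in> borel_measurable borel"
      unfolding F_def by measurable
    have "\<Psi> y = (\<integral>\<^sup>+ x. ennreal (F y (c + 1 * x)) \<partial>lborel)"
      unfolding \<Psi>_def by (subst nn_integral_real_affine[of _ 1 c]) auto
    also have "\<dots> = \<Psi> (\<lambda>t. y t - c)"
      unfolding \<Psi>_def F_def s_def by (simp add: less_diff_eq add.commute)
    finally show ?thesis by simp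
  qed
  have norm_eq: "(\<integral>\<^sup>+ z. ennreal (\<bar>\<Sum>j\<in>J. a j * K (j + h) z\<bar> powr \<alpha>) \<partial>m) =
      (\<integral>\<^sup>+ \<omega>. \<Psi> (\<lambda>t. A (t + real h) \<omega>) \<partial>P')" for h
  proof -
    have [measurable]: "K (j + h) \<in> borel_measurable m" if "j \<in> J" for j
      using that J by (intro K_measurable) auto
    have "(\<integral>\<^sup>+ z. ennreal (\<bar>\<Sum>j\<in>J. a j * K (j + h) z\<bar> powr \<alpha>) \<partial>m) =
      (\<integral>\<^sup>+ \<omega>. \<integral>\<^sup>+ x. ennreal (\<bar>\<Sum>j\<in>J. a j * K (j + h) (\<omega>, x)\<bar> powr \<alpha>) \<partial>lborel \<partial>P')"
      by (intro lborel.nn_integral_fst[symmetric]) measurable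
    also have "\<dots> = (\<integral>\<^sup>+ \<omega>. \<Psi> (\<lambda>t. A (t + real h) \<omega>) \<partial>P')"
      unfolding \<Psi>_def
    proof (rule nn_integral_cong, rule nn_integral_cong_AE)
      fix \<omega>
      have "AE x in lborel. \<forall>t\<in>T. x \<noteq> A (t + real h) \<omega>"
        using T(1) by (simp add: AE_finite_all AE_lborel_singleton)
      moreover have "AE x in lborel. x \<noteq> (0::real)" by (rule AE_lborel_singleton)
      ultimately show "AE x in lborel. ennreal (\<bar>\<Sum>j\<in>J. a j * K (j + h) (\<omega>, x)\<bar> powr \<alpha>) = ennreal (F (\<lambda>t. A (t + real h) \<omega>) x)"
      proof eventually_elim
        case (elim x)
        have "K (j + h) (\<omega>, x) = sgn x * (s (A (real j + real h) \<omega>) x - s (A (real j - 1 + real h) \<omega>) x)" if "j \<in> J" for j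
        proof -
          have times: "real (j + h) = real j + real h" "real j + real h - 1 = real j - 1 + real h" by simp_all
          show ?thesis
            using indicator_kernel_eq[of x A "j + h" \<omega>, unfolded times] elim TJ[OF that]
            by (simp add: s_def of_bool_def)
        qed
        then have "(\<Sum>j\<in>J. a j * K (j + h) (\<omega>, x)) =
          (\<Sum>j\<in>J. sgn x * (a j * (s (A (real j + real h) \<omega>) x - s (A (real j - 1 + real h) \<omega>) x)))"
          by (intro sum.cong) auto
        also have "\<dots> = sgn x * (\<Sum>j\<in>J. a j * (s (A (real j + real h) \<omega>) x - s (A (real j - 1 + real h) \<omega>) x))"
          by (simp add: sum_distrib_left)
        finally show ?case using elim by (simp add: F_def abs_mult abs_sgn_eq)
      qed
    qed
    finally show ?thesis .
  qed
  have increments: "(\<integral>\<^sup>+ \<omega>. \<Psi> (\<lambda>t. A (t + real h) \<omega>) \<partial>P') =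
      (\<integral>\<^sup>+ y. \<Psi> y \<partial>distr P' (\<Pi>\<^sub>M t\<in>T. borel) (\<lambda>\<omega>. \<lambda>t\<in>T. A (t + real h) \<omega> - A (real h) \<omega>))" for h
  proof -
    have [measurable]: "(\<lambda>\<omega>. \<lambda>t\<in>T. A (t + real h) \<omega> - A (real h) \<omega>) \<in> measurable P' (\<Pi>\<^sub>M t\<in>T. borel)"
      using T(2) by (intro measurable_restrict borel_measurable_diff A_measurable) auto
    have "\<Psi> (\<lambda>t. A (t + real h) \<omega>) = \<Psi> (\<lambda>t\<in>T. A (t + real h) \<omega> - A (real h) \<omega>)" for \<omega>
      using \<Psi>_translate[of "\<lambda>t. A (t + real h) \<omega>" "A (real h) \<omega>"]
        \<Psi>_cong[of "\<lambda>t. A (t + real h) \<omega> - A (real h) \<omega>" "\<lambda>t\<in>T. A (t + real h) \<omega> - A (real h) \<omega>"] by simp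
    then show ?thesis by (simp add: nn_integral_distr)
  qed
  have "distr P' (\<Pi>\<^sub>M t\<in>T. borel) (\<lambda>\<omega>. \<lambda>t\<in>T. A (t + real h) \<omega> - A (real h) \<omega>)
    = distr P' (\<Pi>\<^sub>M t\<in>T. borel) (\<lambda>\<omega>. \<lambda>t\<in>T. A (t + real 0) \<omega> - A (real 0) \<omega>)"
    using stat_incr[unfolded stationary_increments_def same_fdd_def, rule_format, of "real h" T] T by simp
  then show ?thesis
    using norm_eq[of h] norm_eq[of 0] increments[of h] increments[of 0] by simp
qed

end

section \<open>The indicator noise\<close>

lemma left_shift_funpow: "1 \<le> j \<Longrightarrow> (left_shift ^^ k) x j = x (j + k)"
  by (induction k arbitrary: j) (auto simp: left_shift_def)

lemma left_shift_funpow_measurable: "left_shift ^^ k \<in> measurable seq_space seq_space"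
proof (induction k)
  case (Suc k)
  have "left_shift \<in> measurable seq_space seq_space"
    unfolding left_shift_def seq_space_def by (intro measurable_restrict measurable_component_singleton) auto
  then show ?case using Suc by (simp add: measurable_comp)
qed (simp add: id_def)

locale indicator_noise_process =
  stable_measure P \<alpha> "P' \<Otimes>\<^sub>M (lborel :: real measure)" M + A: ssi_stable_process P' \<beta> H A
  for P :: "'w measure" and \<alpha> :: real and P' :: "'v measure" and M :: "('v \<times> real) set \<Rightarrow> 'w \<Rightarrow> real"
    and \<beta> H :: real and A :: "real \<Rightarrow> 'v \<Rightarrow> real"
begin

abbreviation "m \<equiv> P' \<Otimes>\<^sub>M (lborel :: real measure)"
abbreviation "Z \<equiv> indicator_noise \<alpha> P P' M A"

definition kernel_sum :: "nat set \<Rightarrow> (nat \<Rightarrow> real) \<Rightarrow> nat \<Rightarrow> 'v \<times> real \<Rightarrow> real" where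
  "kernel_sum J a h z = (\<Sum>j\<in>J. a j * indicator_kernel A (j + h) z)"

definition scale :: "nat set \<Rightarrow> (nat \<Rightarrow> real) \<Rightarrow> real" where
  "scale J a = (\<integral>z. \<bar>kernel_sum J a 0 z\<bar> powr \<alpha> \<partial>m)"

lemma Z_measurable [measurable]: "1 \<le> n \<Longrightarrow> Z n \<in> borel_measurable P"
  unfolding indicator_noise_def by (intro stable_integral_simple A.simple_integrand_K)

lemma Z_eq: "1 \<le> n \<Longrightarrow> AE \<omega> in P. Z n \<omega> = S (indicator_kernel A n) \<omega>"
  unfolding indicator_noise_def by (intro stable_integral_simple A.simple_integrand_K)

lemma sum_Z_measurable [measurable]:
  "J \<subseteq> {1..} \<Longrightarrow> (\<lambda>\<omega>. \<Sum>j\<in>J. a j * Z (j + h) \<omega>) \<in> borel_measurable P"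
  by (intro borel_measurable_sum borel_measurable_times Z_measurable) auto

lemma simple_integrand_kernel_sum:
  "finite J \<Longrightarrow> J \<subseteq> {1..} \<Longrightarrow> simple_integrand m (kernel_sum J a h)"
  unfolding kernel_sum_def[abs_def] by (intro simple_integrand_linear A.simple_integrand_K) auto

lemma sum_Z_eq:
  assumes J: "finite J" "J \<subseteq> {1..}"
  shows "AE \<omega> in P. (\<Sum>j\<in>J. a j * Z (j + h) \<omega>) = S (kernel_sum J a h) \<omega>"
proof -
  have "AE \<omega> in P. \<forall>j\<in>J. Z (j + h) \<omega> = S (indicator_kernel A (j + h)) \<omega>"
    using J by (subst AE_finite_all) (auto intro!: Z_eq)
  moreover have "AE \<omega> in P. S (kernel_sum J a h) \<omega> = (\<Sum>j\<in>J. a j * S (indicator_kernel A (j + h)) \<omega>)"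
    unfolding kernel_sum_def[abs_def] using J by (intro S_linear A.simple_integrand_K) auto
  ultimately show ?thesis by eventually_elim simp
qed

lemma kernel_sum_norm_shift:
  assumes J: "finite J" "J \<subseteq> {1..}"
  shows "(\<integral>z. \<bar>kernel_sum J a h z\<bar> powr \<alpha> \<partial>m) = scale J a"
proof -
  have "ennreal (\<integral>z. \<bar>kernel_sum J a h z\<bar> powr \<alpha> \<partial>m) = (\<integral>\<^sup>+ z. ennreal (\<bar>kernel_sum J a h z\<bar> powr \<alpha>) \<partial>m)"
    by (rule nn_powr_simple_integrand[OF simple_integrand_kernel_sum[OF J], symmetric])
  also have "\<dots> = (\<integral>\<^sup>+ z. ennreal (\<bar>kernel_sum J a 0 z\<bar> powr \<alpha>) \<partial>m)"
    using A.K_norm_shift[OF J, of a h \<alpha>] by (simp add: kernel_sum_def)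
  also have "\<dots> = ennreal (scale J a)"
    unfolding scale_def by (rule nn_powr_simple_integrand[OF simple_integrand_kernel_sum[OF J]])
  finally show ?thesis by (subst (asm) ennreal_inj) (auto simp: scale_def)
qed

lemma expectation_cos_sum_Z:
  assumes J: "finite J" "J \<subseteq> {1..}"
  shows "expectation (\<lambda>\<omega>. cos ((\<Sum>j\<in>J. a j * Z (j + h) \<omega>) + s)) = cos s * exp (- scale J a)"
proof -
  have "expectation (\<lambda>\<omega>. cos ((\<Sum>j\<in>J. a j * Z (j + h) \<omega>) + s)) = expectation (\<lambda>\<omega>. cos (S (kernel_sum J a h) \<omega> + s))"
    using sum_Z_eq[OF J, of a h] S_measurable[OF simple_integrand_kernel_sum[OF J, of a h]] sum_Z_measurable[OF J(2), of a h]
    by (intro integral_cong_AE) auto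
  then show ?thesis
    using expectation_cos_S[OF simple_integrand_kernel_sum[OF J]] kernel_sum_norm_shift[OF J] by simp
qed

lemma sas_process_Z: "sas_process \<alpha> P {1..} Z"
  unfolding sas_process_def
proof (intro conjI ballI allI impI)
  fix J :: "nat set" and a :: "nat \<Rightarrow> real"
  assume "finite J \<and> J \<subseteq> {1..}"
  then have J: "finite J" "J \<subseteq> {1..}" by auto
  note si = simple_integrand_kernel_sum[OF J, of a 0]
  have meas: "(\<lambda>\<omega>. \<Sum>j\<in>J. a j * Z j \<omega>) \<in> borel_measurable P" using sum_Z_measurable[OF J(2), of a 0] by simp
  have "distr P borel (\<lambda>\<omega>. \<Sum>j\<in>J. a j * Z j \<omega>) = distr P borel (S (kernel_sum J a 0))"
    using sum_Z_eq[OF J, of a 0] meas S_measurable[OF si] by (intro distr_cong_AE) auto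
  then have "char (distr P borel (\<lambda>\<omega>. \<Sum>j\<in>J. a j * Z j \<omega>)) \<theta> = of_real (exp (- scale J a * \<bar>\<theta>\<bar> powr \<alpha>))" for \<theta>
    using char_S[OF si, of \<theta>] by (simp add: scale_def)
  moreover have "(scale J a powr (1 / \<alpha>)) powr \<alpha> = scale J a"
    using \<alpha>_pos by (simp add: powr_powr scale_def)
  moreover have "real_distribution (distr P borel (\<lambda>\<omega>. \<Sum>j\<in>J. a j * Z j \<omega>))"
    using meas by (rule real_distribution_distr)
  ultimately have "sas_law \<alpha> (scale J a powr (1 / \<alpha>)) (distr P borel (\<lambda>\<omega>. \<Sum>j\<in>J. a j * Z j \<omega>))"
    by (simp add: sas_law_def)
  then show "sas_rv \<alpha> P (\<lambda>\<omega>. \<Sum>j\<in>J. a j * Z j \<omega>)"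
    using meas by (auto simp: sas_rv_def intro!: exI[of _ "scale J a powr (1 / \<alpha>)"])
qed auto

text \<open>Finite index sets give stationarity; the set of all positive integers gives invariance of the path
law under the shift.\<close>

lemma law_Z_shift:
  assumes I: "I \<subseteq> {1..}"
  shows "distr P (\<Pi>\<^sub>M n\<in>I. borel) (\<lambda>\<omega>. \<lambda>n\<in>I. Z (n + h) \<omega>) = distr P (\<Pi>\<^sub>M n\<in>I. borel) (\<lambda>\<omega>. \<lambda>n\<in>I. Z n \<omega>)"
proof (rule law_eqI_cosines)
  have meas [measurable]: "(\<lambda>\<omega>. \<lambda>n\<in>I. Z (n + h) \<omega>) \<in> measurable P (\<Pi>\<^sub>M n\<in>I. borel)" for h
    using I by (intro measurable_restrict Z_measurable) auto
  have meas0 [measurable]: "(\<lambda>\<omega>. \<lambda>n\<in>I. Z n \<omega>) \<in> measurable P (\<Pi>\<^sub>M n\<in>I. borel)"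
    using meas[of 0] by simp
  show "prob_space (distr P (\<Pi>\<^sub>M n\<in>I. borel) (\<lambda>\<omega>. \<lambda>n\<in>I. Z (n + h) \<omega>))"
    "prob_space (distr P (\<Pi>\<^sub>M n\<in>I. borel) (\<lambda>\<omega>. \<lambda>n\<in>I. Z n \<omega>))"
    by (intro prob_space_distr meas meas0)+
  fix J :: "nat set" and a :: "nat \<Rightarrow> real" and s assume J: "finite J" "J \<subseteq> I"
  have [measurable]: "(\<lambda>x. x j) \<in> borel_measurable (\<Pi>\<^sub>M n\<in>I. (borel :: real measure))" if "j \<in> J" for j
    by (rule measurable_component_singleton) (use J that in auto)
  have [measurable]: "(\<lambda>x. cos ((\<Sum>j\<in>J. a j * x j) + s)) \<in> borel_measurable (\<Pi>\<^sub>M n\<in>I. (borel :: real measure))"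
    by measurable
  have "(\<integral>x. cos ((\<Sum>j\<in>J. a j * x j) + s) \<partial>distr P (\<Pi>\<^sub>M n\<in>I. borel) (\<lambda>\<omega>. \<lambda>n\<in>I. Z (n + h) \<omega>)) = cos s * exp (- scale J a)" for h
  proof -
    have "(\<integral>x. cos ((\<Sum>j\<in>J. a j * x j) + s) \<partial>distr P (\<Pi>\<^sub>M n\<in>I. borel) (\<lambda>\<omega>. \<lambda>n\<in>I. Z (n + h) \<omega>))
      = expectation (\<lambda>\<omega>. cos ((\<Sum>j\<in>J. a j * (\<lambda>n\<in>I. Z (n + h) \<omega>) j) + s))"
      by (subst integral_distr) auto
    also have "\<dots> = expectation (\<lambda>\<omega>. cos ((\<Sum>j\<in>J. a j * Z (j + h) \<omega>) + s))"
    proof (rule Bochner_Integration.integral_cong[OF refl])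
      show "cos ((\<Sum>j\<in>J. a j * (\<lambda>n\<in>I. Z (n + h) \<omega>) j) + s) = cos ((\<Sum>j\<in>J. a j * Z (j + h) \<omega>) + s)" for \<omega>
        using J(2) by (intro arg_cong[where f = "\<lambda>y. cos (y + s)"] sum.cong) auto
    qed
    also have "\<dots> = cos s * exp (- scale J a)"
      using J I by (intro expectation_cos_sum_Z) auto
    finally show ?thesis .
  qed
  from this[of h] this[of 0]
  show "(\<integral>x. cos ((\<Sum>j\<in>J. a j * x j) + s) \<partial>distr P (\<Pi>\<^sub>M n\<in>I. borel) (\<lambda>\<omega>. \<lambda>n\<in>I. Z (n + h) \<omega>))
    = (\<integral>x. cos ((\<Sum>j\<in>J. a j * x j) + s) \<partial>distr P (\<Pi>\<^sub>M n\<in>I. borel) (\<lambda>\<omega>. \<lambda>n\<in>I. Z n \<omega>))" by simp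
qed auto

lemma stationary_Z: "stationary P Z"
  unfolding stationary_def same_fdd_def using law_Z_shift by blast

lemma overlap_kernel_sums:
  assumes J: "finite J" "J \<subseteq> {1..}" and L: "finite L" "L \<subseteq> {1..}"
  shows "(\<lambda>k. measure m {z \<in> space m. kernel_sum J a 0 z \<noteq> 0 \<and> kernel_sum L b k z \<noteq> 0}) \<longlonglongrightarrow> 0"
proof -
  have supp: "\<exists>j\<in>J. indicator_kernel A (j + h) z \<noteq> 0" if "kernel_sum J a h z \<noteq> 0" for J a h z
  proof (rule ccontr)
    assume "\<not> ?thesis"
    then have "kernel_sum J a h z = 0" unfolding kernel_sum_def by (intro sum.neutral) auto
    then show False using that by simp
  qed
  have sm: "A.support i \<in> sets m" if "i \<ge> 1" for i by (rule A.support_sets[OF that])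
  have le: "measure m {z \<in> space m. kernel_sum J a 0 z \<noteq> 0 \<and> kernel_sum L b k z \<noteq> 0}
    \<le> (\<Sum>(i, j)\<in>J \<times> L. measure m (A.support i \<inter> A.support (j + k)))" for k
  proof -
    have "measure m {z \<in> space m. kernel_sum J a 0 z \<noteq> 0 \<and> kernel_sum L b k z \<noteq> 0}
      \<le> measure m (\<Union>p\<in>J \<times> L. A.support (fst p) \<inter> A.support (snd p + k))"
    proof (rule measure_mono_fmeasurable)
      show "{z \<in> space m. kernel_sum J a 0 z \<noteq> 0 \<and> kernel_sum L b k z \<noteq> 0} \<subseteq> (\<Union>p\<in>J \<times> L. A.support (fst p) \<inter> A.support (snd p + k))"
        using supp[of J a 0] supp[of L b k] by (fastforce simp: A.support_def)
      have [measurable]: "kernel_sum J a 0 \<in> borel_measurable m" "kernel_sum L b k \<in> borel_measurable m"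
        using simple_integrand_kernel_sum[OF J, of a 0] simple_integrand_kernel_sum[OF L, of b k]
        by (auto simp: simple_integrand_def intro: borel_measurable_simple_function)
      show "{z \<in> space m. kernel_sum J a 0 z \<noteq> 0 \<and> kernel_sum L b k z \<noteq> 0} \<in> sets m" by measurable
      have "(\<Union>p\<in>J \<times> L. A.support (fst p) \<inter> A.support (snd p + k)) \<in> sets m"
        using J L by (intro sets.finite_UN sets.Int sm) auto
      moreover have "emeasure m (\<Union>p\<in>J \<times> L. A.support (fst p) \<inter> A.support (snd p + k)) < \<infinity>"
      proof -
        have "emeasure m (\<Union>p\<in>J \<times> L. A.support (fst p) \<inter> A.support (snd p + k)) \<le> emeasure m (\<Union>i\<in>J. A.support i)"
          using J by (intro emeasure_mono sets.finite_UN sm) auto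
        also have "\<dots> \<le> (\<Sum>i\<in>J. emeasure m (A.support i))"
          using J by (intro emeasure_subadditive_finite image_subsetI sm) auto
        also have "\<dots> < \<infinity>" using J A.support_finite by auto
        finally show ?thesis .
      qed
      ultimately show "(\<Union>p\<in>J \<times> L. A.support (fst p) \<inter> A.support (snd p + k)) \<in> fmeasurable m"
        by (rule fmeasurableI)
    qed
    also have "\<dots> \<le> (\<Sum>p\<in>J \<times> L. measure m (A.support (fst p) \<inter> A.support (snd p + k)))"
      using J L by (intro measure_UNION_le sets.Int sm) auto
    finally show ?thesis by (simp add: case_prod_beta')
  qed
  have "(\<lambda>k. \<Sum>(i, j)\<in>J \<times> L. measure m (A.support i \<inter> A.support (j + k))) \<longlonglongrightarrow> (\<Sum>p\<in>J \<times> L. 0)"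
    unfolding case_prod_beta'
  proof (rule tendsto_sum)
    fix p assume "p \<in> J \<times> L"
    then have "1 \<le> fst p" using J by auto
    from LIMSEQ_ignore_initial_segment[OF A.overlap_tendsto_0[OF this], of "snd p"]
    show "(\<lambda>k. measure m (A.support (fst p) \<inter> A.support (snd p + k))) \<longlonglongrightarrow> 0"
      by (simp add: add.commute)
  qed
  then have lim: "(\<lambda>k. \<Sum>(i, j)\<in>J \<times> L. measure m (A.support i \<inter> A.support (j + k))) \<longlonglongrightarrow> 0" by simp
  show ?thesis by (rule tendsto_sandwich[OF _ _ tendsto_const lim]) (use le in auto)
qed

lemma kernel_sum_bounded: "\<bar>kernel_sum J a h z\<bar> \<le> (\<Sum>j\<in>J. \<bar>a j\<bar>)"
proof -
  have "\<bar>indicator_kernel A n z\<bar> \<le> 1" for n using indicator_kernel_range[of A n z] by auto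
  then have "\<bar>a j * indicator_kernel A (j + h) z\<bar> \<le> \<bar>a j\<bar>" for j
    by (simp add: abs_mult mult_left_le)
  then show ?thesis unfolding kernel_sum_def by (intro order_trans[OF sum_abs] sum_mono) 
qed

lemma combined_norm:
  assumes J: "finite J" "J \<subseteq> {1..}" and L: "finite L" "L \<subseteq> {1..}" and c: "\<bar>c\<bar> = 1"
  shows "(\<lambda>k. \<integral>z. \<bar>kernel_sum J a 0 z + c * kernel_sum L b k z\<bar> powr \<alpha> \<partial>m) \<longlonglongrightarrow> scale J a + scale L b"
proof -
  note sJ = simple_integrand_kernel_sum[OF J, of a 0]
  note sL = simple_integrand_kernel_sum[OF L, of b]
  have "(\<lambda>k. (\<integral>z. \<bar>kernel_sum J a 0 z + c * kernel_sum L b k z\<bar> powr \<alpha> \<partial>m) - (\<integral>z. \<bar>kernel_sum J a 0 z\<bar> powr \<alpha> \<partial>m)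
      - (\<integral>z. \<bar>c * kernel_sum L b k z\<bar> powr \<alpha> \<partial>m)) \<longlonglongrightarrow> 0"
  proof (rule norm_nearly_disjoint[OF sJ kernel_sum_bounded])
    show "simple_integrand m (\<lambda>z. c * kernel_sum L b k z)" for k by (rule simple_integrand_scale[OF sL])
    show "\<bar>c * kernel_sum L b k z\<bar> \<le> (\<Sum>j\<in>L. \<bar>b j\<bar>)" for k z
      using kernel_sum_bounded[of L b k z] c by (simp add: abs_mult)
    show "(\<lambda>k. measure m {z \<in> space m. kernel_sum J a 0 z \<noteq> 0 \<and> c * kernel_sum L b k z \<noteq> 0}) \<longlonglongrightarrow> 0"
    proof -
      have "c \<noteq> 0" using c by auto
      then show ?thesis using overlap_kernel_sums[OF J L, of a b] by simp
    qed
  qed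
  moreover have "(\<integral>z. \<bar>c * kernel_sum L b k z\<bar> powr \<alpha> \<partial>m) = scale L b" for k
    using kernel_sum_norm_shift[OF L, of b k] c by (simp add: abs_mult)
  ultimately have "(\<lambda>k. (\<integral>z. \<bar>kernel_sum J a 0 z + c * kernel_sum L b k z\<bar> powr \<alpha> \<partial>m) - scale J a - scale L b) \<longlonglongrightarrow> 0"
    by (simp add: scale_def)
  from tendsto_add[OF this tendsto_const[of "scale J a + scale L b"]] show ?thesis by simp
qed

text \<open>The sign \<open>c\<close> selects one of the two terms of the product-to-sum formula for cosines.\<close>

lemma combined_cos:
  assumes J: "finite J" "J \<subseteq> {1..}" and L: "finite L" "L \<subseteq> {1..}" and c: "\<bar>c\<bar> = 1"
  shows "(\<lambda>k. expectation (\<lambda>\<omega>. cos (((\<Sum>j\<in>J. a j * Z j \<omega>) + s) + c * ((\<Sum>j\<in>L. b j * Z (j + k) \<omega>) + t))))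
    \<longlonglongrightarrow> cos (s + c * t) * exp (- (scale J a + scale L b))"
proof -
  note sJ = simple_integrand_kernel_sum[OF J, of a 0]
  note sL = simple_integrand_kernel_sum[OF L, of b]
  have "expectation (\<lambda>\<omega>. cos (((\<Sum>j\<in>J. a j * Z j \<omega>) + s) + c * ((\<Sum>j\<in>L. b j * Z (j + k) \<omega>) + t)))
    = cos (s + c * t) * exp (- (\<integral>z. \<bar>kernel_sum J a 0 z + c * kernel_sum L b k z\<bar> powr \<alpha> \<partial>m))" for k
  proof -
    note si = simple_integrand_combine[OF sJ sL, of c k]
    have meas [measurable]: "(\<lambda>\<omega>. \<Sum>j\<in>J. a j * Z j \<omega>) \<in> borel_measurable P" "(\<lambda>\<omega>. \<Sum>j\<in>L. b j * Z (j + k) \<omega>) \<in> borel_measurable P"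
      using sum_Z_measurable[OF J(2), of a 0] sum_Z_measurable[OF L(2), of b k] by simp_all
    have [measurable]: "S (\<lambda>z. kernel_sum J a 0 z + c * kernel_sum L b k z) \<in> borel_measurable P"
      by (rule S_measurable[OF si])
    have "AE \<omega> in P. (\<Sum>j\<in>J. a j * Z j \<omega>) = S (kernel_sum J a 0) \<omega>" using sum_Z_eq[OF J, of a 0] by simp
    then have "AE \<omega> in P. cos (((\<Sum>j\<in>J. a j * Z j \<omega>) + s) + c * ((\<Sum>j\<in>L. b j * Z (j + k) \<omega>) + t))
      = cos (S (\<lambda>z. kernel_sum J a 0 z + c * kernel_sum L b k z) \<omega> + (s + c * t))"
      using sum_Z_eq[OF L, of b k] S_combine[OF sJ sL, of c k]
      by eventually_elim (simp add: algebra_simps)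
    then have "expectation (\<lambda>\<omega>. cos (((\<Sum>j\<in>J. a j * Z j \<omega>) + s) + c * ((\<Sum>j\<in>L. b j * Z (j + k) \<omega>) + t)))
      = expectation (\<lambda>\<omega>. cos (S (\<lambda>z. kernel_sum J a 0 z + c * kernel_sum L b k z) \<omega> + (s + c * t)))"
      by (intro integral_cong_AE) measurable
    then show ?thesis by (simp only: expectation_cos_S[OF si])
  qed
  moreover have "(\<lambda>k. cos (s + c * t) * exp (- (\<integral>z. \<bar>kernel_sum J a 0 z + c * kernel_sum L b k z\<bar> powr \<alpha> \<partial>m)))
    \<longlonglongrightarrow> cos (s + c * t) * exp (- (scale J a + scale L b))"
    by (intro tendsto_intros combined_norm assms)
  ultimately show ?thesis by simp
qed

lemma mixing_Z: "mixing P Z"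
  unfolding mixing_def
proof (intro ballI)
  let ?\<mu> = "path_law P Z"
  have path_meas [measurable]: "(\<lambda>\<omega>. \<lambda>n\<in>{1..}. Z n \<omega>) \<in> measurable P seq_space"
    unfolding seq_space_def by (intro measurable_restrict Z_measurable) auto
  have sets_\<mu>: "sets ?\<mu> = sets (\<Pi>\<^sub>M n\<in>{1..}. borel)" and space_\<mu>: "space ?\<mu> = space seq_space"
    by (simp_all add: path_law_def seq_space_def)
  interpret \<mu>: prob_space ?\<mu> unfolding path_law_def by (rule prob_space_distr[OF path_meas])
  have shift_meas: "left_shift ^^ k \<in> measurable ?\<mu> ?\<mu>" for k
    using left_shift_funpow_measurable[of k] by (simp add: path_law_def)
  have coord: "(\<lambda>x. x j) \<in> borel_measurable seq_space" if "1 \<le> j" for j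
    unfolding seq_space_def by (rule measurable_component_singleton) (use that in auto)
  have cos_meas: "(\<lambda>x. cos ((\<Sum>j\<in>J. a j * x (j + k)) + s)) \<in> borel_measurable seq_space" if "J \<subseteq> {1..}" for J a k s
  proof -
    have [measurable]: "(\<lambda>x. x (j + k)) \<in> borel_measurable seq_space" if "j \<in> J" for j
      using \<open>J \<subseteq> {1..}\<close> that by (intro coord) auto
    show ?thesis by measurable
  qed
  have path_int: "(\<integral>x. f x \<partial>?\<mu>) = expectation (\<lambda>\<omega>. f (\<lambda>n\<in>{1..}. Z n \<omega>))"
    if "f \<in> borel_measurable seq_space" for f :: "(nat \<Rightarrow> real) \<Rightarrow> real"
    unfolding path_law_def by (rule integral_distr[OF path_meas that])
  have restrict_sum: "(\<Sum>j\<in>J. a j * (\<lambda>n\<in>{1..}. Z n \<omega>) (j + k)) = (\<Sum>j\<in>J. a j * Z (j + k) \<omega>)"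
    if "J \<subseteq> {1..}" for J a \<omega> k
    using that by (intro sum.cong) auto
  have shift_sum: "(\<Sum>j\<in>J. a j * (left_shift ^^ k) x j) = (\<Sum>j\<in>J. a j * x (j + k))"
    if "J \<subseteq> {1..}" for J a k x
    using that by (intro sum.cong refl) (auto simp: left_shift_funpow)
  fix U V assume "U \<in> sets seq_space" "V \<in> sets seq_space"
  have "(\<lambda>k. measure ?\<mu> (U \<inter> ((left_shift ^^ k) -` V \<inter> space ?\<mu>))) \<longlonglongrightarrow> measure ?\<mu> U * measure ?\<mu> V"
  proof (rule mixing_from_cosines[OF \<mu>.prob_space_axioms sets_\<mu> shift_meas])
    show "U \<in> sets ?\<mu>" "V \<in> sets ?\<mu>"
      using \<open>U \<in> sets seq_space\<close> \<open>V \<in> sets seq_space\<close> by (simp_all add: path_law_def)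
    show "distr ?\<mu> ?\<mu> (left_shift ^^ k) = ?\<mu>" for k
    proof -
      have "distr ?\<mu> ?\<mu> (left_shift ^^ k) = distr P seq_space ((left_shift ^^ k) \<circ> (\<lambda>\<omega>. \<lambda>n\<in>{1..}. Z n \<omega>))"
        unfolding path_law_def
        by (subst distr_cong[OF refl sets_distr refl]) (rule distr_distr[OF left_shift_funpow_measurable path_meas])
      also have "(left_shift ^^ k) \<circ> (\<lambda>\<omega>. \<lambda>n\<in>{1..}. Z n \<omega>) = (\<lambda>\<omega>. \<lambda>n\<in>{1..}. Z (n + k) \<omega>)"
      proof (intro ext)
        fix \<omega> n
        \<comment> \<open>sequences are undefined at the index 0, and the shift keeps them so\<close>
        have "(left_shift ^^ k) (\<lambda>n\<in>{1..}. Z n \<omega>) n = undefined" if "n = 0"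
          using that by (cases k) (auto simp: left_shift_def)
        then show "((left_shift ^^ k) \<circ> (\<lambda>\<omega>. \<lambda>n\<in>{1..}. Z n \<omega>)) \<omega> n = (\<lambda>n\<in>{1..}. Z (n + k) \<omega>) n"
          by (cases "n = 0") (auto simp: left_shift_funpow)
      qed
      also have "distr P seq_space (\<lambda>\<omega>. \<lambda>n\<in>{1..}. Z (n + k) \<omega>) = ?\<mu>"
        unfolding path_law_def seq_space_def by (rule law_Z_shift) simp
      finally show ?thesis .
    qed
    fix J L :: "nat set" and a b :: "nat \<Rightarrow> real" and s t :: real
    assume J: "finite J" "J \<subseteq> {1..}" and L: "finite L" "L \<subseteq> {1..}"
    have single: "(\<integral>x. cos ((\<Sum>j\<in>J. a j * x j) + s) \<partial>?\<mu>) = cos s * exp (- scale J a)"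
      if "finite J" "J \<subseteq> {1..}" for J a s
      using path_int[OF cos_meas[OF that(2), of a 0 s]] restrict_sum[OF that(2), of a _ 0]
        expectation_cos_sum_Z[OF that, of a 0 s] by simp
    have product_to_sum: "cos u * cos v = (cos (u + 1 * v) + cos (u + (-1) * v)) / 2" for u v :: real
      by (simp add: cos_times_cos)
    have joint: "(\<integral>x. cos ((\<Sum>j\<in>J. a j * x j) + s) * cos ((\<Sum>j\<in>L. b j * (left_shift ^^ k) x j) + t) \<partial>?\<mu>)
      = (expectation (\<lambda>\<omega>. cos (((\<Sum>j\<in>J. a j * Z j \<omega>) + s) + 1 * ((\<Sum>j\<in>L. b j * Z (j + k) \<omega>) + t)))
       + expectation (\<lambda>\<omega>. cos (((\<Sum>j\<in>J. a j * Z j \<omega>) + s) + (-1) * ((\<Sum>j\<in>L. b j * Z (j + k) \<omega>) + t)))) / 2" for k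
    proof -
      have [measurable]: "(\<lambda>\<omega>. \<Sum>j\<in>J. a j * Z j \<omega>) \<in> borel_measurable P" "(\<lambda>\<omega>. \<Sum>j\<in>L. b j * Z (j + k) \<omega>) \<in> borel_measurable P"
        using sum_Z_measurable[OF J(2), of a 0] sum_Z_measurable[OF L(2), of b k] by simp_all
      have "(\<lambda>x. cos ((\<Sum>j\<in>J. a j * x (j + 0)) + s) * cos ((\<Sum>j\<in>L. b j * x (j + k)) + t)) \<in> borel_measurable seq_space"
        by (intro borel_measurable_times cos_meas J L)
      from path_int[OF this]
      have "(\<integral>x. cos ((\<Sum>j\<in>J. a j * x j) + s) * cos ((\<Sum>j\<in>L. b j * (left_shift ^^ k) x j) + t) \<partial>?\<mu>)
        = expectation (\<lambda>\<omega>. cos ((\<Sum>j\<in>J. a j * Z j \<omega>) + s) * cos ((\<Sum>j\<in>L. b j * Z (j + k) \<omega>) + t))"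
        using restrict_sum[OF J(2), of a _ 0] restrict_sum[OF L(2), of b _ k] shift_sum[OF L(2), of b k] by simp
      also have "\<dots> = expectation (\<lambda>\<omega>. (cos (((\<Sum>j\<in>J. a j * Z j \<omega>) + s) + 1 * ((\<Sum>j\<in>L. b j * Z (j + k) \<omega>) + t))
        + cos (((\<Sum>j\<in>J. a j * Z j \<omega>) + s) + (-1) * ((\<Sum>j\<in>L. b j * Z (j + k) \<omega>) + t))) / 2)"
        by (simp only: product_to_sum)
      also have "\<dots> = (expectation (\<lambda>\<omega>. cos (((\<Sum>j\<in>J. a j * Z j \<omega>) + s) + 1 * ((\<Sum>j\<in>L. b j * Z (j + k) \<omega>) + t)))
       + expectation (\<lambda>\<omega>. cos (((\<Sum>j\<in>J. a j * Z j \<omega>) + s) + (-1) * ((\<Sum>j\<in>L. b j * Z (j + k) \<omega>) + t)))) / 2"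
        by (subst integral_divide_zero, subst Bochner_Integration.integral_add)
           (auto intro!: integrable_bounded_cos)
      finally show ?thesis .
    qed
    have "(\<lambda>k. \<integral>x. cos ((\<Sum>j\<in>J. a j * x j) + s) * cos ((\<Sum>j\<in>L. b j * (left_shift ^^ k) x j) + t) \<partial>?\<mu>)
      \<longlonglongrightarrow> (cos (s + 1 * t) * exp (- (scale J a + scale L b)) + cos (s + (-1) * t) * exp (- (scale J a + scale L b))) / 2"
      unfolding joint by (intro tendsto_intros combined_cos J L) auto
    also have "(cos (s + 1 * t) * exp (- (scale J a + scale L b)) + cos (s + (-1) * t) * exp (- (scale J a + scale L b))) / 2
      = (cos s * exp (- scale J a)) * (cos t * exp (- scale L b))"
      by (simp add: cos_add cos_diff exp_add[symmetric] exp_diff exp_minus field_simps)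
    finally show "(\<lambda>k. \<integral>x. cos ((\<Sum>j\<in>J. a j * x j) + s) * cos ((\<Sum>j\<in>L. b j * (left_shift ^^ k) x j) + t) \<partial>?\<mu>)
      \<longlonglongrightarrow> (\<integral>x. cos ((\<Sum>j\<in>J. a j * x j) + s) \<partial>?\<mu>) * (\<integral>x. cos ((\<Sum>j\<in>L. b j * x j) + t) \<partial>?\<mu>)"
      by (simp only: single[OF J] single[OF L])
  qed
  then show "(\<lambda>k. measure ?\<mu> (U \<inter> ((left_shift ^^ k) -` V \<inter> space seq_space))) \<longlonglongrightarrow> measure ?\<mu> U * measure ?\<mu> V"
    by (simp only: space_\<mu>)
qed

end

theorem theorem4p2:
  fixes \<alpha> \<beta> H' :: real
    and P :: "'w measure" and P' :: "'v measure"
    and A :: "real \<Rightarrow> 'v \<Rightarrow> real"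
    and M :: "('v \<times> real) set \<Rightarrow> 'w \<Rightarrow> real"
  assumes "0 < \<alpha>" and "\<alpha> < 2" and "1 < \<beta>" and "\<beta> \<le> 2" and "0 < H'" and "H' < 1"
    and "prob_space P'" and "prob_space P"
    and "sas_process \<beta> P' {0..} A"
    and "non_degenerate P' A"
    and "stationary_increments P' A"
    and "self_similar H' P' A"
    and "sas_random_measure \<alpha> P (P' \<Otimes>\<^sub>M lborel) M"
  shows "sas_process \<alpha> P {1..} (indicator_noise \<alpha> P P' M A)
    \<and> stationary P (indicator_noise \<alpha> P P' M A)
    \<and> mixing P (indicator_noise \<alpha> P P' M A)"
proof -
  interpret indicator_noise_process P \<alpha> P' M \<beta> H' A
    using assms
    by (intro indicator_noise_process.intro stable_measure.intro stable_measure_axioms.intro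
        ssi_stable_process.intro ssi_stable_process_axioms.intro)
  show ?thesis using sas_process_Z stationary_Z mixing_Z by blast
qed

end
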